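(* There is a universal constant $C>0$ with the following property. Let $1<p<\infty$, $p\ne2$, and let $\varphi:\mathbb R^n\to\mathbb R$ be a bounded measurable function (not almost everywhere zero) such that, for some constant $A>0$ and every $\lambda\in\mathbb R$, $\|e^{i\lambda\varphi}\|_{\mathcal M_p}\le A$. Then $\varphi\in\mathcal M_p$ and $$1\le\frac{\|\varphi\|_{\mathcal M_p}}{\|\varphi\|_\infty}\le C A^2.$$
   Context: For a bounded measurable function $m:\mathbb R^n\to\mathbb C$, $T_m$ is the operator defined initially on test functions by $T_mf(x)=\int_{\mathbb R^n}m(\xi)\hat f(\xi)e^{ix\cdot\xi}\,d\xi$, where $\hat f$ is the Fourier transform of $f$ (normalized so that $T_1$ is the identity). For $1\le p<\infty$, $\mathcal M_p=\mathcal M_p(\mathbb R^n)$ is the space of those $m$ for which $T_m$ extends to a bounded operator on $L^p(\mathbb R^n)$, with norm $\|m\|_{\mathcal M_p}=\|T_m\|_{L^p\to L^p}$. *)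

theory Defs
  imports "HOL-Analysis.Analysis" "HOL-Probability.Essential_Supremum"
begin

text \<open>
  The constant of the theorem does not depend on the dimension, so \<open>n\<close> has to be a term rather
  than a type: a point of \<open>\<real>\<^sup>n\<close> is an extensional function on \<open>{..<n}\<close>.
\<close>

definition Rn :: "nat \<Rightarrow> (nat \<Rightarrow> real) set" where
  "Rn n = {..<n} \<rightarrow>\<^sub>E UNIV"

text \<open>The completion makes this Lebesgue (rather than Borel) measure, so that measurability of
  functions below is Lebesgue measurability.\<close>

definition leb_n :: "nat \<Rightarrow> (nat \<Rightarrow> real) measure" where
  "leb_n n = completion (\<Pi>\<^sub>M i\<in>{..<n}. lborel)"

lemma space_leb_n: "space (leb_n n) = Rn n"
  by (simp add: leb_n_def Rn_def space_PiM)

definition dot_n :: "nat \<Rightarrow> (nat \<Rightarrow> real) \<Rightarrow> (nat \<Rightarrow> real) \<Rightarrow> real" where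
  "dot_n n x y = (\<Sum>i<n. x i * y i)"

definition partial_deriv :: "nat \<Rightarrow> ((nat \<Rightarrow> real) \<Rightarrow> complex) \<Rightarrow> (nat \<Rightarrow> real) \<Rightarrow> complex" where
  "partial_deriv i f x = vector_derivative (\<lambda>t. f (x(i := t))) (at (x i))"

primrec iter_partial_deriv ::
    "nat list \<Rightarrow> ((nat \<Rightarrow> real) \<Rightarrow> complex) \<Rightarrow> (nat \<Rightarrow> real) \<Rightarrow> complex" where
  "iter_partial_deriv [] f = f"
| "iter_partial_deriv (j # js) f = partial_deriv j (iter_partial_deriv js f)"

text \<open>Smoothness: the iterated partial derivatives of all orders exist and are continuous.\<close>

definition smooth_n :: "nat \<Rightarrow> ((nat \<Rightarrow> real) \<Rightarrow> complex) \<Rightarrow> bool" where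
  "smooth_n n f \<longleftrightarrow>
    (\<forall>js. set js \<subseteq> {..<n} \<longrightarrow>
       continuous_on (Rn n) (iter_partial_deriv js f) \<and>
       (\<forall>i<n. \<forall>x\<in>Rn n. (\<lambda>t. iter_partial_deriv js f (x(i := t))) differentiable (at (x i))))"

text \<open>The closure is taken in the product topology on \<open>nat \<Rightarrow> real\<close>, in which \<open>Rn n\<close> is a
  closed subset homeomorphic to Euclidean \<open>n\<close>-space.\<close>

definition test_functions :: "nat \<Rightarrow> ((nat \<Rightarrow> real) \<Rightarrow> complex) set" where
  "test_functions n = {f. smooth_n n f \<and> compact (closure {x \<in> Rn n. f x \<noteq> 0})}"

text \<open>The factor \<open>(2\<pi>)\<^sup>-\<^sup>n\<close> is forced by requiring that the multiplier operator of the constant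
  symbol \<open>1\<close> be the identity.\<close>

definition fourier_n :: "nat \<Rightarrow> ((nat \<Rightarrow> real) \<Rightarrow> complex) \<Rightarrow> (nat \<Rightarrow> real) \<Rightarrow> complex" where
  "fourier_n n f \<xi> =
    (\<integral>x. f x * exp (- \<i> * complex_of_real (dot_n n x \<xi>)) \<partial>leb_n n) / complex_of_real ((2 * pi) ^ n)"

definition multiplier_op ::
    "nat \<Rightarrow> ((nat \<Rightarrow> real) \<Rightarrow> complex) \<Rightarrow> ((nat \<Rightarrow> real) \<Rightarrow> complex) \<Rightarrow> (nat \<Rightarrow> real) \<Rightarrow> complex" where
  "multiplier_op n m f x =
    (\<integral>\<xi>. m \<xi> * fourier_n n f \<xi> * exp (\<i> * complex_of_real (dot_n n x \<xi>)) \<partial>leb_n n)"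

text \<open>Elements of \<open>L\<^sup>p(\<real>\<^sup>n)\<close> are represented by functions; identification of almost everywhere
  equal functions is expressed by \<open>AE\<close> where needed.\<close>

definition Lp_space :: "nat \<Rightarrow> real \<Rightarrow> ((nat \<Rightarrow> real) \<Rightarrow> complex) set" where
  "Lp_space n p =
    {f \<in> borel_measurable (leb_n n). integrable (leb_n n) (\<lambda>x. cmod (f x) powr p)}"

definition Lp_norm :: "nat \<Rightarrow> real \<Rightarrow> ((nat \<Rightarrow> real) \<Rightarrow> complex) \<Rightarrow> real" where
  "Lp_norm n p f = (\<integral>x. cmod (f x) powr p \<partial>leb_n n) powr (1 / p)"

definition Linf_norm :: "nat \<Rightarrow> ((nat \<Rightarrow> real) \<Rightarrow> real) \<Rightarrow> real" where
  "Linf_norm n f = real_of_ereal (esssup (leb_n n) (\<lambda>x. ereal \<bar>f x\<bar>))"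

text \<open>That the operator respects almost everywhere equality follows from linearity and
  boundedness.\<close>

definition bounded_Lp_operator ::
    "nat \<Rightarrow> real \<Rightarrow> (((nat \<Rightarrow> real) \<Rightarrow> complex) \<Rightarrow> (nat \<Rightarrow> real) \<Rightarrow> complex) \<Rightarrow> bool" where
  "bounded_Lp_operator n p T \<longleftrightarrow>
    (\<forall>f\<in>Lp_space n p. T f \<in> Lp_space n p) \<and>
    (\<forall>f\<in>Lp_space n p. \<forall>g\<in>Lp_space n p.
       AE x in leb_n n. T (\<lambda>y. f y + g y) x = T f x + T g x) \<and>
    (\<forall>c. \<forall>f\<in>Lp_space n p. AE x in leb_n n. T (\<lambda>y. c * f y) x = c * T f x) \<and>
    (\<exists>B. \<forall>f\<in>Lp_space n p. Lp_norm n p (T f) \<le> B * Lp_norm n p f)"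

definition Lp_operator_norm ::
    "nat \<Rightarrow> real \<Rightarrow> (((nat \<Rightarrow> real) \<Rightarrow> complex) \<Rightarrow> (nat \<Rightarrow> real) \<Rightarrow> complex) \<Rightarrow> real" where
  "Lp_operator_norm n p T =
    Inf {B. 0 \<le> B \<and> (\<forall>f\<in>Lp_space n p. Lp_norm n p (T f) \<le> B * Lp_norm n p f)}"

definition Lp_extension ::
    "nat \<Rightarrow> real \<Rightarrow> ((nat \<Rightarrow> real) \<Rightarrow> complex) \<Rightarrow>
     (((nat \<Rightarrow> real) \<Rightarrow> complex) \<Rightarrow> (nat \<Rightarrow> real) \<Rightarrow> complex) \<Rightarrow> bool" where
  "Lp_extension n p m T \<longleftrightarrow>
    bounded_Lp_operator n p T \<and>
    (\<forall>f\<in>test_functions n. AE x in leb_n n. T f x = multiplier_op n m f x)"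

definition multipliers :: "nat \<Rightarrow> real \<Rightarrow> ((nat \<Rightarrow> real) \<Rightarrow> complex) set" where
  "multipliers n p =
    {m \<in> borel_measurable (leb_n n).
       (\<exists>B. \<forall>\<xi>\<in>Rn n. cmod (m \<xi>) \<le> B) \<and> (\<exists>T. Lp_extension n p m T)}"

text \<open>For \<open>1 \<le> p < \<infinity>\<close> test functions are dense in \<open>L\<^sup>p\<close>, so any two extensions agree almost
  everywhere on every \<open>L\<^sup>p\<close> function and the outer infimum ranges over a single value. It is
  meaningful only for elements of \<^const>\<open>multipliers\<close>.\<close>

definition multiplier_norm :: "nat \<Rightarrow> real \<Rightarrow> ((nat \<Rightarrow> real) \<Rightarrow> complex) \<Rightarrow> real" where
  "multiplier_norm n p m = Inf {Lp_operator_norm n p T | T. Lp_extension n p m T}"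

end

theory Submission
  imports Defs "HOL-Probability.Probability"
begin

text \<open>
  \<^emph>\<open>Upper bound.\<close> For \<open>\<bar>s\<bar> \<le> 1\<close> we have \<open>s = arcsin (sin s) = (\<Sum>k. w k * sin s ^ Suc k)\<close> with
  \<open>w k \<ge> 0\<close> and \<open>(\<Sum>k. w k) \<le> \<pi>/2\<close>, and each power of \<open>sin s\<close> is a combination of functions \<open>exp (\<i> j s)\<close>
  whose coefficients have absolute sum 1. Absolutely convergent combinations of multipliers of norm
  at most \<open>A\<close> are multipliers, so with \<open>s = \<phi> / S\<close>, \<open>S\<close> the supremum norm of \<open>\<phi>\<close>, the multiplier norm of
  \<open>\<phi>\<close> is at most \<open>\<pi>/2 * S * A\<close>.

  \<^emph>\<open>Lower bound.\<close> Let \<open>c\<close> lie in the essential range of a multiplier \<open>m\<close>. Since measurable sets are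
  continuous in measure under translation, some wave packet \<open>f x = exp (\<i> a x) * g (\<epsilon> x)\<close> has its Fourier
  transform concentrated where \<open>m\<close> is close to \<open>c\<close>. Then \<open>T\<^sub>m f\<close> is uniformly close to \<open>c f\<close>, and comparing
  \<open>L\<^sup>p\<close> norms shows that \<open>\<bar>c\<bar>\<close> is at most the multiplier norm of \<open>m\<close>. For \<open>m = \<phi>\<close> this is the lower bound,
  and for \<open>m = 1\<close> it gives \<open>A \<ge> 1\<close>, hence \<open>A \<le> A\<^sup>2\<close>.
\<close>

section \<open>Smooth functions of one variable\<close>


text \<open>The wave packet estimate is uniform in \<open>y\<close> but carries no decay, so by
  itself it does not control an \<open>L^p\<close> norm of \<open>T f - c f\<close>. It is therefore
  integrated only over the cube of side \<open>2 / \<epsilon>\<close> that carries the packet;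
  outside it \<open>c f\<close> vanishes. The measure of this cube and the \<open>p\<close>-th power
  integral of the packet are both multiples of \<open>1 / \<epsilon> ^ n\<close>, so \<epsilon>
  cancels and the uniform error can be made small no matter how small \<epsilon> had to be.

  For the upper bound, the function \<open>arcsin (sin s)\<close> is the triangular wave: a periodic
  function that agrees with \<open>s\<close> near 0 and has absolutely summable Fourier
  coefficients. Going through the Taylor series of arcsin makes the summability a matter of signs:
  the coefficients are nonnegative and their partial sums are bounded by
  \<open>arcsin 1 = pi / 2\<close>, whence the constant. The norms of the problem are nested infima
  over operators, so all combinations are formed from witnesses at a bound \<open>A' > A\<close>,
  and \<open>A'\<close> is sent to \<open>A\<close> only at the very end.\<close>

primrec cdiff :: "nat \<Rightarrow> (real \<Rightarrow> complex) \<Rightarrow> bool" where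
  "cdiff 0 h = True"
| "cdiff (Suc k) h = (\<exists>h'. (\<forall>t. (h has_vector_derivative h' t) (at t)) \<and> cdiff k h')"

text \<open>The order of differentiability is counted by \<open>cdiff\<close>, whose existential
  over \<open>h'\<close> lets every closure property go by induction on \<open>k\<close> with the
  function generalised. A canonical derivative is recovered afterwards by
  \<open>deriv1\<close>.\<close>

definition smooth1 :: "(real \<Rightarrow> complex) \<Rightarrow> bool" where
  "smooth1 h \<longleftrightarrow> (\<forall>k. cdiff k h)"

definition deriv1 :: "(real \<Rightarrow> complex) \<Rightarrow> real \<Rightarrow> complex" where
  "deriv1 h t = vector_derivative h (at t)"

lemma cdiff_SucI:
  "(\<And>t. (h has_vector_derivative h' t) (at t)) \<Longrightarrow> cdiff k h' \<Longrightarrow> cdiff (Suc k) h"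
  by auto

lemma cdiff_SucD: "cdiff (Suc k) h \<Longrightarrow> cdiff k h"
proof (induction k arbitrary: h)
  case (Suc k)
  then obtain h' where "\<forall>t. (h has_vector_derivative h' t) (at t)" "cdiff (Suc k) h'"
    by auto
  with Suc.IH show ?case by auto
qed simp

lemma cdiff_add: "cdiff k f \<Longrightarrow> cdiff k g \<Longrightarrow> cdiff k (\<lambda>t. f t + g t)"
proof (induction k arbitrary: f g)
  case (Suc k)
  from Suc.prems obtain f' g' where
    "\<forall>t. (f has_vector_derivative f' t) (at t)" "cdiff k f'"
    "\<forall>t. (g has_vector_derivative g' t) (at t)" "cdiff k g'" by auto
  with Suc.IH[of f' g'] show ?case
    by (auto intro!: exI[of _ "\<lambda>t. f' t + g' t"] has_vector_derivative_add)
qed simp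

lemma cdiff_mult: "cdiff k f \<Longrightarrow> cdiff k g \<Longrightarrow> cdiff k (\<lambda>t. f t * g t)"
proof (induction k arbitrary: f g)
  case (Suc k)
  from Suc.prems obtain f' g' where d:
    "\<forall>t. (f has_vector_derivative f' t) (at t)" "cdiff k f'"
    "\<forall>t. (g has_vector_derivative g' t) (at t)" "cdiff k g'" by auto
  have "cdiff k f" "cdiff k g" using Suc.prems cdiff_SucD by blast+
  with d Suc.IH have "cdiff k (\<lambda>t. f t * g' t + f' t * g t)"
    by (intro cdiff_add Suc.IH) auto
  with d show ?case
    by (auto intro!: exI[of _ "\<lambda>t. f t * g' t + f' t * g t"] has_vector_derivative_mult)
qed simp

lemma cdiff_const: "cdiff k (\<lambda>t. c)"
  by (induction k arbitrary: c) (auto intro!: exI[of _ "\<lambda>t. 0"])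

lemma cdiff_affine: "cdiff k h \<Longrightarrow> cdiff k (\<lambda>t. h (a + c * t))"
proof (induction k arbitrary: h)
  case (Suc k)
  from Suc.prems obtain h' where d: "\<forall>t. (h has_vector_derivative h' t) (at t)" "cdiff k h'"
    by auto
  have "((\<lambda>t. h (a + c * t)) has_vector_derivative complex_of_real c * h' (a + c * t)) (at t)" for t
  proof -
    have "((\<lambda>t. a + c * t) has_vector_derivative c) (at t)"
      unfolding has_real_derivative_iff_has_vector_derivative[symmetric]
      by (auto intro!: derivative_eq_intros)
    from vector_diff_chain_at[OF this, of h "h' (a + c * t)"] d show ?thesis
      by (auto simp: o_def scaleR_conv_of_real)
  qed
  moreover have "cdiff k (\<lambda>t. complex_of_real c * h' (a + c * t))"
    using cdiff_mult[OF cdiff_const Suc.IH[OF d(2)]] .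
  ultimately show ?case by (rule cdiff_SucI)
qed simp

lemma smooth1_mult: "smooth1 f \<Longrightarrow> smooth1 g \<Longrightarrow> smooth1 (\<lambda>t. f t * g t)"
  and smooth1_affine: "smooth1 f \<Longrightarrow> smooth1 (\<lambda>t. f (a + c * t))"
  by (auto simp: smooth1_def cdiff_mult cdiff_affine)

lemma smooth1_exp: "smooth1 (\<lambda>t. exp (\<i> * complex_of_real (a * t)))"
proof -
  \<comment> \<open>The prefactor \<open>c\<close> has to be arbitrary because each derivative
    multiplies it by \<open>\<i> * a\<close>.\<close>
  have "cdiff k (\<lambda>t. c * exp (\<i> * complex_of_real (a * t)))" for k c
  proof (induction k arbitrary: c)
    case (Suc k)
    have "((\<lambda>t. c * exp (\<i> * complex_of_real (a * t))) has_vector_derivative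
        (c * (\<i> * a)) * exp (\<i> * complex_of_real (a * t))) (at t)" for t
      by (rule has_vector_derivative_real_field[where f="\<lambda>z. c * exp (\<i> * (a * z))", simplified of_real_mult[symmetric], unfolded of_real_mult[symmetric]])
         (auto intro!: derivative_eq_intros)
    then show ?case using Suc[of "c * (\<i> * a)"] by (rule cdiff_SucI)
  qed simp
  from this[of _ 1] show ?thesis by (simp add: smooth1_def)
qed

lemma smooth1_has_deriv: "smooth1 h \<Longrightarrow> (h has_vector_derivative deriv1 h t) (at t)"
  unfolding deriv1_def smooth1_def
  by (metis cdiff.simps(2) vector_derivative_works differentiableI_vector)

lemma smooth1_deriv1: assumes "smooth1 h" shows "smooth1 (deriv1 h)"
  unfolding smooth1_def
proof
  fix k
  from assms have "cdiff (Suc k) h" by (simp add: smooth1_def)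
  then obtain h' where d: "\<forall>t. (h has_vector_derivative h' t) (at t)" "cdiff k h'" by auto
  then have "deriv1 h = h'"
    by (auto simp: deriv1_def fun_eq_iff intro: vector_derivative_at)
  with d show "cdiff k (deriv1 h)" by simp
qed

lemma smooth1_continuous: "smooth1 h \<Longrightarrow> continuous_on UNIV h"
  using smooth1_has_deriv has_vector_derivative_continuous
  by (metis continuous_at_imp_continuous_on)

text \<open>The standard functions that are flat at 0. The polynomial parameter makes the family
  closed under differentiation, so all orders of smoothness follow from one induction over arbitrary
  \<open>P\<close>.\<close>

definition flat_fun :: "real poly \<Rightarrow> real \<Rightarrow> real" where
  "flat_fun P t = (if t > 0 then poly P (1 / t) * exp (- 1 / t) else 0)"

lemma poly_times_exp_minus_tendsto_0:
  "((\<lambda>u. poly P u * exp (- u)) \<longlongrightarrow> 0) (at_top :: real filter)"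
proof -
  have "((\<lambda>u. \<Sum>i\<le>degree P. coeff P i * (u ^ i / exp u)) \<longlongrightarrow> (\<Sum>i\<le>degree P. coeff P i * 0)) at_top"
    by (intro tendsto_intros tendsto_power_div_exp_0)
  then show ?thesis
    by (simp add: poly_altdef exp_minus divide_inverse sum_distrib_left mult_ac)
qed

text \<open>With \<open>u = 1/t\<close> the derivative of \<open>P(u) exp (-u)\<close> in \<open>t\<close> is \<open>u\<^sup>2 (P(u) - P'(u)) exp (-u)\<close>.\<close>

lemma flat_fun_deriv:
  "(flat_fun P has_real_derivative flat_fun ([:0, 0, 1:] * (P - pderiv P)) t) (at t)"
proof -
  consider "t > 0" | "t < 0" | "t = 0" by linarith
  then show ?thesis
  proof cases
    case 1
    have "((\<lambda>t. poly P (1 / t) * exp (- 1 / t)) has_real_derivative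
        poly ([:0, 0, 1:] * (P - pderiv P)) (1 / t) * exp (- 1 / t)) (at t)"
      using 1 by (auto intro!: derivative_eq_intros simp: field_simps power2_eq_square)
    then have "(flat_fun P has_real_derivative
        poly ([:0, 0, 1:] * (P - pderiv P)) (1 / t) * exp (- 1 / t)) (at t)"
      by (rule DERIV_cong_ev[THEN iffD1, rotated -1])
         (use 1 in \<open>auto simp: flat_fun_def intro!: eventually_mono[OF eventually_nhds_in_open[of "{0<..}"]]\<close>)
    then show ?thesis using 1 by (simp add: flat_fun_def)
  next
    case 2
    have "(flat_fun P has_real_derivative 0) (at t)"
      by (rule DERIV_cong_ev[THEN iffD1, OF refl _ refl, rotated], rule DERIV_const[of 0])
         (use 2 in \<open>auto simp: flat_fun_def intro!: eventually_mono[OF eventually_nhds_in_open[of "{..<0}"]]\<close>)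
    then show ?thesis using 2 by (simp add: flat_fun_def)
  next
    case 3
    have "((\<lambda>h. flat_fun P h / h) \<longlongrightarrow> 0) (at 0)"
    proof (rule filterlim_split_at)
      show "((\<lambda>h. flat_fun P h / h) \<longlongrightarrow> 0) (at_left 0)"
        by (rule tendsto_eventually) (auto simp: eventually_at_filter flat_fun_def)
      \<comment> \<open>In terms of \<open>u = 1 / h\<close>, dividing by \<open>h\<close>
        multiplies the polynomial by \<open>u\<close>, and \<open>exp (- u)\<close> still
        wins.\<close>
      have "((\<lambda>h. poly ([:0, 1:] * P) (inverse h) * exp (- inverse h)) \<longlongrightarrow> 0) (at_right (0::real))"
        by (rule filterlim_compose[OF poly_times_exp_minus_tendsto_0 filterlim_inverse_at_top_right])
      then show "((\<lambda>h. flat_fun P h / h) \<longlongrightarrow> 0) (at_right 0)"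
        by (rule Lim_transform_eventually)
           (auto simp: eventually_at_filter flat_fun_def field_simps)
    qed
    with 3 show ?thesis by (simp add: DERIV_def flat_fun_def)
  qed
qed

lemma smooth1_flat_fun: "smooth1 (\<lambda>t. complex_of_real (flat_fun P t))"
proof -
  have "cdiff k (\<lambda>t. complex_of_real (flat_fun P t))" for k
  proof (induction k arbitrary: P)
    case (Suc k)
    have "((\<lambda>t. complex_of_real (flat_fun P t)) has_vector_derivative
        complex_of_real (flat_fun ([:0, 0, 1:] * (P - pderiv P)) t)) (at t)" for t
      using flat_fun_deriv[of P t] by (simp add: has_vector_derivative_of_real has_real_derivative_iff_has_vector_derivative)
    then show ?case using Suc by (rule cdiff_SucI)
  qed simp
  then show ?thesis by (simp add: smooth1_def)
qed

text \<open>On the interval from -1 to 1 this is \<open>exp (- 2 / (1 - t ^ 2))\<close>. The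
  arguments \<open>1 + 1 * t\<close> and \<open>1 + (- 1) * t\<close> have the shape
  \<open>a + c * t\<close> that \<open>smooth1_affine\<close> matches.\<close>

definition bump :: "real \<Rightarrow> complex" where
  "bump t = complex_of_real (flat_fun 1 (1 + 1 * t)) * complex_of_real (flat_fun 1 (1 + (- 1) * t))"

lemma smooth1_bump: "smooth1 bump"
  unfolding bump_def
  by (intro smooth1_mult smooth1_affine[of "\<lambda>t. complex_of_real (flat_fun 1 t)"] smooth1_flat_fun)

lemma bump_eq_0: "\<bar>t\<bar> \<ge> 1 \<Longrightarrow> bump t = 0"
  by (auto simp: bump_def flat_fun_def)

lemma bump_nonzero: "\<bar>t\<bar> < 1 \<Longrightarrow> bump t \<noteq> 0"
  by (auto simp: bump_def flat_fun_def)

section \<open>The Fourier transform on the line\<close>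


definition fourier1 :: "(real \<Rightarrow> complex) \<Rightarrow> real \<Rightarrow> complex" where
  "fourier1 h \<xi> = (\<integral>t. h t * exp (- \<i> * complex_of_real (t * \<xi>)) \<partial>lborel) / complex_of_real (2 * pi)"

lemma integrable_continuous_support:
  fixes h :: "real \<Rightarrow> 'b::{banach, second_countable_topology}"
  assumes "continuous_on UNIV h" "\<And>t. R < \<bar>t\<bar> \<Longrightarrow> h t = 0"
  shows "integrable lborel h"
proof -
  have "integrable lborel (\<lambda>x. indicator {-R..R} x *\<^sub>R h x)"
    by (rule borel_integrable_compact) (auto intro: continuous_on_subset[OF assms(1)])
  also have "(\<lambda>x. indicator {-R..R} x *\<^sub>R h x) = h"
    using assms(2) by (force simp: fun_eq_iff indicator_def abs_if split: if_splits)
  finally show ?thesis .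
qed

lemma integrable_mult_unimodular:
  fixes h u :: "'a \<Rightarrow> complex"
  assumes "integrable M h" "u \<in> borel_measurable M" "\<And>x. cmod (u x) = 1"
  shows "integrable M (\<lambda>x. h x * u x)"
  by (rule Bochner_Integration.integrable_bound[OF assms(1)]) (use assms in \<open>auto simp: norm_mult\<close>)

lemma has_vector_derivative_zero_outside:
  fixes h :: "real \<Rightarrow> complex"
  assumes s: "\<And>t. R < \<bar>t\<bar> \<Longrightarrow> h t = 0" and t: "R < \<bar>t\<bar>" and d: "(h has_vector_derivative c) (at t)"
  shows "c = 0"
proof -
  have "open {t::real. R < \<bar>t\<bar>}" by (intro open_Collect_less continuous_intros)
  then have "(h has_vector_derivative 0) (at t)"
    using t s by (intro has_vector_derivative_transform_within_open[of "\<lambda>_. 0" 0 t "{t. R < \<bar>t\<bar>}" h]) auto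
  with d show ?thesis using vector_derivative_unique_at by blast
qed

text \<open>Integration by parts: the derivative of \<open>h * e\<close> integrates to 0 over an
  interval whose ends lie outside the support.\<close>

lemma integral_deriv_exp:
  assumes d: "\<And>t. (h has_vector_derivative h' t) (at t)"
    and c: "continuous_on UNIV h'" and s: "\<And>t. R < \<bar>t\<bar> \<Longrightarrow> h t = 0"
  shows "(\<integral>t. h' t * exp (- \<i> * complex_of_real (t * \<xi>)) \<partial>lborel) =
    \<i> * complex_of_real \<xi> * (\<integral>t. h t * exp (- \<i> * complex_of_real (t * \<xi>)) \<partial>lborel)"
proof -
  \<comment> \<open>Strictly above \<open>R\<close>, because \<open>h\<close> is known to vanish
    only where \<open>R < \<bar>t\<bar>\<close>, and positive, because \<open>R\<close> may be
    negative.\<close>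
  define R' where "R' = max R 0 + 1"
  define e where "e = (\<lambda>t. exp (- \<i> * complex_of_real (t * \<xi>)))"
  have R': "R' > R" "R' > 0" by (auto simp: R'_def)
  have s': "h' t = 0" if "R < \<bar>t\<bar>" for t
    using has_vector_derivative_zero_outside[OF s that d] .
  have ch: "continuous_on UNIV h"
    using d has_vector_derivative_continuous by (metis continuous_at_imp_continuous_on)
  have ce: "continuous_on UNIV e" unfolding e_def by (intro continuous_intros)
  have de: "(e has_vector_derivative (- \<i> * \<xi>) * e t) (at t)" for t
    unfolding e_def of_real_mult
    by (rule has_vector_derivative_real_field[where f="\<lambda>z. exp (- \<i> * (z * \<xi>))"])
       (auto intro!: derivative_eq_intros)
  have dF: "((\<lambda>t. h t * e t) has_vector_derivative h t * ((- \<i> * \<xi>) * e t) + h' t * e t) (at t)" for t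
    by (rule has_vector_derivative_mult[OF d de])
  have i1: "integrable lborel (\<lambda>t. h t * e t)"
    using ch ce s by (intro integrable_continuous_support[of _ R] continuous_intros) auto
  have i2: "integrable lborel (\<lambda>t. h' t * e t)"
    using c ce s' by (intro integrable_continuous_support[of _ R] continuous_intros) auto
  have "has_bochner_integral lborel
     (\<lambda>x. indicator {-R'..R'} x *\<^sub>R (h x * ((- \<i> * \<xi>) * e x) + h' x * e x)) (h R' * e R' - h (-R') * e (-R'))"
    using R' dF ch ce c by (intro has_bochner_integral_FTC_Icc)
       (auto intro!: continuous_intros intro: has_vector_derivative_at_within continuous_on_subset)
  moreover have "(\<lambda>x. indicator {-R'..R'} x *\<^sub>R (h x * ((- \<i> * \<xi>) * e x) + h' x * e x)) =
      (\<lambda>x. h' x * e x - \<i> * \<xi> * (h x * e x))"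
  proof
    fix x show "indicator {-R'..R'} x *\<^sub>R (h x * ((- \<i> * \<xi>) * e x) + h' x * e x) =
      h' x * e x - \<i> * \<xi> * (h x * e x)"
      using s[of x] s'[of x] R' by (cases "\<bar>x\<bar> \<le> R'") (auto simp: indicator_def abs_le_iff)
  qed
  moreover have "h R' = 0" "h (-R') = 0" using s R' by auto
  ultimately have "(\<integral>x. h' x * e x - \<i> * \<xi> * (h x * e x) \<partial>lborel) = 0"
    by (simp add: has_bochner_integral_iff)
  then show ?thesis using i1 i2 by (simp add: e_def)
qed

lemma fourier1_measurable: "continuous_on UNIV h \<Longrightarrow> fourier1 h \<in> borel_measurable borel"
proof -
  assume "continuous_on UNIV h"
  then have [measurable]: "h \<in> borel_measurable borel" by (rule borel_measurable_continuous_onI)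
  show ?thesis unfolding fourier1_def
    using lborel.borel_measurable_lebesgue_integral[of "\<lambda>\<xi> t. h t * exp (- \<i> * complex_of_real (t * \<xi>))" borel]
    by (intro borel_measurable_divide) auto
qed

lemma integrable_inverse_one_plus_square: "integrable lborel (\<lambda>x::real. inverse (1 + x\<^sup>2))"
  using integrable_inverse_1_plus_square
  by (simp add: set_integrable_def)

text \<open>Two integrations by parts show that the transform of \<open>h - h''\<close> is
  \<open>1 + \<xi>^2\<close> times that of \<open>h\<close>. Since the former is bounded, the latter
  decays like \<open>1 / (1 + \<xi>^2)\<close>.\<close>

lemma fourier1_integrable:
  assumes "smooth1 h" "\<And>t. R < \<bar>t\<bar> \<Longrightarrow> h t = 0"
  shows "integrable lborel (fourier1 h)"
proof -
  define e where "e = (\<lambda>\<xi> t. exp (- \<i> * complex_of_real (t * \<xi>)))"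
  note sm = assms(1) smooth1_deriv1[OF assms(1)] smooth1_deriv1[OF smooth1_deriv1[OF assms(1)]]
  note c = sm[THEN smooth1_continuous]
  have s1: "deriv1 g t = 0" if "\<And>t. R < \<bar>t\<bar> \<Longrightarrow> g t = 0" "R < \<bar>t\<bar>" "smooth1 g" for t g
    using has_vector_derivative_zero_outside[OF that(1,2) smooth1_has_deriv[OF that(3)]] .
  have s: "deriv1 h t = 0" "deriv1 (deriv1 h) t = 0" if "R < \<bar>t\<bar>" for t
    using s1[OF assms(2) that assms(1)] s1[OF s1[OF assms(2) _ assms(1)] that sm(2)] by auto
  have i: "integrable lborel h" "integrable lborel (deriv1 (deriv1 h))"
    using c s assms by (auto intro!: integrable_continuous_support[of _ R])
  have em: "e \<xi> \<in> borel_measurable lborel" and en: "cmod (e \<xi> t) = 1" for \<xi> t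
    by (auto simp: e_def)
  have ie: "integrable lborel (\<lambda>t. h t * e \<xi> t)" "integrable lborel (\<lambda>t. deriv1 (deriv1 h) t * e \<xi> t)" for \<xi>
    by (auto intro!: integrable_mult_unimodular i em en)
  have "(\<integral>t. deriv1 (deriv1 h) t * e \<xi> t \<partial>lborel) = \<i> * \<xi> * (\<i> * \<xi> * (\<integral>t. h t * e \<xi> t \<partial>lborel))" for \<xi>
    unfolding e_def
    using integral_deriv_exp[of h "deriv1 h" R \<xi>] integral_deriv_exp[of "deriv1 h" "deriv1 (deriv1 h)" R \<xi>]
      smooth1_has_deriv sm c s assms by simp
  then have eq: "(\<integral>t. (h t - deriv1 (deriv1 h) t) * e \<xi> t \<partial>lborel) = complex_of_real (1 + \<xi>\<^sup>2) * (\<integral>t. h t * e \<xi> t \<partial>lborel)" for \<xi>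
    using ie[of \<xi>] by (simp add: left_diff_distrib algebra_simps power2_eq_square)
  define C where "C = (\<integral>t. cmod (h t - deriv1 (deriv1 h) t) \<partial>lborel)"
  have bnd: "cmod (fourier1 h \<xi>) \<le> C / (2 * pi) * inverse (1 + \<xi>\<^sup>2)" for \<xi>
  proof -
    have "(1 + \<xi>\<^sup>2) * cmod (\<integral>t. h t * e \<xi> t \<partial>lborel) = cmod (\<integral>t. (h t - deriv1 (deriv1 h) t) * e \<xi> t \<partial>lborel)"
    proof -
      have "cmod (complex_of_real (1 + \<xi>\<^sup>2)) = 1 + \<xi>\<^sup>2"
        unfolding norm_of_real by simp
      then show ?thesis unfolding eq norm_mult by simp
    qed
    also have "\<dots> \<le> (\<integral>t. cmod ((h t - deriv1 (deriv1 h) t) * e \<xi> t) \<partial>lborel)"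
      by (rule integral_norm_bound)
    also have "\<dots> = C" by (simp add: C_def norm_mult en)
    finally have "cmod (\<integral>t. h t * e \<xi> t \<partial>lborel) \<le> C / (1 + \<xi>\<^sup>2)"
      by (simp add: pos_le_divide_eq add_pos_nonneg mult.commute)
    then have "cmod (\<integral>t. h t * e \<xi> t \<partial>lborel) / (2 * pi) \<le> C / (1 + \<xi>\<^sup>2) / (2 * pi)"
      by (rule divide_right_mono) simp
    moreover have "cmod (fourier1 h \<xi>) = cmod (\<integral>t. h t * e \<xi> t \<partial>lborel) / (2 * pi)"
      by (simp add: fourier1_def e_def norm_divide norm_mult)
    ultimately show ?thesis by (simp only: divide_inverse mult_ac)
  qed
  have "integrable lborel (\<lambda>\<xi>. C / (2 * pi) * inverse (1 + \<xi>\<^sup>2))"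
    by (rule integrable_mult_right[OF integrable_inverse_one_plus_square])
  then show ?thesis
  proof (rule Bochner_Integration.integrable_bound)
    show "AE \<xi> in lborel. norm (fourier1 h \<xi>) \<le> norm (C / (2 * pi) * inverse (1 + \<xi>\<^sup>2))"
      using bnd by (intro AE_I2) (metis abs_ge_self order_trans real_norm_def)
  qed (use fourier1_measurable[OF c(1)] in simp)
qed

section \<open>Fourier inversion by Gaussian summation\<close>

lemma integral_std_normal_char:
  "(\<integral>x. exp (\<i> * complex_of_real (s * x)) * std_normal_density x \<partial>lborel) = exp (- (s\<^sup>2) / 2)"
proof -
  have "exp (- (s\<^sup>2) / 2) = char std_normal_distribution s"
    by (simp add: char_std_normal_distribution)
  also have "\<dots> = (\<integral>x. std_normal_density x *\<^sub>R exp (\<i> * complex_of_real (s * x)) \<partial>lborel)"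
    unfolding char_def by (subst integral_density) auto
  finally show ?thesis by (simp add: scaleR_conv_of_real mult.commute)
qed

text \<open>A rescaling of \<open>integral_std_normal_char\<close>. As a function of
  \<open>s\<close> the right-hand side is \<open>sqrt (2 * pi)\<close> times a probability density
  of width \<delta>, the approximate identity behind the inversion formula.\<close>

lemma integral_gauss_kernel:
  assumes "\<delta> > 0"
  shows "(\<integral>\<xi>. exp (\<i> * complex_of_real (s * \<xi>)) * std_normal_density (\<delta> * \<xi>) \<partial>lborel) =
    complex_of_real (sqrt (2 * pi) / \<delta> * std_normal_density (s / \<delta>))"
proof -
  have "(\<integral>\<xi>. exp (\<i> * complex_of_real (s / \<delta> * \<xi>)) * std_normal_density \<xi> \<partial>lborel) =
     \<bar>\<delta>\<bar> *\<^sub>R (\<integral>\<xi>. exp (\<i> * complex_of_real (s / \<delta> * (0 + \<delta> * \<xi>))) * std_normal_density (0 + \<delta> * \<xi>) \<partial>lborel)"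
    using assms by (intro lborel_integral_real_affine) auto
  then have "\<delta> * (\<integral>\<xi>. exp (\<i> * complex_of_real (s * \<xi>)) * std_normal_density (\<delta> * \<xi>) \<partial>lborel)
     = exp (- ((s/\<delta>)\<^sup>2) / 2)"
    using assms unfolding integral_std_normal_char by (simp add: scaleR_conv_of_real)
  then show ?thesis using assms
    by (simp add: std_normal_density_def field_simps exp_of_real[symmetric])
qed

text \<open>Inserting the factor \<open>exp (- (\<delta> \<xi>)\<^sup>2 / 2)\<close> turns the integral into the mean of \<open>h (y + \<delta> z)\<close> over a
  standard normal \<open>z\<close>; then let \<open>\<delta>\<close> tend to 0.\<close>

lemma fourier1_inversion:
  assumes c: "continuous_on UNIV h" and s: "\<And>t. R < \<bar>t\<bar> \<Longrightarrow> h t = 0"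
    and i: "integrable lborel (fourier1 h)"
  shows "(\<integral>\<xi>. fourier1 h \<xi> * exp (\<i> * complex_of_real (y * \<xi>)) \<partial>lborel) = h y"
proof -
  have [measurable]: "h \<in> borel_measurable borel" using c by (rule borel_measurable_continuous_onI)
  have [measurable]: "fourier1 h \<in> borel_measurable borel" using c by (rule fourier1_measurable)
  have ih: "integrable lborel h" using c s by (rule integrable_continuous_support)
  define \<delta> where "\<delta> = (\<lambda>k::nat. 1 / real (Suc k))"
  have \<delta>: "\<delta> k > 0" for k by (simp add: \<delta>_def)
  have \<delta>0: "\<delta> \<longlonglongrightarrow> 0"
    unfolding \<delta>_def by (rule LIMSEQ_Suc[OF lim_1_over_n])
  \<comment> \<open>The factor \<open>sqrt (2 * pi)\<close> gives the Gaussian the value 1 at 0, so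
    that \<open>w k\<close> is bounded by 1 and tends to 1.\<close>
  define w where "w = (\<lambda>k \<xi>. complex_of_real (sqrt (2 * pi) * std_normal_density (\<delta> k * \<xi>)))"
  have w1: "cmod (w k \<xi>) \<le> 1" for k \<xi>
    by (simp add: w_def std_normal_density_def norm_mult)
  have wm[measurable]: "w k \<in> borel_measurable borel" for k unfolding w_def by measurable
  have w0: "(\<lambda>k. w k \<xi>) \<longlonglongrightarrow> 1" for \<xi>
  proof -
    have "(\<lambda>k. complex_of_real (sqrt (2 * pi) * (1 / sqrt (2 * pi) * exp (- (\<delta> k * \<xi>)\<^sup>2 / 2)))) \<longlonglongrightarrow>
      complex_of_real (sqrt (2 * pi) * (1 / sqrt (2 * pi) * exp (- (0 * \<xi>)\<^sup>2 / 2)))"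
      by (intro tendsto_intros \<delta>0) simp
    then show ?thesis by (simp add: w_def std_normal_density_def)
  qed
  have wi: "integrable lborel (w k)" for k
  proof -
    have "integrable lborel (\<lambda>x. std_normal_density (0 + \<delta> k * x))"
      using \<delta>[of k] integrable_std_normal_moment[of 0]
      by (intro lborel_integrable_real_affine) auto
    then show ?thesis unfolding w_def
      by (intro integrable_of_real integrable_mult_right) simp
  qed
  have L: "(\<lambda>k. \<integral>\<xi>. fourier1 h \<xi> * exp (\<i> * complex_of_real (y * \<xi>)) * w k \<xi> \<partial>lborel) \<longlonglongrightarrow>
     (\<integral>\<xi>. fourier1 h \<xi> * exp (\<i> * complex_of_real (y * \<xi>)) * 1 \<partial>lborel)"
  proof (rule integral_dominated_convergence[where w="\<lambda>\<xi>. cmod (fourier1 h \<xi>)"])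
    show "AE \<xi> in lborel. (\<lambda>k. fourier1 h \<xi> * exp (\<i> * complex_of_real (y * \<xi>)) * w k \<xi>)
       \<longlonglongrightarrow> fourier1 h \<xi> * exp (\<i> * complex_of_real (y * \<xi>)) * 1"
      by (intro AE_I2 tendsto_mult w0 tendsto_const)
    show "AE \<xi> in lborel. cmod (fourier1 h \<xi> * exp (\<i> * complex_of_real (y * \<xi>)) * w k \<xi>) \<le> cmod (fourier1 h \<xi>)" for k
      using w1 by (simp add: norm_mult mult_left_le)
    show "integrable lborel (\<lambda>\<xi>. cmod (fourier1 h \<xi>))" using i by simp
  qed measurable
  obtain B where B: "\<And>t. cmod (h t) \<le> B"
  proof -
    have "compact (h ` {-R..R})" by (intro compact_continuous_image continuous_on_subset[OF c]) auto
    then obtain B where "\<And>t. t \<in> {-R..R} \<Longrightarrow> cmod (h t) \<le> B"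
      using compact_imp_bounded bounded_iff by (metis imageI)
    then have "cmod (h t) \<le> max B 0" for t
      using s[of t] by (cases "\<bar>t\<bar> \<le> R") (auto simp: abs_le_iff le_max_iff_disj)
    then show ?thesis using that by blast
  qed
  have "(\<lambda>k. \<integral>z. h (y + \<delta> k * z) * std_normal_density z \<partial>lborel) \<longlonglongrightarrow>
     (\<integral>z. h (y + 0 * z) * std_normal_density z \<partial>lborel)"
  proof (rule integral_dominated_convergence[where w="\<lambda>z. B * std_normal_density z"])
    show "integrable lborel (\<lambda>z. B * std_normal_density z)"
      using integrable_std_normal_moment[of 0] by simp
    have "(\<lambda>k. y + \<delta> k * z) \<longlonglongrightarrow> y + 0 * z" for z
      by (intro tendsto_intros \<delta>0)
    then have "(\<lambda>k. h (y + \<delta> k * z)) \<longlonglongrightarrow> h (y + 0 * z)" for z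
      by (rule continuous_on_tendsto_compose[OF c _ UNIV_I]) simp
    then show "AE z in lborel. (\<lambda>k. h (y + \<delta> k * z) * std_normal_density z) \<longlonglongrightarrow> h (y + 0 * z) * std_normal_density z"
      by (intro AE_I2 tendsto_intros)
    show "\<And>k. AE z in lborel. cmod (h (y + \<delta> k * z) * std_normal_density z) \<le> B * std_normal_density z"
      using B by (auto simp: norm_mult intro!: mult_right_mono)
  qed measurable
  also have "(\<integral>z. h (y + 0 * z) * std_normal_density z \<partial>lborel) = h y"
    using integral_std_normal_char[of 0] by simp
  finally have R: "(\<lambda>k. \<integral>z. h (y + \<delta> k * z) * std_normal_density z \<partial>lborel) \<longlonglongrightarrow> h y" .
  have "(\<integral>\<xi>. fourier1 h \<xi> * exp (\<i> * complex_of_real (y * \<xi>)) * w k \<xi> \<partial>lborel) =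
     (\<integral>z. h (y + \<delta> k * z) * std_normal_density z \<partial>lborel)" for k
  proof -
    \<comment> \<open>The weight makes the double integrand absolutely integrable and Fubini
      applicable; without it the inner integral over \<xi> would diverge.\<close>
    define F where "F = (\<lambda>t \<xi>. h t * (exp (\<i> * complex_of_real ((y - t) * \<xi>)) * w k \<xi>))"
    have [measurable]: "case_prod F \<in> borel_measurable (lborel \<Otimes>\<^sub>M lborel)"
      unfolding F_def by measurable
    have nF: "cmod (F t \<xi>) = cmod (h t) * cmod (w k \<xi>)" for t \<xi>
      by (simp add: F_def norm_mult)
    have iF: "integrable (lborel \<Otimes>\<^sub>M lborel) (case_prod F)"
    proof (rule lborel_pair.Fubini_integrable)
      show "integrable lborel (\<lambda>t. \<integral>\<xi>. cmod (case (t, \<xi>) of (x, xa) \<Rightarrow> F x xa) \<partial>lborel)"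
        using ih by (simp add: nF)
      have "integrable lborel (F t)" for t
        unfolding F_def using integrable_mult_unimodular[OF wi[of k], of "\<lambda>\<xi>. exp (\<i> * complex_of_real ((y - t) * \<xi>))"]
        by (intro integrable_mult_right) (simp add: mult.commute)
      then show "AE t in lborel. integrable lborel (\<lambda>\<xi>. case (t, \<xi>) of (x, xa) \<Rightarrow> F x xa)" by simp
    qed measurable
    have "(\<integral>\<xi>. fourier1 h \<xi> * exp (\<i> * complex_of_real (y * \<xi>)) * w k \<xi> \<partial>lborel) =
        (\<integral>\<xi>. (\<integral>t. F t \<xi> \<partial>lborel) / complex_of_real (2 * pi) \<partial>lborel)"
    proof (rule Bochner_Integration.integral_cong[OF refl])
      fix \<xi>
      have "F t \<xi> = h t * exp (- \<i> * complex_of_real (t * \<xi>)) * (exp (\<i> * complex_of_real (y * \<xi>)) * w k \<xi>)" for t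
        by (simp add: F_def mult_exp_exp left_diff_distrib right_diff_distrib exp_diff exp_minus field_simps)
      then show "fourier1 h \<xi> * exp (\<i> * complex_of_real (y * \<xi>)) * w k \<xi> =
         (\<integral>t. F t \<xi> \<partial>lborel) / complex_of_real (2 * pi)"
        by (simp add: fourier1_def)
    qed
    also have "\<dots> = (\<integral>\<xi>. (\<integral>t. F t \<xi> \<partial>lborel) \<partial>lborel) / complex_of_real (2 * pi)"
      by simp
    also have "(\<integral>\<xi>. (\<integral>t. F t \<xi> \<partial>lborel) \<partial>lborel) = (\<integral>t. (\<integral>\<xi>. F t \<xi> \<partial>lborel) \<partial>lborel)"
      by (rule lborel_pair.Fubini_integral[OF iF])
    also have "(\<lambda>t. \<integral>\<xi>. F t \<xi> \<partial>lborel) = (\<lambda>t. h t * complex_of_real (2 * pi / \<delta> k * std_normal_density ((y - t) / \<delta> k)))"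
    proof
      fix t
      have "(\<integral>\<xi>. F t \<xi> \<partial>lborel) = h t * (\<integral>\<xi>. complex_of_real (sqrt (2 * pi)) * (exp (\<i> * complex_of_real ((y - t) * \<xi>)) * std_normal_density (\<delta> k * \<xi>)) \<partial>lborel)"
        unfolding F_def w_def by (simp only: integral_mult_right_zero of_real_mult mult.left_commute)
      also have "\<dots> = h t * (complex_of_real (sqrt (2 * pi)) * complex_of_real (sqrt (2 * pi) / \<delta> k * std_normal_density ((y - t) / \<delta> k)))"
        unfolding integral_mult_right_zero integral_gauss_kernel[OF \<delta>] ..
      also have "\<dots> = h t * complex_of_real (sqrt (2 * pi) * sqrt (2 * pi) / \<delta> k * std_normal_density ((y - t) / \<delta> k))"
        by (simp only: of_real_mult[symmetric] mult.assoc times_divide_eq_left times_divide_eq_right)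
      finally show "(\<integral>\<xi>. F t \<xi> \<partial>lborel) = h t * complex_of_real (2 * pi / \<delta> k * std_normal_density ((y - t) / \<delta> k))"
        by simp
    qed
    also have "(\<integral>t. h t * complex_of_real (2 * pi / \<delta> k * std_normal_density ((y - t) / \<delta> k)) \<partial>lborel) =
       \<bar>\<delta> k\<bar> *\<^sub>R (\<integral>z. h (y + \<delta> k * z) * complex_of_real (2 * pi / \<delta> k * std_normal_density ((y - (y + \<delta> k * z)) / \<delta> k)) \<partial>lborel)"
      using \<delta>[of k] by (intro lborel_integral_real_affine) auto
    also have "\<dots> = \<delta> k *\<^sub>R (\<integral>z. complex_of_real (2 * pi / \<delta> k) * (h (y + \<delta> k * z) * std_normal_density z) \<partial>lborel)"
      using \<delta>[of k] by (simp add: std_normal_density_def mult_ac)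
    also have "\<dots> / complex_of_real (2 * pi) = (\<integral>z. h (y + \<delta> k * z) * std_normal_density z \<partial>lborel)"
      using \<delta>[of k] unfolding integral_mult_right_zero by (simp add: scaleR_conv_of_real)
    finally show ?thesis .
  qed
  with L R show ?thesis by (simp add: LIMSEQ_unique)
qed

section \<open>Affine maps and translations of product Lebesgue measure\<close>


abbreviation lborel_n :: "nat \<Rightarrow> (nat \<Rightarrow> real) measure" where
  "lborel_n n \<equiv> (\<Pi>\<^sub>M i\<in>{..<n}. lborel)"

interpretation lb: product_sigma_finite "\<lambda>i::nat. lborel :: real measure"
  by (rule product_sigma_finite.intro) (rule sigma_finite_lborel)

lemma space_lborel_n: "space (lborel_n n) = Rn n"
  by (simp add: Rn_def space_PiM)

lemma sigma_finite_lborel_n: "sigma_finite_measure (lborel_n n)"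
  by (rule lb.sigma_finite) simp

definition restr :: "nat \<Rightarrow> (nat \<Rightarrow> real) \<Rightarrow> nat \<Rightarrow> real" where
  "restr n x = (\<lambda>i. if i < n then x i else undefined)"

lemma restr_in_Rn: "restr n x \<in> Rn n"
  by (auto simp: restr_def Rn_def PiE_def extensional_def)

lemma restr_eq: "x \<in> Rn n \<Longrightarrow> restr n x = x"
  by (auto simp: restr_def Rn_def PiE_def extensional_def fun_eq_iff)

text \<open>Continuity refers to the topology of \<open>nat \<Rightarrow> real\<close>,
  measurability to a product over \<open>{..<n}\<close>. The retraction \<open>restr n\<close>
  bridges them: \<open>f\<close> composed with it is continuous everywhere, hence Borel, and
  \<open>restr n\<close> is measurable coordinate by coordinate.\<close>

lemma measurable_continuous_Rn:
  fixes f :: "(nat \<Rightarrow> real) \<Rightarrow> complex"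
  assumes "continuous_on (Rn n) f"
  shows "f \<in> borel_measurable (lborel_n n)"
proof -
  have "continuous_on UNIV (\<lambda>x. f (restr n x))"
  proof (rule continuous_on_compose2[OF assms])
    have "continuous_on UNIV (\<lambda>x. restr n x i)" for i
      by (cases "i < n") (simp_all add: restr_def)
    then show "continuous_on UNIV (restr n)"
      by (rule continuous_on_coordinatewise_then_product)
  qed (use restr_in_Rn in auto)
  then have "(\<lambda>x. f (restr n x)) \<in> borel_measurable (borel :: (nat \<Rightarrow> real) measure)"
    by (rule borel_measurable_continuous_onI)
  then have "(\<lambda>x. f (restr n x)) \<in> measurable (\<Pi>\<^sub>M i\<in>UNIV. borel) borel"
    using sets_PiM_equal_borel measurable_cong_sets by blast
  moreover have "(\<lambda>x. restr n x) \<in> measurable (lborel_n n) (\<Pi>\<^sub>M i\<in>UNIV. borel)"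
  proof (rule measurable_PiM_single')
    fix i show "(\<lambda>x. restr n x i) \<in> borel_measurable (lborel_n n)"
      using measurable_component_singleton[of i "{..<n}" "\<lambda>_. lborel :: real measure"]
      by (cases "i < n") (simp_all add: restr_def)
  qed auto
  ultimately have "(\<lambda>x. f (restr n (restr n x))) \<in> borel_measurable (lborel_n n)"
    by (rule measurable_compose_rev)
  moreover have "f (restr n (restr n x)) = f x" if "x \<in> space (lborel_n n)" for x
    using that by (simp add: restr_eq restr_in_Rn space_lborel_n)
  ultimately show ?thesis by (subst measurable_cong[symmetric])
qed

definition affine_map :: "nat \<Rightarrow> real \<Rightarrow> (nat \<Rightarrow> real) \<Rightarrow> (nat \<Rightarrow> real) \<Rightarrow> nat \<Rightarrow> real" where
  "affine_map n c a x = (\<lambda>i\<in>{..<n}. a i + c * x i)"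

lemma affine_map_measurable [measurable]: "affine_map n c a \<in> measurable (lborel_n n) (lborel_n n)"
proof -
  have "(\<lambda>x. \<lambda>i\<in>{..<n}. a i + c * x i) \<in> measurable (lborel_n n) (lborel_n n)"
    by measurable
  then show ?thesis unfolding affine_map_def[abs_def] .
qed

lemma affine_map_in_Rn: "affine_map n c a x \<in> Rn n"
  by (auto simp: affine_map_def Rn_def)

lemma affine_map_nth: "i < n \<Longrightarrow> affine_map n c a x i = a i + c * x i"
  by (simp add: affine_map_def)

text \<open>A product measure is determined by its values on boxes, where the one-dimensional change
  of variables applies in each coordinate and contributes one factor \<open>c\<close>.\<close>

lemma lborel_n_affine:
  assumes c: "c > 0"
  shows "density (distr (lborel_n n) (lborel_n n) (affine_map n c a)) (\<lambda>_. ennreal (c ^ n)) = lborel_n n"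
proof (rule lb.PiM_eqI)
  fix A :: "nat \<Rightarrow> real set" assume A: "\<And>i. i \<in> {..<n} \<Longrightarrow> A i \<in> sets lborel"
  have As: "Pi\<^sub>E {..<n} A \<in> sets (lborel_n n)" using A by (intro sets_PiM_I_finite) auto
  have pre: "affine_map n c a -` Pi\<^sub>E {..<n} A \<inter> space (lborel_n n) =
      Pi\<^sub>E {..<n} (\<lambda>i. (\<lambda>t. a i + c * t) -` A i)"
    by (auto simp: affine_map_def space_PiM PiE_def Pi_def)
  have 1: "emeasure lborel (A i) = ennreal c * emeasure lborel ((\<lambda>t. a i + c * t) -` A i)" if "i < n" for i
  proof -
    have "emeasure lborel (A i) = emeasure (density (distr lborel borel (\<lambda>t. a i + c * t)) (\<lambda>_. ennreal \<bar>c\<bar>)) (A i)"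
      using lborel_real_affine[of c "a i"] c by simp
    also have "\<dots> = ennreal c * emeasure lborel ((\<lambda>t. a i + c * t) -` A i)"
      using c A[of i] that by (subst emeasure_density_const) (auto simp: emeasure_distr)
    finally show ?thesis .
  qed
  have m: "(\<lambda>t. a i + c * t) -` A i \<in> sets lborel" if "i < n" for i
    using measurable_sets[of "\<lambda>t. a i + c * t" borel borel "A i"] A[of i] that by simp
  have "emeasure (density (distr (lborel_n n) (lborel_n n) (affine_map n c a)) (\<lambda>_. ennreal (c ^ n))) (Pi\<^sub>E {..<n} A)
     = ennreal (c ^ n) * emeasure (lborel_n n) (Pi\<^sub>E {..<n} (\<lambda>i. (\<lambda>t. a i + c * t) -` A i))"
    using As by (subst emeasure_density_const) (auto simp: emeasure_distr pre)
  also have "\<dots> = ennreal (c ^ n) * (\<Prod>i<n. emeasure lborel ((\<lambda>t. a i + c * t) -` A i))"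
    using m by (subst lb.emeasure_PiM) auto
  also have "\<dots> = (\<Prod>i<n. emeasure lborel (A i))"
    using c by (simp add: 1 prod.distrib ennreal_power)
  finally show "emeasure (density (distr (lborel_n n) (lborel_n n) (affine_map n c a)) (\<lambda>_. ennreal (c ^ n))) (Pi\<^sub>E {..<n} A)
     = (\<Prod>i\<in>{..<n}. emeasure lborel (A i))" .
qed auto

lemma nn_integral_lborel_n_affine:
  assumes "c > 0" "f \<in> borel_measurable (lborel_n n)"
  shows "(\<integral>\<^sup>+x. f x \<partial>lborel_n n) = ennreal (c ^ n) * (\<integral>\<^sup>+x. f (affine_map n c a x) \<partial>lborel_n n)"
proof -
  note [measurable] = assms(2)
  have "(\<integral>\<^sup>+x. f x \<partial>lborel_n n) = (\<integral>\<^sup>+x. f x \<partial>density (distr (lborel_n n) (lborel_n n) (affine_map n c a)) (\<lambda>_. ennreal (c ^ n)))"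
    by (simp only: lborel_n_affine[OF assms(1)])
  also have "\<dots> = ennreal (c ^ n) * (\<integral>\<^sup>+x. f (affine_map n c a x) \<partial>lborel_n n)"
    by (subst nn_integral_density) (simp_all add: nn_integral_cmult nn_integral_distr)
  finally show ?thesis .
qed

section \<open>Cubes, and continuity of translation in measure\<close>

definition cube :: "nat \<Rightarrow> real \<Rightarrow> (nat \<Rightarrow> real) set" where
  "cube n R = Pi\<^sub>E {..<n} (\<lambda>_. {-R..R})"

lemma mem_cube: "x \<in> cube n R \<longleftrightarrow> x \<in> Rn n \<and> (\<forall>i<n. \<bar>x i\<bar> \<le> R)"
  by (auto simp: cube_def Rn_def PiE_def Pi_def abs_le_iff minus_le_iff)

lemma cube_sets [measurable]: "cube n R \<in> sets (lborel_n n)"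
  unfolding cube_def by (intro sets_PiM_I_finite) auto

lemma emeasure_cube: "R \<ge> 0 \<Longrightarrow> emeasure (lborel_n n) (cube n R) = ennreal ((2 * R) ^ n)"
  unfolding cube_def by (subst lb.emeasure_PiM) (auto simp: ennreal_power)

lemma emeasure_cube_finite: "emeasure (lborel_n n) (cube n R) < \<infinity>"
proof (cases "R \<ge> 0")
  case False
  \<comment> \<open>Every factor is empty, yet in dimension 0 the empty product is 1; the power
    \<open>0 ^ n\<close> covers both situations.\<close>
  then have "emeasure (lborel_n n) (cube n R) = 0 ^ n"
    unfolding cube_def by (subst lb.emeasure_PiM) auto
  then show ?thesis by (cases n) auto
qed (simp add: emeasure_cube)

lemma AE_component_neq:
  assumes "i < n"
  shows "AE x in lborel_n n. x i \<noteq> a"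
proof (rule AE_I')
  let ?N = "Pi\<^sub>E {..<n} (\<lambda>j. if j = i then {a} else UNIV)"
  have "emeasure (lborel_n n) ?N = (\<Prod>j<n. emeasure lborel (if j = i then {a} else (UNIV::real set)))"
    by (rule lb.emeasure_PiM) auto
  also have "\<dots> = 0" using assms by (intro prod_zero) auto
  finally show "?N \<in> null_sets (lborel_n n)"
    by (auto intro!: null_setsI sets_PiM_I_finite)
  show "{x \<in> space (lborel_n n). \<not> x i \<noteq> a} \<subseteq> ?N"
    by (auto simp: space_PiM PiE_def Pi_def)
qed

text \<open>The sets satisfying \<open>shift_cont\<close> form a \<open>\<sigma>\<close>-algebra that contains the coordinate half spaces.\<close>

definition shift_diff :: "nat \<Rightarrow> (nat \<Rightarrow> real) \<Rightarrow> real \<Rightarrow> (nat \<Rightarrow> real) set \<Rightarrow> nat \<Rightarrow> (nat \<Rightarrow> real) set" where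
  "shift_diff n \<eta> R S j =
    {x \<in> cube n R. (affine_map n 1 (\<lambda>i. \<eta> i / real (Suc j)) x \<in> S) \<noteq> (x \<in> S)}"

text \<open>Translation is tested along the sequence \<open>\<eta> / (j + 1)\<close>, which matches
  the scales of the packets later on. Restricting to cubes keeps the measures finite when
  \<open>S\<close> has infinite measure.\<close>

definition shift_cont :: "nat \<Rightarrow> (nat \<Rightarrow> real) \<Rightarrow> (nat \<Rightarrow> real) set \<Rightarrow> bool" where
  "shift_cont n \<eta> S \<longleftrightarrow> S \<in> sets (lborel_n n) \<and>
    (\<forall>R. (\<lambda>j. measure (lborel_n n) (shift_diff n \<eta> R S j)) \<longlonglongrightarrow> 0)"

lemma fmeasurable_cube: "cube n R \<in> fmeasurable (lborel_n n)"
  using emeasure_cube_finite by (auto simp: fmeasurable_def)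

lemma shift_diff_fmeasurable:
  assumes [measurable]: "S \<in> sets (lborel_n n)"
  shows "shift_diff n \<eta> R S j \<in> fmeasurable (lborel_n n)"
proof (rule fmeasurableI2[OF fmeasurable_cube])
  show "shift_diff n \<eta> R S j \<subseteq> cube n R" by (auto simp: shift_diff_def)
  have "{x \<in> space (lborel_n n). x \<in> cube n R \<and> (affine_map n 1 (\<lambda>i. \<eta> i / real (Suc j)) x \<in> S) \<noteq> (x \<in> S)}
    \<in> sets (lborel_n n)" by measurable
  also have "{x \<in> space (lborel_n n). x \<in> cube n R \<and> (affine_map n 1 (\<lambda>i. \<eta> i / real (Suc j)) x \<in> S) \<noteq> (x \<in> S)} =
    shift_diff n \<eta> R S j"
    using sets.sets_into_space[OF cube_sets] by (auto simp: shift_diff_def)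
  finally show "shift_diff n \<eta> R S j \<in> sets (lborel_n n)" .
qed

lemma cube_subset_Rn: "cube n R \<subseteq> Rn n"
  by (auto simp: cube_def Rn_def)

lemma shift_cont_compl:
  assumes "shift_cont n \<eta> S"
  shows "shift_cont n \<eta> (Rn n - S)"
proof -
  have "shift_diff n \<eta> R (Rn n - S) j = shift_diff n \<eta> R S j" for R j
    using cube_subset_Rn affine_map_in_Rn by (auto simp: shift_diff_def)
  moreover have "Rn n - S \<in> sets (lborel_n n)"
    using assms by (auto simp: shift_cont_def space_lborel_n[symmetric])
  ultimately show ?thesis using assms by (simp add: shift_cont_def)
qed

lemma shift_cont_empty: "shift_cont n \<eta> {}"
  by (simp add: shift_cont_def shift_diff_def)

lemma shift_cont_Un:
  assumes "shift_cont n \<eta> S" "shift_cont n \<eta> T"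
  shows "shift_cont n \<eta> (S \<union> T)"
  unfolding shift_cont_def
proof (intro conjI allI)
  have m[measurable]: "S \<in> sets (lborel_n n)" "T \<in> sets (lborel_n n)"
    using assms by (auto simp: shift_cont_def)
  show "S \<union> T \<in> sets (lborel_n n)" by simp
  fix R
  let ?D = "\<lambda>S j. shift_diff n \<eta> R S j" and ?m = "measure (lborel_n n)"
  have "?m (?D (S \<union> T) j) \<le> ?m (?D S j) + ?m (?D T j)" for j
  proof -
    have "?m (?D (S \<union> T) j) \<le> ?m (?D S j \<union> ?D T j)"
      using shift_diff_fmeasurable m by (intro measure_mono_fmeasurable) (auto simp: shift_diff_def)
    also have "\<dots> \<le> ?m (?D S j) + ?m (?D T j)"
      using shift_diff_fmeasurable m by (intro measure_Un_le) auto
    finally show ?thesis .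
  qed
  moreover have "(\<lambda>j. ?m (?D S j) + ?m (?D T j)) \<longlonglongrightarrow> 0 + 0"
    using assms by (intro tendsto_add) (auto simp: shift_cont_def)
  ultimately show "(\<lambda>j. ?m (?D (S \<union> T) j)) \<longlonglongrightarrow> 0"
    using Lim_null_comparison[of "\<lambda>j. ?m (?D (S \<union> T) j)" "\<lambda>j. ?m (?D S j) + ?m (?D T j)" sequentially]
    by simp
qed

lemma emeasure_translate:
  assumes [measurable]: "S \<in> sets (lborel_n n)"
  shows "emeasure (lborel_n n) (affine_map n 1 a -` S \<inter> Rn n) = emeasure (lborel_n n) S"
proof -
  have "emeasure (lborel_n n) S = emeasure (density (distr (lborel_n n) (lborel_n n) (affine_map n 1 a)) (\<lambda>_. ennreal (1 ^ n))) S"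
    by (subst lborel_n_affine) auto
  also have "\<dots> = emeasure (lborel_n n) (affine_map n 1 a -` S \<inter> Rn n)"
    by (subst emeasure_density_const) (auto simp: emeasure_distr space_lborel_n)
  finally show ?thesis by simp
qed

text \<open>A finite subunion \<open>P J\<close> misses only a tail \<open>T J\<close>, whose
  measure inside a bounded cube tends to 0. A point where the full union behaves differently from
  \<open>P J\<close> under the shift lies in the tail or is moved into it, and both sets have the
  measure of \<open>T J\<close>.\<close>

lemma shift_cont_UN:
  assumes S: "\<And>k::nat. shift_cont n \<eta> (S k)"
  shows "shift_cont n \<eta> (\<Union>k. S k)"
  unfolding shift_cont_def
proof (intro conjI allI)
  have m[measurable]: "S k \<in> sets (lborel_n n)" for k
    using S by (auto simp: shift_cont_def)
  show "(\<Union>k. S k) \<in> sets (lborel_n n)" by measurable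
  fix R
  let ?U = "\<Union>k. S k"
  define P where "P = (\<lambda>J. \<Union>k<J. S k)"
  have Pm[measurable]: "P J \<in> sets (lborel_n n)" for J by (simp add: P_def)
  have P: "shift_cont n \<eta> (P J)" for J
    by (induction J) (auto simp: P_def lessThan_Suc intro: shift_cont_empty shift_cont_Un S)
  \<comment> \<open>Bounds every coordinate of every shift, so that the cube of half-side
    \<open>R + H\<close> contains a point of \<open>cube n R\<close> together with its
    translate.\<close>
  define H where "H = (\<Sum>i<n. \<bar>\<eta> i\<bar>)"
  define T where "T = (\<lambda>J. cube n (R + H) \<inter> (?U - P J))"
  let ?D = "\<lambda>S j. shift_diff n \<eta> R S j" and ?m = "measure (lborel_n n)"
  let ?a = "\<lambda>j. affine_map n 1 (\<lambda>i. \<eta> i / real (Suc j))"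
  have Tm[measurable]: "T J \<in> sets (lborel_n n)" for J by (simp add: T_def)
  have Tf: "T J \<in> fmeasurable (lborel_n n)" for J
    by (rule fmeasurableI2[OF fmeasurable_cube[of n "R + H"]]) (auto simp: T_def)
  have H: "\<bar>\<eta> i\<bar> / real (Suc j) \<le> H" if "i < n" for i j
  proof -
    have "\<bar>\<eta> i\<bar> / real (Suc j) \<le> \<bar>\<eta> i\<bar> / 1" by (intro divide_left_mono) auto
    also have "\<dots> \<le> H" unfolding H_def using that by (intro order_trans[OF _ member_le_sum[of i]]) auto
    finally show ?thesis .
  qed
  have H0: "H \<ge> 0" by (auto simp: H_def intro: sum_nonneg)
  have sub: "?D ?U j \<subseteq> ?D (P J) j \<union> T J \<union> (?a j -` T J \<inter> Rn n)" for j J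
  proof
    fix x assume x: "x \<in> ?D ?U j"
    then have xc: "x \<in> cube n R" by (simp add: shift_diff_def)
    have xi: "\<bar>x i\<bar> \<le> R" if "i < n" for i using xc that by (simp add: mem_cube)
    have 1: "x \<in> cube n (R + H)" using xc H0 xi by (force simp: mem_cube)
    have "\<bar>\<eta> i / real (Suc j) + 1 * x i\<bar> \<le> R + H" if "i < n" for i
      using xi[OF that] H[OF that, of j] abs_triangle_ineq[of "\<eta> i / real (Suc j)" "x i"] by simp
    then have 2: "?a j x \<in> cube n (R + H)"
      by (simp add: mem_cube affine_map_in_Rn affine_map_nth)
    have 3: "x \<in> Rn n" using xc cube_subset_Rn by auto
    have "P J \<subseteq> ?U" by (auto simp: P_def)
    then show "x \<in> ?D (P J) j \<union> T J \<union> (?a j -` T J \<inter> Rn n)"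
      using x xc 1 2 3 by (auto simp: shift_diff_def T_def)
  qed
  have le: "?m (?D ?U j) \<le> ?m (?D (P J) j) + 2 * ?m (T J)" for j J
  proof -
    have f3: "?a j -` T J \<inter> Rn n \<in> fmeasurable (lborel_n n)"
    proof (rule fmeasurableI)
      show "?a j -` T J \<inter> Rn n \<in> sets (lborel_n n)"
        using measurable_sets[OF affine_map_measurable Tm] by (simp add: space_lborel_n)
      show "emeasure (lborel_n n) (?a j -` T J \<inter> Rn n) < \<infinity>"
        unfolding emeasure_translate[OF Tm] using Tf[of J] by (auto simp: fmeasurable_def)
    qed
    note f = shift_diff_fmeasurable[OF Pm] Tf f3
    have "?m (?D ?U j) \<le> ?m (?D (P J) j \<union> T J \<union> (?a j -` T J \<inter> Rn n))"
      using sub f by (intro measure_mono_fmeasurable fmeasurable.Un) (auto intro!: fmeasurableD[OF shift_diff_fmeasurable])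
    also have "\<dots> \<le> ?m (?D (P J) j \<union> T J) + ?m (?a j -` T J \<inter> Rn n)"
      using f by (intro measure_Un_le) auto
    also have "?m (?D (P J) j \<union> T J) \<le> ?m (?D (P J) j) + ?m (T J)"
      using f by (intro measure_Un_le) auto
    finally show ?thesis by (simp add: measure_def emeasure_translate[OF Tm])
  qed
  have "(\<lambda>J. ?m (T J)) \<longlonglongrightarrow> ?m (\<Inter>J. T J)"
  proof (rule Lim_measure_decseq)
    show "range T \<subseteq> sets (lborel_n n)" by auto
    show "decseq T"
      by (rule decseq_SucI) (auto simp: T_def P_def)
    show "emeasure (lborel_n n) (T i) \<noteq> \<infinity>" for i using Tf[of i] by (auto simp: fmeasurable_def)
  qed
  moreover have "(\<Inter>J. T J) = {}" by (auto simp: T_def P_def)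
  ultimately have T0: "(\<lambda>J. ?m (T J)) \<longlonglongrightarrow> 0" by simp
  show "(\<lambda>j. ?m (?D ?U j)) \<longlonglongrightarrow> 0"
  proof (rule LIMSEQ_I)
    fix r :: real assume r: "r > 0"
    obtain J where J: "?m (T J) < r / 4"
      using LIMSEQ_D[OF T0, of "r / 4"] r by auto
    have "(\<lambda>j. ?m (?D (P J) j)) \<longlonglongrightarrow> 0" using P by (auto simp: shift_cont_def)
    from LIMSEQ_D[OF this, of "r / 2"] r obtain j0 where "\<And>j. j \<ge> j0 \<Longrightarrow> ?m (?D (P J) j) < r / 2" by auto
    then have "?m (?D ?U j) < r" if "j \<ge> j0" for j using le[of j J] J that by fastforce
    then show "\<exists>no. \<forall>j\<ge>no. norm (?m (?D ?U j) - 0) < r" by auto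
  qed
qed

text \<open>Off the null hyperplane \<open>x i = a\<close>, a small enough shift no longer changes
  membership; dominated convergence does the rest.\<close>

lemma shift_cont_halfspace:
  assumes i: "i < n"
  shows "shift_cont n \<eta> {x \<in> Rn n. x i \<le> a}"
  unfolding shift_cont_def
proof (intro conjI allI)
  let ?S = "{x \<in> Rn n. x i \<le> a}"
  have [measurable]: "(\<lambda>x. x i) \<in> borel_measurable (lborel_n n)"
    using measurable_component_singleton[of i "{..<n}" "\<lambda>_. lborel :: real measure"] i by simp
  have "{x \<in> space (lborel_n n). x i \<le> a} \<in> sets (lborel_n n)" by measurable
  then show S: "?S \<in> sets (lborel_n n)" by (simp add: space_lborel_n)
  fix R
  let ?D = "shift_diff n \<eta> R ?S"
  have [measurable]: "?D j \<in> sets (lborel_n n)" for j using shift_diff_fmeasurable[OF S] by auto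
  have "(\<lambda>j. \<integral>x. indicator (?D j) x \<partial>lborel_n n) \<longlonglongrightarrow> (\<integral>x. 0 \<partial>lborel_n n :: real)"
  proof (rule integral_dominated_convergence[where w="indicator (cube n R)"])
    show "integrable (lborel_n n) (indicator (cube n R) :: _ \<Rightarrow> real)"
      using fmeasurable_cube[of n R] by (simp add: fmeasurable_def)
    show "AE x in lborel_n n. norm (indicator (?D j) x :: real) \<le> indicator (cube n R) x" for j
      by (auto simp: shift_diff_def indicator_def)
    show "AE x in lborel_n n. (\<lambda>j. indicator (?D j) x :: real) \<longlonglongrightarrow> 0"
      using AE_component_neq[OF i, of a] AE_space
    proof eventually_elim
      case (elim x)
      have "(\<lambda>j. \<eta> i * (1 / real (Suc j)) + 1 * x i) \<longlonglongrightarrow> \<eta> i * 0 + 1 * x i"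
        by (intro tendsto_intros LIMSEQ_Suc[OF lim_1_over_n])
      then have l: "(\<lambda>j. affine_map n 1 (\<lambda>i. \<eta> i / real (Suc j)) x i) \<longlonglongrightarrow> x i"
        using i by (simp add: affine_map_nth)
      have "eventually (\<lambda>j. (affine_map n 1 (\<lambda>i. \<eta> i / real (Suc j)) x i \<le> a) = (x i \<le> a)) sequentially"
      proof (cases "x i < a")
        case True
        then show ?thesis using order_tendstoD(2)[OF l True] by (auto elim!: eventually_mono)
      next
        case False
        with elim(1) have "a < x i" by simp
        from order_tendstoD(1)[OF l this] this show ?thesis by (auto elim!: eventually_mono)
      qed
      then have "eventually (\<lambda>j. indicator (?D j) x = (0::real)) sequentially"
        by (rule eventually_mono) (use elim affine_map_in_Rn in \<open>auto simp: shift_diff_def indicator_def space_lborel_n\<close>)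
      then show ?case by (rule tendsto_eventually)
    qed
  qed measurable
  then show "(\<lambda>j. measure (lborel_n n) (?D j)) \<longlonglongrightarrow> 0" by simp
qed

text \<open>Two inductions over generated \<sigma>-algebras: rays generate the Borel sets of one
  coordinate, and the resulting cylinders generate the product.\<close>

lemma shift_cont_sets:
  assumes "S \<in> sets (lborel_n n)"
  shows "shift_cont n \<eta> S"
proof -
  have cyl: "shift_cont n \<eta> {x \<in> Rn n. x i \<in> A}" if i: "i < n" and A: "A \<in> sets borel" for i A
  proof -
    have "A \<in> sigma_sets UNIV (range (\<lambda>a::real. {..a}))"
      using A unfolding borel_eq_atMost by simp
    then show ?thesis
    proof induction
      case (Basic B)
      then show ?case using shift_cont_halfspace[OF i] by auto
    next
      case Empty
      show ?case using shift_cont_empty by simp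
    next
      case (Compl B)
      have "{x \<in> Rn n. x i \<in> UNIV - B} = Rn n - {x \<in> Rn n. x i \<in> B}" by auto
      with shift_cont_compl[OF Compl.IH] show ?case by simp
    next
      case (Union B)
      have "{x \<in> Rn n. x i \<in> (\<Union>k. B k)} = (\<Union>k. {x \<in> Rn n. x i \<in> B k})" by auto
      with shift_cont_UN[OF Union.IH] show ?case by simp
    qed
  qed
  have "S \<in> sigma_sets (Rn n) {{f \<in> Rn n. f i \<in> A} |i A. i \<in> {..<n} \<and> A \<in> sets lborel}"
    using assms unfolding sets_PiM_single by (simp add: Rn_def)
  then show ?thesis
  proof induction
    case (Compl B)
    from shift_cont_compl[OF Compl.IH] show ?case .
  next
    case (Union B)
    from shift_cont_UN[OF Union.IH] show ?case .
  qed (use cyl shift_cont_empty in auto)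
qed

section \<open>Integrability of the Fourier transform of a test function\<close>


text \<open>Inside the full product over \<open>nat\<close> the coordinates from \<open>n\<close> on
  are pinned to \<open>undefined\<close>, so the cube is a product of compact factors and
  Tychonoff's theorem applies.\<close>

lemma compact_cube: "compact (cube n R)"
proof -
  have eq: "cube n R = Pi\<^sub>E UNIV (\<lambda>i. if i < n then {-R..R} else {undefined})"
    unfolding cube_def PiE_def Pi_def extensional_def by (fastforce split: if_splits)
  have "compactin (product_topology (\<lambda>i. euclidean) UNIV) (Pi\<^sub>E UNIV (\<lambda>i. if i < n then {-R..R} else {undefined}))"
    unfolding compactin_PiE by (auto simp: compactin_euclidean_iff)
  then show ?thesis unfolding euclidean_product_topology eq by (simp add: compactin_euclidean_iff)
qed

lemma Rn_upd: "x \<in> Rn n \<Longrightarrow> i < n \<Longrightarrow> x(i := t) \<in> Rn n"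
  by (auto simp: Rn_def PiE_def extensional_def)

lemma test_function_support:
  assumes "f \<in> test_functions n"
  obtains R where "\<And>x. x \<in> Rn n \<Longrightarrow> x \<notin> cube n R \<Longrightarrow> f x = 0"
proof -
  define K where "K = closure {x \<in> Rn n. f x \<noteq> 0}"
  have K: "compact K" using assms by (simp add: test_functions_def K_def)
  have "\<exists>b. \<forall>x\<in>K. \<bar>x i\<bar> \<le> b" for i
  proof -
    have "compact ((\<lambda>x. x i) ` K)"
      by (rule compact_continuous_image[OF continuous_on_subset[OF continuous_on_product_coordinates] K]) simp
    then show ?thesis using compact_imp_bounded bounded_iff by (metis imageI real_norm_def)
  qed
  then obtain b where b: "\<And>i x. x \<in> K \<Longrightarrow> \<bar>x i\<bar> \<le> b i" by metis
  have "f x = 0" if x: "x \<in> Rn n" "x \<notin> cube n (\<Sum>i<n. \<bar>b i\<bar>)" for x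
  proof (rule ccontr)
    assume "f x \<noteq> 0"
    then have "x \<in> K" using x closure_subset by (force simp: K_def)
    have "\<bar>x i\<bar> \<le> (\<Sum>i<n. \<bar>b i\<bar>)" if "i < n" for i
    proof -
      have "\<bar>x i\<bar> \<le> \<bar>b i\<bar>" using b[OF \<open>x \<in> K\<close>, of i] by simp
      also have "\<dots> \<le> (\<Sum>i<n. \<bar>b i\<bar>)"
        using that by (intro member_le_sum[of i]) auto
      finally show ?thesis .
    qed
    with x show False by (simp add: mem_cube)
  qed
  with that show ?thesis by blast
qed

lemma iter_partial_deriv_support:
  assumes f: "\<And>x. x \<in> Rn n \<Longrightarrow> x \<notin> cube n R \<Longrightarrow> f x = 0"
    and js: "set js \<subseteq> {..<n}" and x: "x \<in> Rn n" "x \<notin> cube n R"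
  shows "iter_partial_deriv js f x = 0"
  using js x
proof (induction js arbitrary: x)
  case (Cons j js)
  let ?g = "iter_partial_deriv js f"
  have j: "j < n" using Cons.prems by simp
  obtain l where l: "l < n" "R < \<bar>x l\<bar>" using Cons.prems by (auto simp: mem_cube not_le)
  \<comment> \<open>If the offending coordinate \<open>l\<close> differs from \<open>j\<close>, the
    whole line in direction \<open>j\<close> avoids the cube; if \<open>l = j\<close>, only the part
    of the line near \<open>x j\<close> is known to avoid it.\<close>
  define U where "U = (if l = j then {t. R < \<bar>t\<bar>} else UNIV)"
  have "open U" by (auto simp: U_def intro!: open_Collect_less continuous_intros)
  moreover have "x j \<in> U" using l by (auto simp: U_def)
  moreover have "?g (x(j := t)) = 0" if "t \<in> U" for t
  proof (rule Cons.IH)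
    show "x(j := t) \<in> Rn n" using Cons.prems j by (intro Rn_upd) auto
    have "R < \<bar>(x(j := t)) l\<bar>" using l that by (auto simp: U_def split: if_splits)
    then show "x(j := t) \<notin> cube n R" using l by (auto simp: mem_cube not_le)
  qed (use Cons.prems in auto)
  ultimately have "((\<lambda>t. ?g (x(j := t))) has_vector_derivative 0) (at (x j))"
    by (intro has_vector_derivative_transform_within_open[of "\<lambda>_. 0" 0 "x j" U "\<lambda>t. ?g (x(j := t))"]) auto
  then show ?case by (simp add: partial_deriv_def vector_derivative_at)
qed (use f in simp)

lemma integrable_continuous_cube:
  fixes g :: "(nat \<Rightarrow> real) \<Rightarrow> complex"
  assumes c: "continuous_on (Rn n) g" and s: "\<And>x. x \<in> Rn n \<Longrightarrow> x \<notin> cube n R \<Longrightarrow> g x = 0"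
  shows "integrable (lborel_n n) g"
proof -
  have "compact (g ` cube n R)"
    by (intro compact_continuous_image compact_cube continuous_on_subset[OF c] cube_subset_Rn)
  then obtain B where B: "\<And>x. x \<in> cube n R \<Longrightarrow> cmod (g x) \<le> B"
    using compact_imp_bounded bounded_iff by (metis imageI)
  show ?thesis
  proof (rule Bochner_Integration.integrable_bound)
    show "integrable (lborel_n n) (\<lambda>x. B * indicator (cube n R) x :: real)"
      using fmeasurable_cube[of n R] by (intro integrable_mult_right) (simp add: fmeasurable_def)
    show "AE x in lborel_n n. norm (g x) \<le> norm (B * indicator (cube n R) x :: real)"
      using AE_space
    proof eventually_elim
      case (elim x)
      then show ?case using B[of x] s[of x] by (cases "x \<in> cube n R") (auto simp: space_lborel_n)
    qed
  qed (use measurable_continuous_Rn[OF c] in simp)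
qed

text \<open>This is \<open>fourier_n\<close> without its normalisation and over the uncompleted
  product, where coordinates can be integrated one at a time. The two are related by
  \<open>fourier_n_eq\<close>.\<close>

definition fourier_int :: "nat \<Rightarrow> ((nat \<Rightarrow> real) \<Rightarrow> complex) \<Rightarrow> (nat \<Rightarrow> real) \<Rightarrow> complex" where
  "fourier_int n f \<xi> = (\<integral>x. f x * exp (- \<i> * complex_of_real (dot_n n x \<xi>)) \<partial>lborel_n n)"

lemma dot_n_measurable [measurable]: "(\<lambda>x. dot_n n x \<xi>) \<in> borel_measurable (lborel_n n)"
  unfolding dot_n_def by measurable

text \<open>Fubini isolates coordinate \<open>i\<close>, in which \<open>integral_deriv_exp\<close>
  applies. The exponentials of the other coordinates form the factor \<open>E\<close>, constant
  along that line.\<close>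

lemma fourier_int_partial_deriv:
  assumes i: "i < n" and c: "continuous_on (Rn n) g" "continuous_on (Rn n) (partial_deriv i g)"
    and d: "\<And>x. x \<in> Rn n \<Longrightarrow> (\<lambda>t. g (x(i := t))) differentiable (at (x i))"
    and s: "\<And>x. x \<in> Rn n \<Longrightarrow> x \<notin> cube n R \<Longrightarrow> g x = 0"
      "\<And>x. x \<in> Rn n \<Longrightarrow> x \<notin> cube n R \<Longrightarrow> partial_deriv i g x = 0"
  shows "fourier_int n (partial_deriv i g) \<xi> = \<i> * complex_of_real (\<xi> i) * fourier_int n g \<xi>"
proof -
  define I where "I = {..<n} - {i}"
  have I: "finite I" "i \<notin> I" "insert i I = {..<n}" using i by (auto simp: I_def)
  define E where "E = (\<lambda>x. exp (- \<i> * complex_of_real (\<Sum>l\<in>I. x l * \<xi> l)))"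
  let ?e = "\<lambda>x. exp (- \<i> * complex_of_real (dot_n n x \<xi>))"
  have e_upd: "?e (x(i := t)) = exp (- \<i> * complex_of_real (t * \<xi> i)) * E x" for x t
  proof -
    have "dot_n n (x(i := t)) \<xi> = (\<Sum>l\<in>insert i I. (x(i := t)) l * \<xi> l)"
      unfolding dot_n_def I(3) ..
    also have "\<dots> = t * \<xi> i + (\<Sum>l\<in>I. (x(i := t)) l * \<xi> l)"
      using I by (subst sum.insert) auto
    also have "(\<Sum>l\<in>I. (x(i := t)) l * \<xi> l) = (\<Sum>l\<in>I. x l * \<xi> l)"
      using I(2) by (intro sum.cong) auto
    finally have "dot_n n (x(i := t)) \<xi> = t * \<xi> i + (\<Sum>l\<in>I. x l * \<xi> l)" .
    then show ?thesis by (simp only: E_def mult_exp_exp of_real_add distrib_left)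
  qed
  have fold: "fourier_int n h \<xi> = (\<integral>x. E x * (\<integral>t. h (x(i := t)) * exp (- \<i> * complex_of_real (t * \<xi> i)) \<partial>lborel) \<partial>Pi\<^sub>M I (\<lambda>_. lborel))"
    if "continuous_on (Rn n) h" "\<And>x. x \<in> Rn n \<Longrightarrow> x \<notin> cube n R \<Longrightarrow> h x = 0" for h
  proof -
    have "integrable (lborel_n n) (\<lambda>x. h x * ?e x)"
      using that by (intro integrable_mult_unimodular integrable_continuous_cube[of n h R]) auto
    then have "fourier_int n h \<xi> = (\<integral>x. (\<integral>t. h (x(i := t)) * ?e (x(i := t)) \<partial>lborel) \<partial>Pi\<^sub>M I (\<lambda>_. lborel))"
      unfolding fourier_int_def using lb.product_integral_insert[OF I(1,2)] unfolding I(3) by blast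
    also have "\<dots> = (\<integral>x. (\<integral>t. E x * (h (x(i := t)) * exp (- \<i> * complex_of_real (t * \<xi> i))) \<partial>lborel) \<partial>Pi\<^sub>M I (\<lambda>_. lborel))"
      unfolding e_upd by (simp only: mult_ac)
    finally show ?thesis by simp
  qed
  have "fourier_int n (partial_deriv i g) \<xi> =
     (\<integral>x. E x * (\<integral>t. partial_deriv i g (x(i := t)) * exp (- \<i> * complex_of_real (t * \<xi> i)) \<partial>lborel) \<partial>Pi\<^sub>M I (\<lambda>_. lborel))"
    by (rule fold[OF c(2) s(2)])
  also have "\<dots> = (\<integral>x. E x * (\<i> * \<xi> i * (\<integral>t. g (x(i := t)) * exp (- \<i> * complex_of_real (t * \<xi> i)) \<partial>lborel)) \<partial>Pi\<^sub>M I (\<lambda>_. lborel))"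
  proof (rule Bochner_Integration.integral_cong[OF refl], rule arg_cong[where f="\<lambda>u. _ * u"], rule integral_deriv_exp[where R=R])
    fix x :: "nat \<Rightarrow> real" assume "x \<in> space (Pi\<^sub>M I (\<lambda>_. lborel))"
    then have xR: "x(i := t) \<in> Rn n" for t
      using I(3) i by (auto simp: space_PiM Rn_def PiE_def extensional_def)
    show "((\<lambda>t. g (x(i := t))) has_vector_derivative partial_deriv i g (x(i := t))) (at t)" for t
      using d[OF xR[of t]] unfolding partial_deriv_def by (simp add: vector_derivative_works)
    have "continuous_on UNIV (\<lambda>t. x(i := t))"
    proof (rule continuous_on_coordinatewise_then_product)
      fix l show "continuous_on UNIV (\<lambda>t. (x(i := t)) l)"
        by (cases "l = i") auto
    qed
    then show "continuous_on UNIV (\<lambda>t. partial_deriv i g (x(i := t)))"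
      by (rule continuous_on_compose2[OF c(2)]) (use xR in auto)
    show "g (x(i := t)) = 0" if "R < \<bar>t\<bar>" for t
      using that i by (intro s(1) xR) (auto simp: mem_cube not_le intro!: exI[of _ i])
  qed
  also have "\<dots> = (\<integral>x. \<i> * \<xi> i * (E x * (\<integral>t. g (x(i := t)) * exp (- \<i> * complex_of_real (t * \<xi> i)) \<partial>lborel)) \<partial>Pi\<^sub>M I (\<lambda>_. lborel))"
    by (simp only: mult_ac)
  also have "\<dots> = \<i> * \<xi> i * (\<integral>x. E x * (\<integral>t. g (x(i := t)) * exp (- \<i> * complex_of_real (t * \<xi> i)) \<partial>lborel) \<partial>Pi\<^sub>M I (\<lambda>_. lborel))"
    by (rule integral_mult_right_zero)
  also have "(\<integral>x. E x * (\<integral>t. g (x(i := t)) * exp (- \<i> * complex_of_real (t * \<xi> i)) \<partial>lborel) \<partial>Pi\<^sub>M I (\<lambda>_. lborel)) = fourier_int n g \<xi>"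
    by (rule fold[OF c(1) s(1), symmetric])
  finally show ?thesis .
qed

lemma fourier_int_iter_partial_deriv:
  assumes f: "f \<in> test_functions n" and js: "set js \<subseteq> {..<n}"
  shows "fourier_int n (iter_partial_deriv js f) \<xi> = (\<Prod>j\<leftarrow>js. \<i> * complex_of_real (\<xi> j)) * fourier_int n f \<xi>"
  using js
proof (induction js)
  case (Cons j js)
  obtain R where R: "\<And>x. x \<in> Rn n \<Longrightarrow> x \<notin> cube n R \<Longrightarrow> f x = 0"
    using test_function_support[OF f] by blast
  have sm: "smooth_n n f" using f by (simp add: test_functions_def)
  have js: "j < n" "set js \<subseteq> {..<n}" "set (j # js) \<subseteq> {..<n}" using Cons.prems by auto
  have "fourier_int n (partial_deriv j (iter_partial_deriv js f)) \<xi> = \<i> * complex_of_real (\<xi> j) * fourier_int n (iter_partial_deriv js f) \<xi>"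
  proof (rule fourier_int_partial_deriv[OF js(1), where R=R])
    show "continuous_on (Rn n) (iter_partial_deriv js f)"
      using sm js by (simp add: smooth_n_def)
    have "continuous_on (Rn n) (iter_partial_deriv (j # js) f)"
      using sm js(3) unfolding smooth_n_def by blast
    then show "continuous_on (Rn n) (partial_deriv j (iter_partial_deriv js f))" by simp
    show "(\<lambda>t. iter_partial_deriv js f (x(j := t))) differentiable at (x j)" if "x \<in> Rn n" for x
      using sm js that by (simp add: smooth_n_def)
    show "iter_partial_deriv js f x = 0" if "x \<in> Rn n" "x \<notin> cube n R" for x
      by (rule iter_partial_deriv_support[OF R js(2) that])
    show "partial_deriv j (iter_partial_deriv js f) x = 0" if "x \<in> Rn n" "x \<notin> cube n R" for x
      using iter_partial_deriv_support[OF R js(3) that] by simp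
  qed
  with Cons js show ?case by simp
qed simp

lemma test_function_iter_integrable:
  assumes f: "f \<in> test_functions n" and js: "set js \<subseteq> {..<n}"
  shows "integrable (lborel_n n) (iter_partial_deriv js f)"
proof -
  obtain R where R: "\<And>x. x \<in> Rn n \<Longrightarrow> x \<notin> cube n R \<Longrightarrow> f x = 0"
    using test_function_support[OF f] by blast
  show ?thesis
    by (rule integrable_continuous_cube[of n _ R])
       (use f js iter_partial_deriv_support[OF R] in \<open>auto simp: test_functions_def smooth_n_def\<close>)
qed

lemma fourier_int_measurable:
  assumes "f \<in> borel_measurable (lborel_n n)"
  shows "fourier_int n f \<in> borel_measurable (lborel_n n)"
proof -
  note [measurable] = assms
  interpret sigma_finite_measure "lborel_n n" by (rule sigma_finite_lborel_n)
  have "(\<lambda>(\<xi>, x). f x * exp (- \<i> * complex_of_real (dot_n n x \<xi>))) \<in> borel_measurable (lborel_n n \<Otimes>\<^sub>M lborel_n n)"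
    unfolding dot_n_def by measurable
  from borel_measurable_lebesgue_integral[OF this] show ?thesis
    unfolding fourier_int_def[abs_def] .
qed

text \<open>Without this, \<^const>\<open>multiplier_op\<close> could be the junk value 0 of a divergent integral, and it would
  not be additive in the symbol.\<close>

lemma fourier_int_integrable:
  assumes f: "f \<in> test_functions n"
  shows "integrable (lborel_n n) (fourier_int n f)"
proof -
  have f0: "f \<in> borel_measurable (lborel_n n)"
    using test_function_iter_integrable[OF f, of "[]"] by auto
  define C where "C = (\<lambda>js. \<integral>x. cmod (iter_partial_deriv js f x) \<partial>lborel_n n)"
  have C: "cmod (fourier_int n (iter_partial_deriv js f) \<xi>) \<le> C js" for js \<xi>
    unfolding fourier_int_def C_def
    using integral_norm_bound[of "lborel_n n" "\<lambda>x. iter_partial_deriv js f x * exp (- \<i> * complex_of_real (dot_n n x \<xi>))"]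
    by (simp add: norm_mult)
  define xs where "xs = (\<lambda>J. (SOME ys. set ys = J \<and> distinct ys) :: nat list)"
  have xs: "set (xs J) = J" "distinct (xs J)" if "J \<subseteq> {..<n}" for J
    unfolding xs_def using someI_ex[OF finite_distinct_list[of J]] finite_subset[OF that] by auto
  \<comment> \<open>Differentiating along \<open>xs J @ xs J\<close>, twice in each coordinate of
    \<open>J\<close>, multiplies the modulus of the transform by the product of
    \<open>(\<xi> i) ^ 2\<close> over \<open>J\<close>. Summed over all \<open>J\<close> these
    factors make up the product of \<open>1 + (\<xi> i) ^ 2\<close>, whose inverse is an integrable
    majorant.\<close>
  define B where "B = (\<Sum>J\<in>Pow {..<n}. C (xs J @ xs J))"
  have bnd: "cmod (fourier_int n f \<xi>) \<le> B * (\<Prod>i<n. inverse (1 + (\<xi> i)\<^sup>2))" for \<xi>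
  proof -
    have "(\<Prod>i<n. 1 + (\<xi> i)\<^sup>2) * cmod (fourier_int n f \<xi>) = (\<Prod>i<n. (\<xi> i)\<^sup>2 + 1) * cmod (fourier_int n f \<xi>)"
      by (simp add: add.commute)
    also have "\<dots> = (\<Sum>J\<in>Pow {..<n}. (\<Prod>i\<in>J. (\<xi> i)\<^sup>2) * cmod (fourier_int n f \<xi>))"
      by (subst prod_add) (simp_all add: sum_distrib_right)
    also have "\<dots> \<le> B" unfolding B_def
    proof (rule sum_mono)
      fix J assume "J \<in> Pow {..<n}"
      then have J: "J \<subseteq> {..<n}" by simp
      have "cmod (\<Prod>j\<leftarrow>xs J @ xs J. \<i> * complex_of_real (\<xi> j)) = (\<Prod>i\<in>J. (\<xi> i)\<^sup>2)"
        using xs[OF J] by (simp add: prod.distinct_set_conv_list[symmetric] prod_norm[symmetric] norm_mult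
            prod.distrib[symmetric] power2_eq_square)
      then have "(\<Prod>i\<in>J. (\<xi> i)\<^sup>2) * cmod (fourier_int n f \<xi>) = cmod (fourier_int n (iter_partial_deriv (xs J @ xs J) f) \<xi>)"
        using fourier_int_iter_partial_deriv[OF f, of "xs J @ xs J" \<xi>] xs[OF J] J by (simp add: norm_mult)
      then show "(\<Prod>i\<in>J. (\<xi> i)\<^sup>2) * cmod (fourier_int n f \<xi>) \<le> C (xs J @ xs J)"
        using C by simp
    qed
    finally have "cmod (fourier_int n f \<xi>) \<le> B / (\<Prod>i<n. 1 + (\<xi> i)\<^sup>2)"
      by (subst pos_le_divide_eq) (auto intro!: prod_pos add_pos_nonneg simp: mult.commute)
    moreover have "inverse (\<Prod>i<n. 1 + (\<xi> i)\<^sup>2) = (\<Prod>i<n. inverse (1 + (\<xi> i)\<^sup>2))"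
      by (induction n) auto
    ultimately show ?thesis by (simp only: divide_inverse)
  qed
  show ?thesis
  proof (rule Bochner_Integration.integrable_bound)
    show "integrable (lborel_n n) (\<lambda>\<xi>. B * (\<Prod>i<n. inverse (1 + (\<xi> i)\<^sup>2)))"
      by (intro integrable_mult_right lb.product_integrable_prod integrable_inverse_one_plus_square) simp
    show "AE \<xi> in lborel_n n. norm (fourier_int n f \<xi>) \<le> norm (B * (\<Prod>i<n. inverse (1 + (\<xi> i)\<^sup>2)))"
      using bnd by (intro AE_I2) (metis abs_ge_self order_trans real_norm_def)
  qed (rule fourier_int_measurable[OF f0])
qed

section \<open>From the product measure to its completion\<close>

lemma test_function_measurable: "f \<in> test_functions n \<Longrightarrow> f \<in> borel_measurable (lborel_n n)"
  using test_function_iter_integrable[of f n "[]"] by auto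

lemma fourier_n_eq:
  assumes "f \<in> borel_measurable (lborel_n n)"
  shows "fourier_n n f = (\<lambda>\<xi>. fourier_int n f \<xi> / complex_of_real ((2 * pi) ^ n))"
proof -
  note [measurable] = assms
  show ?thesis unfolding fourier_n_def[abs_def] fourier_int_def leb_n_def
    by (subst integral_completion) auto
qed

lemma fourier_n_measurable:
  "f \<in> test_functions n \<Longrightarrow> fourier_n n f \<in> borel_measurable (lborel_n n)"
  unfolding fourier_n_eq[OF test_function_measurable]
  using fourier_int_measurable[OF test_function_measurable, of f n] by simp

lemma fourier_n_integrable:
  "f \<in> test_functions n \<Longrightarrow> integrable (lborel_n n) (fourier_n n f)"
  unfolding fourier_n_eq[OF test_function_measurable]
  by (intro integrable_divide fourier_int_integrable)

lemma fourier_n_integrable_leb: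
  "f \<in> test_functions n \<Longrightarrow> integrable (leb_n n) (fourier_n n f)"
  unfolding leb_n_def using fourier_n_integrable fourier_n_measurable by (subst integrable_completion) auto

section \<open>Wave packets\<close>


definition prod_fun :: "nat \<Rightarrow> (nat \<Rightarrow> real \<Rightarrow> complex) \<Rightarrow> (nat \<Rightarrow> real) \<Rightarrow> complex" where
  "prod_fun n h x = (\<Prod>i<n. h i (x i))"

lemma prod_fun_upd:
  assumes "j < n"
  shows "prod_fun n g (x(j := t)) = g j t * (\<Prod>i\<in>{..<n} - {j}. g i (x i))"
proof -
  have "prod_fun n g (x(j := t)) = g j ((x(j := t)) j) * (\<Prod>i\<in>{..<n} - {j}. g i ((x(j := t)) i))"
    unfolding prod_fun_def using assms by (subst prod.remove[of _ j]) auto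
  also have "(\<Prod>i\<in>{..<n} - {j}. g i ((x(j := t)) i)) = (\<Prod>i\<in>{..<n} - {j}. g i (x i))"
    by (intro prod.cong) auto
  finally show ?thesis by (simp only: fun_upd_same)
qed

lemma prod_fun_has_partial_deriv:
  assumes "j < n" "smooth1 (g j)"
  shows "((\<lambda>t. prod_fun n g (x(j := t))) has_vector_derivative
    prod_fun n (g(j := deriv1 (g j))) (x(j := s))) (at s)"
proof -
  have "(\<Prod>i\<in>{..<n} - {j}. (g(j := deriv1 (g j))) i (x i)) = (\<Prod>i\<in>{..<n} - {j}. g i (x i))"
    by (intro prod.cong) auto
  then show ?thesis
    unfolding prod_fun_upd[OF assms(1)]
    by (simp add: has_vector_derivative_mult_left[OF smooth1_has_deriv[OF assms(2)]])
qed

lemma partial_deriv_prod_fun: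
  assumes "j < n" "smooth1 (g j)"
  shows "partial_deriv j (prod_fun n g) = prod_fun n (g(j := deriv1 (g j)))"
proof
  fix x
  from prod_fun_has_partial_deriv[of j n g x "x j"] assms
  show "partial_deriv j (prod_fun n g) x = prod_fun n (g(j := deriv1 (g j))) x"
    by (simp add: partial_deriv_def vector_derivative_at)
qed

text \<open>Tensor products are closed under partial derivatives, which reduces
  \<open>smooth_n\<close> to smoothness of the factors. The existential keeps just the product form,
  all that the induction has to carry.\<close>

lemma iter_partial_deriv_prod_fun:
  assumes "\<And>i. i < n \<Longrightarrow> smooth1 (h i)" "set js \<subseteq> {..<n}"
  shows "\<exists>g. (\<forall>i<n. smooth1 (g i)) \<and> iter_partial_deriv js (prod_fun n h) = prod_fun n g"
  using assms(2)
proof (induction js)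
  case (Cons j js)
  then obtain g where g: "\<forall>i<n. smooth1 (g i)" "iter_partial_deriv js (prod_fun n h) = prod_fun n g"
    by auto
  have "\<forall>i<n. smooth1 ((g(j := deriv1 (g j))) i)"
    using g(1) Cons.prems smooth1_deriv1 by auto
  moreover have "iter_partial_deriv (j # js) (prod_fun n h) = prod_fun n (g(j := deriv1 (g j)))"
    using g Cons.prems partial_deriv_prod_fun[of j n g] by simp
  ultimately show ?case by blast
qed (use assms(1) in auto)

lemma continuous_on_prod_fun:
  assumes "\<And>i. i < n \<Longrightarrow> continuous_on UNIV (h i)"
  shows "continuous_on S (prod_fun n h)"
  unfolding prod_fun_def[abs_def]
proof (intro continuous_on_prod)
  fix i assume "i \<in> {..<n}"
  then show "continuous_on S (\<lambda>x. h i (x i))"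
    by (intro continuous_on_compose2[OF assms[of i] continuous_on_subset[OF continuous_on_product_coordinates]]) auto
qed

lemma prod_fun_test_function:
  assumes sm: "\<And>i. i < n \<Longrightarrow> smooth1 (h i)" and s: "\<And>i t. i < n \<Longrightarrow> R < \<bar>t\<bar> \<Longrightarrow> h i t = 0"
  shows "prod_fun n h \<in> test_functions n"
proof -
  have "smooth_n n (prod_fun n h)"
    unfolding smooth_n_def
  proof (intro allI impI conjI ballI)
    fix js assume js: "set js \<subseteq> {..<n}"
    obtain g where g: "\<forall>i<n. smooth1 (g i)" "iter_partial_deriv js (prod_fun n h) = prod_fun n g"
      using iter_partial_deriv_prod_fun[of n h js] sm js by blast
    show "continuous_on (Rn n) (iter_partial_deriv js (prod_fun n h))"
      unfolding g(2) using g(1) smooth1_continuous by (intro continuous_on_prod_fun) auto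
    show "(\<lambda>t. iter_partial_deriv js (prod_fun n h) (x(i := t))) differentiable at (x i)" if "i < n" for i x
      unfolding g(2) using prod_fun_has_partial_deriv[OF that, of g] g(1) that
      by (blast intro: differentiableI_vector)
  qed
  moreover have "compact (closure {x \<in> Rn n. prod_fun n h x \<noteq> 0})"
  proof -
    have "{x \<in> Rn n. prod_fun n h x \<noteq> 0} \<subseteq> cube n R"
      using s by (force simp: mem_cube prod_fun_def not_le[symmetric])
    then have "closure {x \<in> Rn n. prod_fun n h x \<noteq> 0} \<subseteq> cube n R"
      by (intro closure_minimal compact_imp_closed compact_cube)
    then show ?thesis
      using compact_Int_closed[OF compact_cube[of n R] closed_closure] by (metis Int_absorb1)
  qed
  ultimately show ?thesis by (simp add: test_functions_def)
qed

lemma exp_dot_n: "exp (c * complex_of_real (dot_n n x \<xi>)) = (\<Prod>i<n. exp (c * complex_of_real (x i * \<xi> i)))"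
  by (simp add: dot_n_def exp_sum[symmetric] sum_distrib_left)

lemma fourier_n_prod_fun:
  assumes sm: "\<And>i. i < n \<Longrightarrow> smooth1 (h i)" and s: "\<And>i t. i < n \<Longrightarrow> R < \<bar>t\<bar> \<Longrightarrow> h i t = 0"
  shows "fourier_n n (prod_fun n h) \<xi> = (\<Prod>i<n. fourier1 (h i) (\<xi> i))"
proof -
  have i: "integrable lborel (\<lambda>t. h i t * exp (- \<i> * complex_of_real (t * \<xi> i)))" if "i < n" for i
    using sm[OF that] s[OF that] smooth1_continuous
    by (intro integrable_mult_unimodular integrable_continuous_support[of _ R]) auto
  have "fourier_int n (prod_fun n h) \<xi> = (\<integral>x. (\<Prod>i<n. h i (x i) * exp (- \<i> * complex_of_real (x i * \<xi> i))) \<partial>lborel_n n)"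
    by (simp only: fourier_int_def prod_fun_def exp_dot_n prod.distrib)
  also have "\<dots> = (\<Prod>i<n. \<integral>t. h i t * exp (- \<i> * complex_of_real (t * \<xi> i)) \<partial>lborel)"
    using i by (subst lb.product_integral_prod) auto
  finally have "fourier_int n (prod_fun n h) \<xi> = \<dots>" .
  moreover have "prod_fun n h \<in> borel_measurable (lborel_n n)"
    by (rule test_function_measurable[OF prod_fun_test_function[OF sm s]])
  ultimately show ?thesis
    by (simp add: fourier_n_eq fourier1_def prod_dividef power_mult_distrib)
qed

lemma fourier_n_inversion_prod_fun:
  assumes sm: "\<And>i. i < n \<Longrightarrow> smooth1 (h i)" and s: "\<And>i t. i < n \<Longrightarrow> R < \<bar>t\<bar> \<Longrightarrow> h i t = 0"
  shows "(\<integral>\<xi>. fourier_n n (prod_fun n h) \<xi> * exp (\<i> * complex_of_real (dot_n n y \<xi>)) \<partial>lborel_n n) = prod_fun n h y"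
proof -
  have fi: "integrable lborel (fourier1 (h i))" if "i < n" for i
    using sm[OF that] s[OF that] by (intro fourier1_integrable[of _ R]) auto
  have i: "integrable lborel (\<lambda>t. fourier1 (h i) t * exp (\<i> * complex_of_real (y i * t)))" if "i < n" for i
    using fi[OF that] by (intro integrable_mult_unimodular) auto
  have "(\<integral>\<xi>. fourier_n n (prod_fun n h) \<xi> * exp (\<i> * complex_of_real (dot_n n y \<xi>)) \<partial>lborel_n n) =
    (\<integral>\<xi>. (\<Prod>i<n. fourier1 (h i) (\<xi> i) * exp (\<i> * complex_of_real (y i * \<xi> i))) \<partial>lborel_n n)"
    by (simp only: fourier_n_prod_fun[OF sm s] exp_dot_n prod.distrib)
  also have "\<dots> = (\<Prod>i<n. \<integral>t. fourier1 (h i) t * exp (\<i> * complex_of_real (y i * t)) \<partial>lborel)"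
    using i by (subst lb.product_integral_prod) auto
  also have "\<dots> = (\<Prod>i<n. h i (y i))"
    using fourier1_inversion[OF smooth1_continuous[OF sm] s fi] by (intro prod.cong) auto
  finally show ?thesis by (simp add: prod_fun_def)
qed

text \<open>A bump of width \<open>1 / \<epsilon>\<close> modulated to frequency \<open>a\<close>.
  The summand 0 gives the argument the affine shape expected by \<open>smooth1_affine\<close> and by
  the change of variables.\<close>

definition bump_packet :: "real \<Rightarrow> real \<Rightarrow> real \<Rightarrow> complex" where
  "bump_packet \<epsilon> a t = exp (\<i> * complex_of_real (a * t)) * bump (0 + \<epsilon> * t)"

lemma smooth1_bump_packet: "smooth1 (bump_packet \<epsilon> a)"
  unfolding bump_packet_def[abs_def] by (intro smooth1_mult smooth1_exp smooth1_affine smooth1_bump)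

lemma bump_packet_eq_0: "\<epsilon> > 0 \<Longrightarrow> 1 / \<epsilon> \<le> \<bar>t\<bar> \<Longrightarrow> bump_packet \<epsilon> a t = 0"
  by (simp add: bump_packet_def bump_eq_0 abs_mult field_simps)

lemma norm_bump_packet: "cmod (bump_packet \<epsilon> a t) = cmod (bump (\<epsilon> * t))"
  by (simp add: bump_packet_def norm_mult)

text \<open>Stated at \<open>a + \<epsilon> * \<eta>\<close>, because in the coordinate \<eta> all
  packets have the same spectrum up to a factor.\<close>

lemma fourier1_bump_packet:
  assumes "\<epsilon> > 0"
  shows "fourier1 (bump_packet \<epsilon> a) (a + \<epsilon> * \<eta>) = fourier1 bump \<eta> / complex_of_real \<epsilon>"
proof -
  have [simp]: "bump \<in> borel_measurable borel"
    by (rule borel_measurable_continuous_onI[OF smooth1_continuous[OF smooth1_bump]])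
  have "(\<integral>t. bump t * exp (- \<i> * complex_of_real (t * \<eta>)) \<partial>lborel) =
      \<bar>\<epsilon>\<bar> *\<^sub>R (\<integral>t. bump (0 + \<epsilon> * t) * exp (- \<i> * complex_of_real ((0 + \<epsilon> * t) * \<eta>)) \<partial>lborel)"
    using assms by (intro lborel_integral_real_affine) auto
  also have "(\<lambda>t. bump (0 + \<epsilon> * t) * exp (- \<i> * complex_of_real ((0 + \<epsilon> * t) * \<eta>))) =
      (\<lambda>t. bump_packet \<epsilon> a t * exp (- \<i> * complex_of_real (t * (a + \<epsilon> * \<eta>))))"
  proof
    fix t
    have "exp (- \<i> * complex_of_real ((0 + \<epsilon> * t) * \<eta>)) =
       exp (\<i> * complex_of_real (a * t)) * exp (- \<i> * complex_of_real (t * (a + \<epsilon> * \<eta>)))"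
      by (simp add: mult_exp_exp algebra_simps)
    then show "bump (0 + \<epsilon> * t) * exp (- \<i> * complex_of_real ((0 + \<epsilon> * t) * \<eta>)) =
      bump_packet \<epsilon> a t * exp (- \<i> * complex_of_real (t * (a + \<epsilon> * \<eta>)))"
      by (simp only: bump_packet_def mult_ac)
  qed
  finally show ?thesis
    using assms unfolding fourier1_def by (simp add: scaleR_conv_of_real)
qed

section \<open>Concentrating a spectrum on a set of positive measure\<close>

lemma emeasure_Int_cube_pos:
  assumes "S \<in> sets (lborel_n n)" "emeasure (lborel_n n) S > 0"
  obtains R where "emeasure (lborel_n n) (S \<inter> cube n R) > 0"
proof (rule ccontr)
  assume "\<not> thesis"
  with that have z: "emeasure (lborel_n n) (S \<inter> cube n R) = 0" for R by (metis not_gr_zero)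
  have "S = (\<Union>k::nat. S \<inter> cube n (real k))"
  proof (intro equalityI subsetI)
    fix x assume x: "x \<in> S"
    then have "x \<in> Rn n" using sets.sets_into_space[OF assms(1)] by (auto simp: space_lborel_n)
    moreover obtain k :: nat where k: "(\<Sum>i<n. \<bar>x i\<bar>) \<le> real k" using real_arch_simple by blast
    have "\<bar>x i\<bar> \<le> real k" if "i < n" for i
      using that by (intro order_trans[OF member_le_sum[of i "{..<n}" "\<lambda>i. \<bar>x i\<bar>"] k]) auto
    ultimately show "x \<in> (\<Union>k::nat. S \<inter> cube n (real k))" using x by (auto simp: mem_cube)
  qed auto
  moreover have "emeasure (lborel_n n) (\<Union>k::nat. S \<inter> cube n (real k)) = 0"
    using z assms(1) by (intro emeasure_UN_eq_0) auto
  ultimately show False using assms(2) by simp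
qed

text \<open>Averaged over \<open>a\<close> in a bounded part of \<open>S\<close>, the integral tends to 0 with \<open>\<epsilon>\<close> by translation
  continuity and dominated convergence.\<close>

lemma exists_concentration_point:
  fixes G :: "(nat \<Rightarrow> real) \<Rightarrow> real"
  assumes S[measurable]: "S \<in> sets (lborel_n n)" and pos: "emeasure (lborel_n n) S > 0"
    and G: "integrable (lborel_n n) G" "\<And>\<eta>. G \<eta> \<ge> 0" and \<tau>: "\<tau> > 0"
  shows "\<exists>a\<in>Rn n. \<exists>\<epsilon>>0.
    (\<integral>\<^sup>+\<eta>. ennreal (G \<eta>) * indicator (- S) (affine_map n \<epsilon> a \<eta>) \<partial>lborel_n n) \<le> ennreal \<tau>"
proof (rule ccontr)
  assume neg: "\<not> ?thesis"
  note [measurable] = borel_measurable_integrable[OF G(1)]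
  interpret sigma_finite_measure "lborel_n n" by (rule sigma_finite_lborel_n)
  interpret P: pair_sigma_finite "lborel_n n" "lborel_n n" by standard
  obtain R where R: "emeasure (lborel_n n) (S \<inter> cube n R) > 0"
    using emeasure_Int_cube_pos[OF S pos] .
  let ?E = "S \<inter> cube n R" and ?\<mu> = "lborel_n n"
  define \<epsilon> where "\<epsilon> = (\<lambda>j. 1 / real (Suc j))"
  define K where "K = (\<lambda>j a \<eta>. ennreal (G \<eta>) * indicator (- S) (affine_map n (\<epsilon> j) a \<eta>) * indicator ?E a :: ennreal)"
  have af[measurable]: "(\<lambda>(a, \<eta>). affine_map n (\<epsilon> j) a \<eta>) \<in> measurable (?\<mu> \<Otimes>\<^sub>M ?\<mu>) ?\<mu>" for j
    unfolding affine_map_def split_beta' by measurable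
  \<comment> \<open>Here \<open>- S\<close> is the complement among all functions, not within
    \<open>Rn n\<close>, so measurability is obtained from the indicator of
    \<open>S\<close>.\<close>
  have nS: "(indicator (- S) (affine_map n e a \<eta>) :: ennreal) = 1 - indicator S (affine_map n e a \<eta>)" for e a \<eta>
    by (simp add: indicator_def)
  have Km[measurable]: "(\<lambda>(a, \<eta>). K j a \<eta>) \<in> borel_measurable (?\<mu> \<Otimes>\<^sub>M ?\<mu>)" for j
    unfolding K_def nS using af[of j] by (simp add: split_beta') measurable
  define u where "u = (\<lambda>j \<eta>. \<integral>\<^sup>+a. K j a \<eta> \<partial>?\<mu>)"
  have um[measurable]: "u j \<in> borel_measurable ?\<mu>" for j
    unfolding u_def[abs_def] by measurable
  \<comment> \<open>If the claim failed at every centre and scale, integrating over the centres in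
    \<open>?E\<close> would give a positive bound independent of \<open>j\<close>, whereas after
    exchanging the integrals the limit is 0.\<close>
  have lower: "ennreal \<tau> * emeasure ?\<mu> ?E \<le> (\<integral>\<^sup>+\<eta>. u j \<eta> \<partial>?\<mu>)" for j
  proof -
    have "ennreal \<tau> * emeasure ?\<mu> ?E = (\<integral>\<^sup>+a. ennreal \<tau> * indicator ?E a \<partial>?\<mu>)"
      by (simp add: nn_integral_cmult_indicator)
    also have "\<dots> \<le> (\<integral>\<^sup>+a. (\<integral>\<^sup>+\<eta>. K j a \<eta> \<partial>?\<mu>) \<partial>?\<mu>)"
    proof (rule nn_integral_mono)
      fix a assume "a \<in> space ?\<mu>"
      then have "ennreal \<tau> \<le> (\<integral>\<^sup>+\<eta>. ennreal (G \<eta>) * indicator (- S) (affine_map n (\<epsilon> j) a \<eta>) \<partial>?\<mu>)"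
        using neg by (auto simp: space_lborel_n \<epsilon>_def not_le dest!: bspec[of _ _ a] spec[of _ "1 / real (Suc j)"])
      then show "ennreal \<tau> * indicator ?E a \<le> (\<integral>\<^sup>+\<eta>. K j a \<eta> \<partial>?\<mu>)"
        unfolding K_def by (cases "a \<in> ?E") (simp_all add: indicator_def)
    qed
    also have "\<dots> = (\<integral>\<^sup>+\<eta>. u j \<eta> \<partial>?\<mu>)"
      unfolding u_def by (rule P.Fubini'[symmetric]) (rule Km)
    finally show ?thesis .
  qed
  have "(\<lambda>j. \<integral>\<^sup>+\<eta>. u j \<eta> \<partial>?\<mu>) \<longlonglongrightarrow> (\<integral>\<^sup>+\<eta>. 0 \<partial>?\<mu>)"
  proof (rule nn_integral_dominated_convergence[where w="\<lambda>\<eta>. ennreal (G \<eta>) * emeasure ?\<mu> (cube n R)"])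
    have ule: "u j \<eta> \<le> ennreal (G \<eta>) * ennreal (measure ?\<mu> (shift_diff n \<eta> R S j))" for j \<eta>
    proof -
      have fm: "shift_diff n \<eta> R S j \<in> fmeasurable ?\<mu>" by (rule shift_diff_fmeasurable[OF S])
      \<comment> \<open>The change of viewpoint: \<open>a + \<epsilon> \<eta>\<close> is read as the
        point \<open>a\<close> translated by a small multiple of \<eta>. A centre in
        \<open>?E\<close> that leaves \<open>S\<close> lies in \<open>shift_diff\<close>.\<close>
      have eq: "affine_map n (\<epsilon> j) a \<eta> = affine_map n 1 (\<lambda>i. \<eta> i / real (Suc j)) a" for a
        by (auto simp: affine_map_def \<epsilon>_def fun_eq_iff)
      have "u j \<eta> \<le> (\<integral>\<^sup>+a. ennreal (G \<eta>) * indicator (shift_diff n \<eta> R S j) a \<partial>?\<mu>)"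
        unfolding u_def by (rule nn_integral_mono) (auto simp: K_def eq shift_diff_def indicator_def)
      also have "\<dots> = ennreal (G \<eta>) * emeasure ?\<mu> (shift_diff n \<eta> R S j)"
        using fm by (intro nn_integral_cmult_indicator) auto
      finally show ?thesis using fm by (simp add: emeasure_eq_measure2)
    qed
    show "AE \<eta> in ?\<mu>. u j \<eta> \<le> ennreal (G \<eta>) * emeasure ?\<mu> (cube n R)" for j
    proof (rule AE_I2)
      fix \<eta>
      have "measure ?\<mu> (shift_diff n \<eta> R S j) \<le> measure ?\<mu> (cube n R)"
        using shift_diff_fmeasurable[OF S, of \<eta> R j] fmeasurable_cube[of n R]
        by (intro measure_mono_fmeasurable) (auto simp: shift_diff_def)
      then have "ennreal (measure ?\<mu> (shift_diff n \<eta> R S j)) \<le> emeasure ?\<mu> (cube n R)"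
        using fmeasurable_cube[of n R] by (simp add: emeasure_eq_measure2 ennreal_leI)
      then show "u j \<eta> \<le> ennreal (G \<eta>) * emeasure ?\<mu> (cube n R)"
        by (intro order_trans[OF ule] mult_left_mono) auto
    qed
    have "(\<integral>\<^sup>+\<eta>. ennreal (G \<eta>) * emeasure ?\<mu> (cube n R) \<partial>?\<mu>) = (\<integral>\<^sup>+\<eta>. ennreal (G \<eta>) \<partial>?\<mu>) * emeasure ?\<mu> (cube n R)"
      by (rule nn_integral_multc) measurable
    also have "\<dots> < \<infinity>"
      using emeasure_cube_finite[of n R] G
      by (auto simp: ennreal_mult_less_top nn_integral_eq_integral)
    finally show "(\<integral>\<^sup>+\<eta>. ennreal (G \<eta>) * emeasure ?\<mu> (cube n R) \<partial>?\<mu>) < \<infinity>" .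
    show "AE \<eta> in ?\<mu>. (\<lambda>j. u j \<eta>) \<longlonglongrightarrow> 0"
    proof (rule AE_I2)
      fix \<eta>
      have "(\<lambda>j. ennreal (G \<eta> * measure ?\<mu> (shift_diff n \<eta> R S j))) \<longlonglongrightarrow> ennreal (G \<eta> * 0)"
        using shift_cont_sets[OF S, of \<eta>] by (intro tendsto_ennrealI tendsto_mult) (auto simp: shift_cont_def)
      then have "(\<lambda>j. ennreal (G \<eta>) * ennreal (measure ?\<mu> (shift_diff n \<eta> R S j))) \<longlonglongrightarrow> 0"
        using G(2) by (simp add: ennreal_mult)
      then show "(\<lambda>j. u j \<eta>) \<longlonglongrightarrow> 0"
        using ule[of _ \<eta>] tendsto_sandwich[of "\<lambda>_. 0" "\<lambda>j. u j \<eta>" sequentially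
            "\<lambda>j. ennreal (G \<eta>) * ennreal (measure ?\<mu> (shift_diff n \<eta> R S j))" 0]
        by simp
    qed
  qed measurable
  then have "ennreal \<tau> * emeasure ?\<mu> ?E \<le> (\<integral>\<^sup>+\<eta>. 0 \<partial>?\<mu>)"
    by (rule LIMSEQ_le_const) (use lower in blast)
  then show False using R \<tau> by simp
qed

section \<open>The supremum norm is dominated by the multiplier norm\<close>


text \<open>The modulus of the Fourier transform of the packet with \<epsilon> = 1 and frequency
  0.\<close>

definition bump_spectrum :: "nat \<Rightarrow> (nat \<Rightarrow> real) \<Rightarrow> real" where
  "bump_spectrum n \<eta> = (\<Prod>i<n. cmod (fourier1 bump (\<eta> i)))"

lemma integrable_bump_spectrum: "integrable (lborel_n n) (bump_spectrum n)"
  unfolding bump_spectrum_def[abs_def]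
  by (intro lb.product_integrable_prod integrable_norm fourier1_integrable[of _ 1] smooth1_bump)
     (auto intro: bump_eq_0)

definition packet :: "nat \<Rightarrow> real \<Rightarrow> (nat \<Rightarrow> real) \<Rightarrow> (nat \<Rightarrow> real) \<Rightarrow> complex" where
  "packet n \<epsilon> a = prod_fun n (\<lambda>i. bump_packet \<epsilon> (a i))"

lemma packet_test_function: "\<epsilon> > 0 \<Longrightarrow> packet n \<epsilon> a \<in> test_functions n"
  unfolding packet_def
  by (rule prod_fun_test_function[of _ _ "1 / \<epsilon>"]) (auto intro: smooth1_bump_packet bump_packet_eq_0)

lemma packet_inversion:
  "\<epsilon> > 0 \<Longrightarrow> (\<integral>\<xi>. fourier_n n (packet n \<epsilon> a) \<xi> * exp (\<i> * complex_of_real (dot_n n y \<xi>)) \<partial>lborel_n n) = packet n \<epsilon> a y"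
  unfolding packet_def
  by (rule fourier_n_inversion_prod_fun[of _ _ "1 / \<epsilon>"]) (auto intro: smooth1_bump_packet bump_packet_eq_0)

lemma norm_fourier_n_packet:
  assumes "\<epsilon> > 0"
  shows "cmod (fourier_n n (packet n \<epsilon> a) (affine_map n \<epsilon> a \<eta>)) = bump_spectrum n \<eta> / \<epsilon> ^ n"
proof -
  have "fourier_n n (packet n \<epsilon> a) (affine_map n \<epsilon> a \<eta>) =
      (\<Prod>i<n. fourier1 (bump_packet \<epsilon> (a i)) (affine_map n \<epsilon> a \<eta> i))"
    unfolding packet_def using assms
    by (intro fourier_n_prod_fun[of _ _ "1 / \<epsilon>"]) (auto intro: smooth1_bump_packet bump_packet_eq_0)
  also have "\<dots> = (\<Prod>i<n. fourier1 bump (\<eta> i) / complex_of_real \<epsilon>)"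
    using fourier1_bump_packet[OF assms] by (intro prod.cong) (auto simp: affine_map_nth)
  finally show ?thesis
    using assms by (simp add: bump_spectrum_def prod_dividef norm_divide prod_norm norm_power)
qed

text \<open>The Jacobian \<open>\<epsilon> ^ n\<close> cancels the height
  \<open>1 / \<epsilon> ^ n\<close> of the spectrum, so its total mass depends neither on
  \<open>a\<close> nor on \<epsilon>.\<close>

lemma nn_integral_fourier_packet:
  assumes e: "\<epsilon> > 0" and S[measurable]: "S \<in> sets (lborel_n n)"
  shows "(\<integral>\<^sup>+\<xi>. ennreal (cmod (fourier_n n (packet n \<epsilon> a) \<xi>)) * indicator S \<xi> \<partial>lborel_n n) =
    (\<integral>\<^sup>+\<eta>. ennreal (bump_spectrum n \<eta>) * indicator S (affine_map n \<epsilon> a \<eta>) \<partial>lborel_n n)"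
proof -
  note [measurable] = fourier_n_measurable[OF packet_test_function[OF e]]
    borel_measurable_integrable[OF integrable_bump_spectrum]
  have "(\<integral>\<^sup>+\<xi>. ennreal (cmod (fourier_n n (packet n \<epsilon> a) \<xi>)) * indicator S \<xi> \<partial>lborel_n n) =
    ennreal (\<epsilon> ^ n) * (\<integral>\<^sup>+\<eta>. ennreal (cmod (fourier_n n (packet n \<epsilon> a) (affine_map n \<epsilon> a \<eta>))) * indicator S (affine_map n \<epsilon> a \<eta>) \<partial>lborel_n n)"
    by (rule nn_integral_lborel_n_affine[OF e]) measurable
  also have "\<dots> = (\<integral>\<^sup>+\<eta>. ennreal (\<epsilon> ^ n) * (ennreal (bump_spectrum n \<eta> / \<epsilon> ^ n) * indicator S (affine_map n \<epsilon> a \<eta>)) \<partial>lborel_n n)"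
    unfolding norm_fourier_n_packet[OF e] by (rule nn_integral_cmult[symmetric]) measurable
  also have "\<dots> = (\<integral>\<^sup>+\<eta>. ennreal (bump_spectrum n \<eta>) * indicator S (affine_map n \<epsilon> a \<eta>) \<partial>lborel_n n)"
    using e by (intro nn_integral_cong) (simp add: mult.assoc[symmetric] ennreal_mult''[symmetric] bump_spectrum_def prod_nonneg)
  finally show ?thesis .
qed

lemma leb_measurable: "f \<in> borel_measurable (lborel_n n) \<Longrightarrow> f \<in> borel_measurable (leb_n n)"
  unfolding leb_n_def by (rule measurable_completion)

lemma unimodular_dot_measurable:
  "(\<lambda>\<xi>. exp (\<i> * complex_of_real (dot_n n y \<xi>))) \<in> borel_measurable (lborel_n n)"
  unfolding dot_n_def by measurable

lemma multiplier_op_integrable: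
  assumes m: "m \<in> borel_measurable (leb_n n)" "\<And>\<xi>. \<xi> \<in> Rn n \<Longrightarrow> cmod (m \<xi>) \<le> M"
    and f: "f \<in> test_functions n"
  shows "integrable (leb_n n) (\<lambda>\<xi>. m \<xi> * fourier_n n f \<xi> * exp (\<i> * complex_of_real (dot_n n y \<xi>)))"
proof (rule Bochner_Integration.integrable_bound)
  show "integrable (leb_n n) (\<lambda>\<xi>. M * cmod (fourier_n n f \<xi>))"
    by (intro integrable_mult_right integrable_norm fourier_n_integrable_leb f)
  show "(\<lambda>\<xi>. m \<xi> * fourier_n n f \<xi> * exp (\<i> * complex_of_real (dot_n n y \<xi>))) \<in> borel_measurable (leb_n n)"
    using m(1) leb_measurable[OF fourier_n_measurable[OF f]] leb_measurable[OF unimodular_dot_measurable]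
    by (intro borel_measurable_times) auto
  show "AE \<xi> in leb_n n. norm (m \<xi> * fourier_n n f \<xi> * exp (\<i> * complex_of_real (dot_n n y \<xi>))) \<le> norm (M * cmod (fourier_n n f \<xi>))"
    using AE_space
  proof eventually_elim
    case (elim \<xi>)
    then have "cmod (m \<xi>) \<le> \<bar>M\<bar>" using m(2)[of \<xi>] by (simp add: space_leb_n)
    then show ?case by (simp add: norm_mult abs_mult mult_right_mono)
  qed
qed

text \<open>By inversion \<open>c\<close> times the packet is the multiplier operator of the
  constant symbol \<open>c\<close>, so the difference is bounded, uniformly in \<open>y\<close>, by
  the integral of \<open>\<bar>m - c\<bar>\<close> against the modulus of the spectrum. That
  integral is small on \<open>S\<close> because \<open>m\<close> is near \<open>c\<close> there, and
  small off \<open>S\<close> because little of the spectrum lies there.\<close>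

lemma packet_almost_eigenfunction:
  fixes m :: "(nat \<Rightarrow> real) \<Rightarrow> complex"
  assumes m: "m \<in> borel_measurable (leb_n n)" "\<And>\<xi>. \<xi> \<in> Rn n \<Longrightarrow> cmod (m \<xi>) \<le> M"
    and ess: "\<And>\<delta>. \<delta> > 0 \<Longrightarrow> emeasure (leb_n n) {\<xi> \<in> Rn n. cmod (m \<xi> - c) < \<delta>} > 0"
    and \<tau>: "\<tau> > 0"
  shows "\<exists>a. \<exists>\<epsilon>>0. \<forall>y. cmod (multiplier_op n m (packet n \<epsilon> a) y - c * packet n \<epsilon> a y) \<le> \<tau>"
proof -
  define \<kappa> where "\<kappa> = (\<integral>\<eta>. bump_spectrum n \<eta> \<partial>lborel_n n)"
  have sp0: "bump_spectrum n \<eta> \<ge> 0" for \<eta> by (simp add: bump_spectrum_def prod_nonneg)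
  have \<kappa>0: "\<kappa> \<ge> 0" unfolding \<kappa>_def using sp0 by simp
  define L where "L = \<bar>M\<bar> + cmod c"
  have L0: "L \<ge> 0" by (simp add: L_def)
  \<comment> \<open>With \<kappa> the mass of the spectrum and \<open>L\<close> a bound for
    \<open>\<bar>m - c\<bar>\<close>, each of the two contributions gets \<open>\<tau> / 2\<close>;
    the added 1 keeps the denominators positive.\<close>
  define \<delta> where "\<delta> = \<tau> / (2 * (\<kappa> + 1))"
  define \<tau>' where "\<tau>' = \<tau> / (2 * (L + 1))"
  have \<delta>: "\<delta> > 0" "\<delta> * \<kappa> \<le> \<tau> / 2" using \<tau> \<kappa>0 by (auto simp: \<delta>_def field_simps)
  have \<tau>': "\<tau>' > 0" "L * \<tau>' \<le> \<tau> / 2" using \<tau> L0 by (auto simp: \<tau>'_def field_simps)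
  define S0 where "S0 = {\<xi> \<in> Rn n. cmod (m \<xi> - c) < \<delta>}"
  have "{\<xi> \<in> space (leb_n n). cmod (m \<xi> - c) < \<delta>} \<in> sets (leb_n n)"
    using m(1) by measurable
  then have S0: "S0 \<in> sets (completion (lborel_n n))"
    unfolding S0_def space_leb_n unfolding leb_n_def .
  \<comment> \<open>The set \<open>S0\<close> is only Lebesgue measurable; its main part is a subset
    of the same measure that is measurable before completion.\<close>
  define S where "S = main_part (lborel_n n) S0"
  have S[measurable]: "S \<in> sets (lborel_n n)" unfolding S_def using S0 by simp
  have SS0: "S \<subseteq> S0" unfolding S_def using main_part_null_part_Un[OF S0] by blast
  have "emeasure (lborel_n n) S > 0"
    using ess[OF \<delta>(1)] S0 unfolding S_def S0_def[symmetric] leb_n_def by simp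
  from exists_concentration_point[OF S this integrable_bump_spectrum sp0 \<tau>'(1)]
  obtain a \<epsilon> where e: "\<epsilon> > 0" and conc:
    "(\<integral>\<^sup>+\<eta>. ennreal (bump_spectrum n \<eta>) * indicator (- S) (affine_map n \<epsilon> a \<eta>) \<partial>lborel_n n) \<le> ennreal \<tau>'"
    by blast
  let ?F = "fourier_n n (packet n \<epsilon> a)"
  note F[measurable] = fourier_n_measurable[OF packet_test_function[OF e, of n a]]
  have Fi: "integrable (leb_n n) ?F" by (rule fourier_n_integrable_leb[OF packet_test_function[OF e]])
  have F1: "(\<integral>\<^sup>+\<xi>. ennreal (cmod (?F \<xi>)) \<partial>lborel_n n) = ennreal \<kappa>"
  proof -
    have "(\<integral>\<^sup>+\<xi>. ennreal (cmod (?F \<xi>)) \<partial>lborel_n n) = (\<integral>\<^sup>+\<xi>. ennreal (cmod (?F \<xi>)) * indicator (space (lborel_n n)) \<xi> \<partial>lborel_n n)"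
      by (intro nn_integral_cong) simp
    also have "\<dots> = (\<integral>\<^sup>+\<eta>. ennreal (bump_spectrum n \<eta>) * indicator (space (lborel_n n)) (affine_map n \<epsilon> a \<eta>) \<partial>lborel_n n)"
      by (rule nn_integral_fourier_packet[OF e]) simp
    also have "\<dots> = (\<integral>\<^sup>+\<eta>. ennreal (bump_spectrum n \<eta>) \<partial>lborel_n n)"
      by (intro nn_integral_cong) (simp add: affine_map_in_Rn space_lborel_n)
    also have "\<dots> = ennreal \<kappa>"
      unfolding \<kappa>_def by (rule nn_integral_eq_integral[OF integrable_bump_spectrum]) (simp add: sp0)
    finally show ?thesis .
  qed
  have F2: "(\<integral>\<^sup>+\<xi>. ennreal (cmod (?F \<xi>)) * indicator (Rn n - S) \<xi> \<partial>lborel_n n) \<le> ennreal \<tau>'"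
  proof -
    have "Rn n - S \<in> sets (lborel_n n)" using sets.compl_sets[OF S] by (simp add: space_lborel_n)
    from nn_integral_fourier_packet[OF e this, of a]
    have "(\<integral>\<^sup>+\<xi>. ennreal (cmod (?F \<xi>)) * indicator (Rn n - S) \<xi> \<partial>lborel_n n) =
      (\<integral>\<^sup>+\<eta>. ennreal (bump_spectrum n \<eta>) * indicator (Rn n - S) (affine_map n \<epsilon> a \<eta>) \<partial>lborel_n n)" .
    also have "\<dots> = (\<integral>\<^sup>+\<eta>. ennreal (bump_spectrum n \<eta>) * indicator (- S) (affine_map n \<epsilon> a \<eta>) \<partial>lborel_n n)"
      by (intro nn_integral_cong) (simp add: affine_map_in_Rn indicator_def)
    finally show ?thesis using conc by simp
  qed
  have "cmod (multiplier_op n m (packet n \<epsilon> a) y - c * packet n \<epsilon> a y) \<le> \<tau>" for y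
  proof -
    let ?e = "\<lambda>\<xi>. exp (\<i> * complex_of_real (dot_n n y \<xi>))"
    have i1: "integrable (leb_n n) (\<lambda>\<xi>. m \<xi> * ?F \<xi> * ?e \<xi>)"
      by (rule multiplier_op_integrable[OF m packet_test_function[OF e]])
    have i2: "integrable (leb_n n) (\<lambda>\<xi>. c * ?F \<xi> * ?e \<xi>)"
      by (rule multiplier_op_integrable[OF _ _ packet_test_function[OF e], of _ _ "cmod c"]) auto
    have "c * packet n \<epsilon> a y = (\<integral>\<xi>. c * (?F \<xi> * ?e \<xi>) \<partial>lborel_n n)"
      using packet_inversion[OF e, of n a y] by simp
    also have "\<dots> = (\<integral>\<xi>. c * ?F \<xi> * ?e \<xi> \<partial>leb_n n)"
      unfolding leb_n_def using unimodular_dot_measurable by (subst integral_completion) (auto simp: mult.assoc)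
    finally have "multiplier_op n m (packet n \<epsilon> a) y - c * packet n \<epsilon> a y =
       (\<integral>\<xi>. m \<xi> * ?F \<xi> * ?e \<xi> - c * ?F \<xi> * ?e \<xi> \<partial>leb_n n)"
      unfolding multiplier_op_def using i1 i2 by simp
    then have "ennreal (cmod (multiplier_op n m (packet n \<epsilon> a) y - c * packet n \<epsilon> a y)) \<le>
       (\<integral>\<^sup>+\<xi>. ennreal (cmod (m \<xi> * ?F \<xi> * ?e \<xi> - c * ?F \<xi> * ?e \<xi>)) \<partial>leb_n n)"
      using integral_norm_bound_ennreal[OF Bochner_Integration.integrable_diff[OF i1 i2]] by simp
    also have "\<dots> \<le> (\<integral>\<^sup>+\<xi>. ennreal \<delta> * ennreal (cmod (?F \<xi>)) + ennreal L * (ennreal (cmod (?F \<xi>)) * indicator (Rn n - S) \<xi>) \<partial>leb_n n)"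
    proof (rule nn_integral_mono)
      fix \<xi> assume "\<xi> \<in> space (leb_n n)"
      then have \<xi>: "\<xi> \<in> Rn n" by (simp add: space_leb_n)
      have "cmod (m \<xi> * ?F \<xi> * ?e \<xi> - c * ?F \<xi> * ?e \<xi>) = cmod ((m \<xi> - c) * (?F \<xi> * ?e \<xi>))"
        by (simp add: algebra_simps)
      also have "\<dots> = cmod (m \<xi> - c) * cmod (?F \<xi>)" by (simp add: norm_mult)
      also have "\<dots> \<le> \<delta> * cmod (?F \<xi>) + L * (cmod (?F \<xi>) * indicator (Rn n - S) \<xi>)"
      proof (cases "\<xi> \<in> S")
        case True
        then show ?thesis using SS0 by (auto simp: S0_def intro!: mult_right_mono)
      next
        case False
        have "cmod (m \<xi> - c) \<le> L"
          using m(2)[OF \<xi>] norm_triangle_ineq4[of "m \<xi>" c] by (simp add: L_def)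
        then have "cmod (m \<xi> - c) * cmod (?F \<xi>) \<le> L * cmod (?F \<xi>)" by (rule mult_right_mono) simp
        moreover have "0 \<le> \<delta> * cmod (?F \<xi>)" using \<delta> by simp
        ultimately show ?thesis using False \<xi> by simp
      qed
      finally have "ennreal (cmod (m \<xi> * ?F \<xi> * ?e \<xi> - c * ?F \<xi> * ?e \<xi>)) \<le>
        ennreal (\<delta> * cmod (?F \<xi>) + L * (cmod (?F \<xi>) * indicator (Rn n - S) \<xi>))" by (rule ennreal_leI)
      also have "\<dots> = ennreal \<delta> * ennreal (cmod (?F \<xi>)) + ennreal L * (ennreal (cmod (?F \<xi>)) * indicator (Rn n - S) \<xi>)"
        using \<delta> L0 by (simp add: ennreal_mult indicator_def)
      finally show "ennreal (cmod (m \<xi> * ?F \<xi> * ?e \<xi> - c * ?F \<xi> * ?e \<xi>)) \<le> \<dots>" .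
    qed
    also have "\<dots> = (\<integral>\<^sup>+\<xi>. ennreal \<delta> * ennreal (cmod (?F \<xi>)) + ennreal L * (ennreal (cmod (?F \<xi>)) * indicator (Rn n - S) \<xi>) \<partial>lborel_n n)"
      unfolding leb_n_def by (rule nn_integral_completion)
    also have "\<dots> = ennreal \<delta> * ennreal \<kappa> + ennreal L * (\<integral>\<^sup>+\<xi>. ennreal (cmod (?F \<xi>)) * indicator (Rn n - S) \<xi> \<partial>lborel_n n)"
    proof -
      have [measurable]: "Rn n - S \<in> sets (lborel_n n)" using sets.compl_sets[OF S] by (simp add: space_lborel_n)
      show ?thesis by (simp add: nn_integral_add nn_integral_cmult F1)
    qed
    also have "\<dots> \<le> ennreal \<delta> * ennreal \<kappa> + ennreal L * ennreal \<tau>'"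
      by (intro add_left_mono mult_left_mono F2) simp
    also have "\<dots> = ennreal (\<delta> * \<kappa> + L * \<tau>')"
      using \<delta> \<kappa>0 L0 \<tau>' by (simp add: ennreal_mult)
    also have "\<dots> \<le> ennreal \<tau>" using \<delta>(2) \<tau>'(2) by (intro ennreal_leI) linarith
    finally show ?thesis using \<tau> by (simp add: ennreal_le_iff)
  qed
  with e show ?thesis by blast
qed

text \<open>Adds the endpoint 0 to the convexity on the open half line: there the inequality reduces
  to \<open>s powr p \<le> s\<close> for \<open>s\<close> between 0 and 1.\<close>

lemma convex_on_powr_nonneg:
  fixes p :: real
  assumes p: "p \<ge> 1"
  shows "convex_on {0..} (\<lambda>x. x powr p)"
proof (rule convex_onI)
  fix t x y :: real assume t: "0 < t" "t < 1" and xy: "x \<in> {0..}" "y \<in> {0..}"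
  have le: "(s * z) powr p \<le> s * z powr p" if "0 < s" "s < 1" for s z :: real
  proof -
    have "s powr p \<le> s powr 1" using that p by (intro powr_mono') auto
    then show ?thesis using that by (simp add: powr_mult mult_right_mono)
  qed
  show "((1 - t) *\<^sub>R x + t *\<^sub>R y) powr p \<le> (1 - t) * x powr p + t * y powr p"
  proof (cases "x = 0 \<or> y = 0")
    case True
    then show ?thesis using le[OF t, of y] le[of "1 - t" x] t p by auto
  next
    case False
    then show ?thesis using t xy by (intro convex_onD[OF powr_convex[OF p]]) auto
  qed
qed simp

text \<open>Convexity applied to \<open>a / (1 - \<theta>)\<close> and \<open>b / \<theta>\<close>.
  The coefficient of \<open>a powr p\<close> tends to 1 with \<theta>, so a vanishing
  \<open>b\<close> loses nothing in the limit.\<close>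

lemma powr_sum_le:
  fixes a b :: real
  assumes "a \<ge> 0" "b \<ge> 0" "p \<ge> 1" "0 < \<theta>" "\<theta> < 1"
  shows "(a + b) powr p \<le> (1 - \<theta>) powr (1 - p) * a powr p + \<theta> powr (1 - p) * b powr p"
proof -
  have "((1 - \<theta>) *\<^sub>R (a / (1 - \<theta>)) + \<theta> *\<^sub>R (b / \<theta>)) powr p
     \<le> (1 - \<theta>) * (a / (1 - \<theta>)) powr p + \<theta> * (b / \<theta>) powr p"
    using assms by (intro convex_onD[OF convex_on_powr_nonneg]) auto
  moreover have "t * (x / t) powr p = t powr (1 - p) * x powr p" if "t > 0" "x \<ge> 0" for t x :: real
    using that by (simp add: powr_divide powr_diff)
  ultimately show ?thesis using assms by simp
qed

lemma prod_powr: "(\<And>i. i < n \<Longrightarrow> f i \<ge> (0::real)) \<Longrightarrow> (\<Prod>i<n::nat. f i) powr p = (\<Prod>i<n. f i powr p)"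
  by (induction n) (simp_all add: powr_mult prod_nonneg)

lemma bump_powr_integral:
  assumes "p > 0"
  shows "integrable lborel (\<lambda>t. cmod (bump t) powr p)" "(\<integral>t. cmod (bump t) powr p \<partial>lborel) > 0"
proof -
  show i: "integrable lborel (\<lambda>t. cmod (bump t) powr p)"
    using assms bump_eq_0 smooth1_continuous[OF smooth1_bump]
    by (intro integrable_continuous_support[of _ 1] continuous_on_powr' continuous_intros) auto
  show "(\<integral>t. cmod (bump t) powr p \<partial>lborel) > 0"
  proof (rule ccontr)
    assume "\<not> ?thesis"
    moreover have "0 \<le> (\<integral>t. cmod (bump t) powr p \<partial>lborel)"
      by (intro integral_nonneg_AE) simp
    ultimately have "(\<integral>t. cmod (bump t) powr p \<partial>lborel) = 0" by linarith
    then have "AE t in lborel. cmod (bump t) powr p = 0"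
      using integral_nonneg_eq_0_iff_AE[OF i] by simp
    then have "AE t in lborel. t \<notin> {-1<..<1::real}"
      by eventually_elim (use bump_nonzero in \<open>auto simp: abs_less_iff\<close>)
    then have "{-1<..<1::real} \<in> null_sets lborel"
      by (subst (asm) AE_iff_null_sets[symmetric]) auto
    then have "emeasure lborel {-1<..<1::real} = 0" by (rule null_setsD1)
    moreover have "emeasure lborel {-1<..<1::real} = ennreal (1 - (-1))"
      by (rule emeasure_lborel_Ioo) simp
    ultimately show False by simp
  qed
qed

lemma packet_Lp:
  assumes p: "p > 0" and e: "\<epsilon> > 0"
  shows "packet n \<epsilon> a \<in> Lp_space n p"
    and "(\<integral>y. cmod (packet n \<epsilon> a y) powr p \<partial>leb_n n) = ((\<integral>t. cmod (bump t) powr p \<partial>lborel) / \<epsilon>) ^ n"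
proof -
  define w where "w = (\<lambda>t. cmod (bump (0 + \<epsilon> * t)) powr p)"
  note [measurable] = test_function_measurable[OF packet_test_function[OF e, of n a]]
  have eq: "cmod (packet n \<epsilon> a y) powr p = (\<Prod>i<n. w (y i))" for y
    by (simp add: packet_def prod_fun_def w_def norm_bump_packet prod_norm[symmetric] prod_powr)
  have wi: "integrable lborel w"
    unfolding w_def using e by (intro lborel_integrable_real_affine bump_powr_integral p) auto
  have wI: "integral\<^sup>L lborel w = (\<integral>t. cmod (bump t) powr p \<partial>lborel) / \<epsilon>"
    using lborel_integral_real_affine[of \<epsilon> "\<lambda>t. cmod (bump t) powr p" 0] e
    unfolding w_def by (simp add: field_simps)
  have i: "integrable (lborel_n n) (\<lambda>y. cmod (packet n \<epsilon> a y) powr p)"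
    unfolding eq by (intro lb.product_integrable_prod wi) simp
  then show "packet n \<epsilon> a \<in> Lp_space n p"
    unfolding Lp_space_def leb_n_def
    by (auto simp: integrable_completion intro: measurable_completion)
  show "(\<integral>y. cmod (packet n \<epsilon> a y) powr p \<partial>leb_n n) = ((\<integral>t. cmod (bump t) powr p \<partial>lborel) / \<epsilon>) ^ n"
    unfolding leb_n_def integral_completion[OF borel_measurable_integrable[OF i]]
    unfolding eq by (subst lb.product_integral_prod) (simp_all add: wi wI)
qed

lemma Lp_norm_powr:
  assumes "p > 0"
  shows "Lp_norm n p f powr p = (\<integral>x. cmod (f x) powr p \<partial>leb_n n)"
  using assms by (simp add: Lp_norm_def powr_powr)

text \<open>On a packet \<open>f\<close>, the \<open>p\<close>-th power of \<open>c f\<close> is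
  compared pointwise with that of \<open>T f\<close> plus a uniform error on the supporting cube.
  Integrating brings in the bound \<open>B\<close> for \<open>T\<close>.\<close>

theorem essential_range_le_multiplier_bound:
  fixes m :: "(nat \<Rightarrow> real) \<Rightarrow> complex"
  assumes p: "p \<ge> 1"
    and m: "m \<in> borel_measurable (leb_n n)" "\<And>\<xi>. \<xi> \<in> Rn n \<Longrightarrow> cmod (m \<xi>) \<le> M"
    and ess: "\<And>\<delta>. \<delta> > 0 \<Longrightarrow> emeasure (leb_n n) {\<xi> \<in> Rn n. cmod (m \<xi> - c) < \<delta>} > 0"
    and T: "Lp_extension n p m T"
    and B: "B \<ge> 0" "\<And>f. f \<in> Lp_space n p \<Longrightarrow> Lp_norm n p (T f) \<le> B * Lp_norm n p f"
  shows "cmod c \<le> B"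
proof -
  define J where "J = (\<integral>t. cmod (bump t) powr p \<partial>lborel)"
  have J: "J > 0" unfolding J_def using p by (intro bump_powr_integral) simp
  have key: "cmod c powr p * J ^ n \<le> (1 - \<theta>) powr (1 - p) * (B powr p * J ^ n) + \<theta> powr (1 - p) * 2 ^ n * s"
    if \<theta>: "0 < \<theta>" "\<theta> < 1" and s: "s > 0" for \<theta> s
  proof -
    \<comment> \<open>The tolerance is chosen so that its \<open>p\<close>-th power is exactly
      \<open>s\<close>.\<close>
    obtain a \<epsilon> where e: "\<epsilon> > 0" and ae: "\<And>y. cmod (multiplier_op n m (packet n \<epsilon> a) y - c * packet n \<epsilon> a y) \<le> s powr (1 / p)"
      using packet_almost_eigenfunction[OF m ess, of "s powr (1 / p)"] s by auto
    let ?f = "packet n \<epsilon> a"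
    have fL: "?f \<in> Lp_space n p" using p e by (intro packet_Lp) auto
    have fI: "(\<integral>y. cmod (?f y) powr p \<partial>leb_n n) = (J / \<epsilon>) ^ n"
      unfolding J_def using p e by (intro packet_Lp) auto
    have TL: "T ?f \<in> Lp_space n p" using T fL by (simp add: Lp_extension_def bounded_Lp_operator_def)
    have TI: "(\<integral>y. cmod (T ?f y) powr p \<partial>leb_n n) \<le> B powr p * (J / \<epsilon>) ^ n"
    proof -
      have "Lp_norm n p (T ?f) powr p \<le> (B * Lp_norm n p ?f) powr p"
        using B(2)[OF fL] p by (intro powr_mono2) (auto simp: Lp_norm_def)
      also have "\<dots> = B powr p * Lp_norm n p ?f powr p"
        by (simp add: powr_mult)
      finally show ?thesis using p by (simp add: Lp_norm_powr fI)
    qed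
    let ?w1 = "(1 - \<theta>) powr (1 - p)" and ?w2 = "\<theta> powr (1 - p)"
    have i1: "integrable (leb_n n) (\<lambda>y. cmod c powr p * cmod (?f y) powr p)"
      using fL by (simp add: Lp_space_def)
    have i2: "integrable (leb_n n) (\<lambda>y. ?w1 * cmod (T ?f y) powr p)"
      using TL by (simp add: Lp_space_def)
    have ci: "integrable (leb_n n) (indicator (cube n (1 / \<epsilon>)) :: _ \<Rightarrow> real)"
      unfolding leb_n_def using fmeasurable_cube[of n "1 / \<epsilon>"] by (subst integrable_completion) (auto simp: fmeasurable_def)
    have cI: "(\<integral>y. indicator (cube n (1 / \<epsilon>)) y \<partial>leb_n n) = (2 / \<epsilon>) ^ n"
      unfolding leb_n_def using emeasure_cube[of "1 / \<epsilon>" n] e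
      by (subst integral_completion) (auto simp: measure_def)
    have i3: "integrable (leb_n n) (\<lambda>y. ?w2 * s * indicator (cube n (1 / \<epsilon>)) y)"
      using ci by simp
    have pw: "AE y in leb_n n. cmod c powr p * cmod (?f y) powr p \<le>
       ?w1 * cmod (T ?f y) powr p + ?w2 * s * indicator (cube n (1 / \<epsilon>)) y"
    proof -
      have "AE y in leb_n n. T ?f y = multiplier_op n m ?f y"
        using T packet_test_function[OF e] by (simp add: Lp_extension_def)
      then show ?thesis using AE_space
      proof eventually_elim
        case (elim y)
        then have y: "y \<in> Rn n" by (simp add: space_leb_n)
        show ?case
        proof (cases "y \<in> cube n (1 / \<epsilon>)")
          case True
          have "cmod c powr p * cmod (?f y) powr p = cmod (c * ?f y) powr p"
            by (simp add: norm_mult powr_mult)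
          also have "\<dots> \<le> (cmod (T ?f y) + s powr (1 / p)) powr p"
          proof (rule powr_mono2)
            have "cmod (c * ?f y) \<le> cmod (T ?f y) + cmod (T ?f y - c * ?f y)"
              using norm_triangle_ineq4[of "T ?f y" "T ?f y - c * ?f y"] by simp
            also have "\<dots> \<le> cmod (T ?f y) + s powr (1 / p)" using ae[of y] elim by simp
            finally show "cmod (c * ?f y) \<le> cmod (T ?f y) + s powr (1 / p)" .
          qed (use p in auto)
          also have "\<dots> \<le> ?w1 * cmod (T ?f y) powr p + ?w2 * (s powr (1 / p)) powr p"
            using p \<theta> by (intro powr_sum_le) auto
          also have "(s powr (1 / p)) powr p = s" using s p by (simp add: powr_powr)
          finally show ?thesis using True by simp
        next
          case False
          then obtain i where "i < n" "1 / \<epsilon> < \<bar>y i\<bar>" using y by (auto simp: mem_cube not_le)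
          then have "?f y = 0"
            using e by (auto simp: packet_def prod_fun_def intro!: bump_packet_eq_0 bexI[of _ i])
          then show ?thesis using p s by simp
        qed
      qed
    qed
    have "cmod c powr p * (J / \<epsilon>) ^ n = (\<integral>y. cmod c powr p * cmod (?f y) powr p \<partial>leb_n n)"
      by (simp add: fI)
    also have "\<dots> \<le> (\<integral>y. ?w1 * cmod (T ?f y) powr p + ?w2 * s * indicator (cube n (1 / \<epsilon>)) y \<partial>leb_n n)"
      using pw i1 i2 i3 by (intro integral_mono_AE Bochner_Integration.integrable_add) auto
    also have "\<dots> = ?w1 * (\<integral>y. cmod (T ?f y) powr p \<partial>leb_n n) + ?w2 * s * (2 / \<epsilon>) ^ n"
      by (simp only: Bochner_Integration.integral_add[OF i2 i3] integral_mult_right_zero cI)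
    also have "\<dots> \<le> ?w1 * (B powr p * (J / \<epsilon>) ^ n) + ?w2 * s * (2 / \<epsilon>) ^ n"
      using TI by (intro add_right_mono mult_left_mono) auto
    \<comment> \<open>All three terms scale like \<open>1 / \<epsilon> ^ n\<close>; multiplying by
      \<open>\<epsilon> ^ n\<close> leaves an inequality free of \<epsilon>.\<close>
    finally have "(cmod c powr p * (J / \<epsilon>) ^ n) * \<epsilon> ^ n \<le> (?w1 * (B powr p * (J / \<epsilon>) ^ n) + ?w2 * s * (2 / \<epsilon>) ^ n) * \<epsilon> ^ n"
      using e by (intro mult_right_mono) auto
    moreover have "(J / \<epsilon>) ^ n * \<epsilon> ^ n = J ^ n" "(2 / \<epsilon>) ^ n * \<epsilon> ^ n = 2 ^ n"
      using e by (simp_all add: power_divide)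
    ultimately show ?thesis
      by (simp only: distrib_right mult.assoc) (simp only: mult_ac)
  qed
  have "cmod c powr p \<le> (1 - \<theta>) powr (1 - p) * B powr p" if \<theta>: "0 < \<theta>" "\<theta> < 1" for \<theta>
  proof -
    define K where "K = \<theta> powr (1 - p) * 2 ^ n"
    have K: "K > 0" using \<theta> by (simp add: K_def)
    \<comment> \<open>The error \<open>s\<close> goes to 0 while \<theta> is fixed, since its
      coefficient \<open>K\<close> may blow up as \<theta> shrinks; only afterwards does \<theta>
      tend to 0.\<close>
    have "cmod c powr p * J ^ n \<le> (1 - \<theta>) powr (1 - p) * (B powr p * J ^ n)"
    proof (rule field_le_epsilon)
      fix r :: real assume "r > 0"
      with K have "r / K > 0" by simp
      from key[OF \<theta> this, folded K_def] K
      show "cmod c powr p * J ^ n \<le> (1 - \<theta>) powr (1 - p) * (B powr p * J ^ n) + r" by simp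
    qed
    then have "cmod c powr p * J ^ n \<le> ((1 - \<theta>) powr (1 - p) * B powr p) * J ^ n" by (simp only: mult.assoc)
    then show ?thesis using J by (simp only: mult_le_cancel_right) (auto simp: zero_less_power)
  qed
  then have "eventually (\<lambda>\<theta>. cmod c powr p \<le> (1 - \<theta>) powr (1 - p) * B powr p) (at_right 0)"
    unfolding eventually_at_right_field by (intro exI[of _ 1]) auto
  moreover have "((\<lambda>\<theta>::real. (1 - \<theta>) powr (1 - p) * B powr p) \<longlongrightarrow> (1 - 0) powr (1 - p) * B powr p) (at_right 0)"
    by (intro tendsto_intros) auto
  ultimately have "cmod c powr p \<le> (1 - 0) powr (1 - p) * B powr p"
    by (intro tendsto_lowerbound) auto
  then have "cmod c powr p \<le> B powr p" by simp
  then show ?thesis using p B(1) by (metis le_less_trans less_irrefl not_le powr_less_mono2 zero_less_one)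
qed

section \<open>Absolutely convergent combinations of multipliers\<close>


text \<open>Jensen's inequality for the normalised weights \<open>w k / W\<close>; undoing the
  normalisation leaves the factor \<open>W powr (p - 1)\<close>.\<close>

lemma Jensen_powr_sum:
  fixes w a :: "nat \<Rightarrow> real"
  assumes p: "p \<ge> 1" and w: "\<And>k. w k \<ge> 0" and a: "\<And>k. a k \<ge> 0"
  shows "(\<Sum>k<N. w k * a k) powr p \<le> (\<Sum>k<N. w k) powr (p - 1) * (\<Sum>k<N. w k * a k powr p)"
proof (cases "(\<Sum>k<N. w k) = 0")
  case True
  then have "\<And>k. k < N \<Longrightarrow> w k = 0" using w by (simp add: sum_nonneg_eq_0_iff)
  then show ?thesis by simp
next
  case False
  define W where "W = (\<Sum>k<N. w k)"
  have W: "W > 0" using False w unfolding W_def by (metis less_eq_real_def sum_nonneg)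
  have N: "{..<N} \<noteq> {}" using False by auto
  have "(\<Sum>k<N. (w k / W) *\<^sub>R a k) powr p \<le> (\<Sum>k<N. (w k / W) * a k powr p)"
    using w a W by (intro convex_on_sum[OF _ N convex_on_powr_nonneg[OF p]])
      (auto simp: sum_divide_distrib[symmetric] W_def[symmetric])
  also have "(\<Sum>k<N. (w k / W) *\<^sub>R a k) = (\<Sum>k<N. w k * a k) / W"
    by (simp add: sum_divide_distrib)
  also have "(\<Sum>k<N. (w k / W) * a k powr p) = (\<Sum>k<N. w k * a k powr p) / W"
    by (simp add: sum_divide_distrib)
  finally have "(\<Sum>k<N. w k * a k) powr p / W powr p \<le> (\<Sum>k<N. w k * a k powr p) / W"
    by (simp add: powr_divide)
  then have "(\<Sum>k<N. w k * a k) powr p \<le> (\<Sum>k<N. w k * a k powr p) / W * W powr p"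
    using W by (simp add: pos_divide_le_eq)
  also have "\<dots> = W powr (p - 1) * (\<Sum>k<N. w k * a k powr p)"
    using W by (simp add: powr_diff)
  finally show ?thesis by (simp add: W_def)
qed

lemma Jensen_powr_suminf:
  fixes w a :: "nat \<Rightarrow> real"
  assumes p: "p \<ge> 1" and w: "\<And>k. w k \<ge> 0" "summable w" and a: "\<And>k. a k \<ge> 0"
    and s: "summable (\<lambda>k. w k * a k powr p)"
  shows "summable (\<lambda>k. w k * a k)"
    and "(\<Sum>k. w k * a k) powr p \<le> (\<Sum>k. w k) powr (p - 1) * (\<Sum>k. w k * a k powr p)"
proof -
  \<comment> \<open>Bounds \<open>w k * a k\<close> by \<open>w k + w k * a k powr p\<close>, from
    which summability follows.\<close>
  have le: "x \<le> 1 + x powr p" if "x \<ge> 0" for x :: real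
  proof (cases "x \<le> 1")
    case False
    then have "x powr 1 \<le> x powr p" using p by (intro powr_mono) auto
    then show ?thesis using False by simp
  qed (use add_increasing2[of "x powr p" x 1] in simp)
  show sm: "summable (\<lambda>k. w k * a k)"
  proof (rule summable_comparison_test')
    show "summable (\<lambda>k. w k + w k * a k powr p)" using w s by (intro summable_add)
    show "norm (w k * a k) \<le> w k + w k * a k powr p" for k
      using mult_left_mono[OF le[OF a[of k]] w(1)[of k]] w(1)[of k] a[of k] by (simp add: distrib_left)
  qed
  have "(\<Sum>k<N. w k * a k) powr p \<le> (\<Sum>k. w k) powr (p - 1) * (\<Sum>k. w k * a k powr p)" for N
  proof -
    have "(\<Sum>k<N. w k * a k) powr p \<le> (\<Sum>k<N. w k) powr (p - 1) * (\<Sum>k<N. w k * a k powr p)"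
      by (rule Jensen_powr_sum[OF p w(1) a])
    also have "\<dots> \<le> (\<Sum>k. w k) powr (p - 1) * (\<Sum>k. w k * a k powr p)"
      using p w s by (intro mult_mono powr_mono2 sum_le_suminf sum_nonneg) auto
    finally show ?thesis .
  qed
  moreover have "(\<lambda>N. (\<Sum>k<N. w k * a k) powr p) \<longlonglongrightarrow> (\<Sum>k. w k * a k) powr p"
    using p w a by (intro tendsto_powr2 summable_LIMSEQ[OF sm] tendsto_const)
      (auto intro!: always_eventually sum_nonneg)
  ultimately show "(\<Sum>k. w k * a k) powr p \<le> (\<Sum>k. w k) powr (p - 1) * (\<Sum>k. w k * a k powr p)"
    by (intro LIMSEQ_le_const2) auto
qed

lemma AE_summable_of_integrals:
  fixes g :: "nat \<Rightarrow> 'a \<Rightarrow> real"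
  assumes g: "\<And>k. integrable M (g k)" "\<And>k x. g k x \<ge> 0" and s: "summable (\<lambda>k. integral\<^sup>L M (g k))"
  shows "AE x in M. summable (\<lambda>k. g k x)"
proof -
  note [measurable] = borel_measurable_integrable[OF g(1)]
  have "(\<integral>\<^sup>+x. (\<Sum>k. ennreal (g k x)) \<partial>M) = (\<Sum>k. \<integral>\<^sup>+x. ennreal (g k x) \<partial>M)"
    by (intro nn_integral_suminf) measurable
  also have "\<dots> = (\<Sum>k. ennreal (integral\<^sup>L M (g k)))"
    using g by (intro arg_cong[where f=suminf] ext nn_integral_eq_integral) auto
  also have "\<dots> \<noteq> \<infinity>"
    using s g by (simp add: ennreal_suminf_neq_top integral_nonneg_AE)
  finally have "AE x in M. (\<Sum>k. ennreal (g k x)) \<noteq> \<infinity>"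
    by (intro nn_integral_PInf_AE) measurable
  then show ?thesis
    by eventually_elim (use g(2) in \<open>auto intro: summable_suminf_not_top\<close>)
qed

text \<open>A witness in place of the nested infima of \<open>multiplier_norm\<close>, so that
  operators can be combined. Going back from the norm requires a strict inequality, as in
  \<open>multiplier_bound_of_norm_less\<close>, because an infimum need not be attained.\<close>

definition multiplier_bound :: "nat \<Rightarrow> real \<Rightarrow> ((nat \<Rightarrow> real) \<Rightarrow> complex) \<Rightarrow> real \<Rightarrow> bool" where
  "multiplier_bound n p m B \<longleftrightarrow> (\<exists>T. Lp_extension n p m T \<and>
     (\<forall>f\<in>Lp_space n p. Lp_norm n p (T f) \<le> B * Lp_norm n p f))"

lemma Lp_norm_nonneg: "Lp_norm n p f \<ge> 0"
  by (simp add: Lp_norm_def)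

text \<open>The terms are dominated by \<open>cmod (w k) * cmod (fourier_n n f \<xi>)\<close>. The
  transform of a test function is integrable, so the series may be integrated term by term.\<close>

lemma multiplier_op_suminf:
  assumes e: "\<And>k. e k \<in> borel_measurable (leb_n n)" "\<And>k \<xi>. \<xi> \<in> Rn n \<Longrightarrow> cmod (e k \<xi>) \<le> 1"
    and w: "summable (\<lambda>k. cmod (w k))"
    and m: "AE \<xi> in leb_n n. (\<lambda>k. w k * e k \<xi>) sums m \<xi>" "m \<in> borel_measurable (leb_n n)"
    and f: "f \<in> test_functions n"
  shows "multiplier_op n m f x = (\<Sum>k. w k * multiplier_op n (e k) f x)"
proof -
  let ?g = "\<lambda>\<xi>. fourier_n n f \<xi> * exp (\<i> * complex_of_real (dot_n n x \<xi>))"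
  have Fi: "integrable (leb_n n) (\<lambda>\<xi>. cmod (fourier_n n f \<xi>))"
    by (intro integrable_norm fourier_n_integrable_leb f)
  have gm: "?g \<in> borel_measurable (leb_n n)"
    using leb_measurable[OF fourier_n_measurable[OF f]] leb_measurable[OF unimodular_dot_measurable]
    by (intro borel_measurable_times) auto
  have i: "integrable (leb_n n) (\<lambda>\<xi>. w k * (e k \<xi> * ?g \<xi>))" for k
    using multiplier_op_integrable[OF e(1)[of k] e(2)[of _ k] f, of x]
    by (intro integrable_mult_right) (simp only: mult.assoc)
  have nb: "cmod (w k * (e k \<xi> * ?g \<xi>)) \<le> cmod (w k) * cmod (fourier_n n f \<xi>)" if "\<xi> \<in> Rn n" for k \<xi>
    using mult_right_mono[OF e(2)[OF that, of k], of "cmod (fourier_n n f \<xi>)"]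
    by (simp add: norm_mult mult_left_mono)
  have "(\<integral>\<xi>. (\<Sum>k. w k * (e k \<xi> * ?g \<xi>)) \<partial>leb_n n) = (\<Sum>k. \<integral>\<xi>. w k * (e k \<xi> * ?g \<xi>) \<partial>leb_n n)"
  proof (rule integral_suminf[OF i])
    show "AE \<xi> in leb_n n. summable (\<lambda>k. norm (w k * (e k \<xi> * ?g \<xi>)))"
      using AE_space
    proof eventually_elim
      case (elim \<xi>)
      then have "\<xi> \<in> Rn n" by (simp add: space_leb_n)
      then show ?case
        using nb by (intro summable_comparison_test'[OF summable_mult2[OF w, of "cmod (fourier_n n f \<xi>)"]]) simp
    qed
    show "summable (\<lambda>k. \<integral>\<xi>. norm (w k * (e k \<xi> * ?g \<xi>)) \<partial>leb_n n)"
    proof (rule summable_comparison_test'[OF summable_mult2[OF w]])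
      fix k
      have "(\<integral>\<xi>. norm (w k * (e k \<xi> * ?g \<xi>)) \<partial>leb_n n) \<le> (\<integral>\<xi>. cmod (w k) * cmod (fourier_n n f \<xi>) \<partial>leb_n n)"
        by (rule integral_mono[OF integrable_norm[OF i] integrable_mult_right[OF Fi]]) (simp add: nb space_leb_n)
      then show "norm (\<integral>\<xi>. norm (w k * (e k \<xi> * ?g \<xi>)) \<partial>leb_n n) \<le> cmod (w k) * (\<integral>\<xi>. cmod (fourier_n n f \<xi>) \<partial>leb_n n)"
        by (simp add: integral_nonneg_AE)
    qed
  qed
  also have "(\<integral>\<xi>. (\<Sum>k. w k * (e k \<xi> * ?g \<xi>)) \<partial>leb_n n) = (\<integral>\<xi>. m \<xi> * ?g \<xi> \<partial>leb_n n)"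
  proof (rule integral_cong_AE)
    show "AE \<xi> in leb_n n. (\<Sum>k. w k * (e k \<xi> * ?g \<xi>)) = m \<xi> * ?g \<xi>"
      using m(1)
    proof eventually_elim
      case (elim \<xi>)
      from sums_mult2[OF this, of "?g \<xi>"] show ?case
        by (simp add: sums_iff mult.assoc)
    qed
    show "(\<lambda>\<xi>. \<Sum>k. w k * (e k \<xi> * ?g \<xi>)) \<in> borel_measurable (leb_n n)"
      by (rule borel_measurable_suminf)
         (rule borel_measurable_times[OF borel_measurable_const borel_measurable_times[OF e(1) gm]])
    show "(\<lambda>\<xi>. m \<xi> * ?g \<xi>) \<in> borel_measurable (leb_n n)"
      using m(2) gm by (rule borel_measurable_times)
  qed
  finally show ?thesis
    by (simp add: multiplier_op_def mult.assoc)
qed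

text \<open>The operator of \<open>m\<close> is the pointwise series of the given operators. Jensen's inequality with the weights
  \<open>cmod (w k)\<close> yields its almost everywhere convergence and the norm bound at once, so neither
  Minkowski's inequality nor the completeness of \<open>L\<^sup>p\<close> is needed.\<close>

lemma multiplier_bound_suminf:
  assumes p: "p \<ge> 1"
    and e: "\<And>k. e k \<in> borel_measurable (leb_n n)" "\<And>k \<xi>. \<xi> \<in> Rn n \<Longrightarrow> cmod (e k \<xi>) \<le> 1"
      "\<And>k. multiplier_bound n p (e k) A"
    and A: "A \<ge> 0"
    and w: "summable (\<lambda>k. cmod (w k))"
    and m: "AE \<xi> in leb_n n. (\<lambda>k. w k * e k \<xi>) sums m \<xi>" "m \<in> borel_measurable (leb_n n)"
  shows "multiplier_bound n p m ((\<Sum>k. cmod (w k)) * A)"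
proof -
  obtain T where T: "\<And>k. Lp_extension n p (e k) (T k)"
      "\<And>k f. f \<in> Lp_space n p \<Longrightarrow> Lp_norm n p (T k f) \<le> A * Lp_norm n p f"
    using e(3) unfolding multiplier_bound_def by metis
  define W where "W = (\<Sum>k. cmod (w k))"
  have W0: "W \<ge> 0" unfolding W_def using w by (intro suminf_nonneg) auto
  \<comment> \<open>Where the series diverges \<open>suminf\<close> is a default value; for
    \<open>f\<close> in \<open>L^p\<close> this concerns a null set only, by
    \<open>sm1\<close>.\<close>
  define U where "U = (\<lambda>f x. \<Sum>k. w k * T k f x)"
  have TL: "T k f \<in> Lp_space n p" if "f \<in> Lp_space n p" for k f
    using T(1)[of k] that by (simp add: Lp_extension_def bounded_Lp_operator_def)
  have TI: "integrable (leb_n n) (\<lambda>x. cmod (T k f x) powr p)"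
      "(\<integral>x. cmod (T k f x) powr p \<partial>leb_n n) \<le> A powr p * Lp_norm n p f powr p" if f: "f \<in> Lp_space n p" for k f
  proof -
    show "integrable (leb_n n) (\<lambda>x. cmod (T k f x) powr p)"
      using TL[OF f] by (simp add: Lp_space_def)
    have "Lp_norm n p (T k f) powr p \<le> (A * Lp_norm n p f) powr p"
      using T(2)[OF f] p by (intro powr_mono2 Lp_norm_nonneg) auto
    then show "(\<integral>x. cmod (T k f x) powr p \<partial>leb_n n) \<le> A powr p * Lp_norm n p f powr p"
      using p by (simp add: Lp_norm_powr powr_mult)
  qed
  \<comment> \<open>The integrable majorant: \<open>cmod (U f x) powr p\<close> is at most
    \<open>W powr (p - 1) * h f x\<close>, and the integral of \<open>h f\<close> supplies the
    missing factor \<open>W\<close> together with the \<open>p\<close>-th power of \<open>A\<close>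
    times the norm of \<open>f\<close>.\<close>
  define h where "h = (\<lambda>f x. \<Sum>k. cmod (w k) * cmod (T k f x) powr p)"
  have sI: "summable (\<lambda>k. \<integral>x. cmod (w k) * cmod (T k f x) powr p \<partial>leb_n n)" if f: "f \<in> Lp_space n p" for f
    by (rule summable_comparison_test'[OF summable_mult2[OF w, of "A powr p * Lp_norm n p f powr p"]])
       (use TI[OF f] in \<open>simp add: mult_left_mono integral_nonneg_AE\<close>)
  have sm: "AE x in leb_n n. summable (\<lambda>k. cmod (w k) * cmod (T k f x) powr p)" if f: "f \<in> Lp_space n p" for f
    using TI(1)[OF f] sI[OF f] by (intro AE_summable_of_integrals) auto
  have sm1: "AE x in leb_n n. summable (\<lambda>k. w k * T k f x)" if f: "f \<in> Lp_space n p" for f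
    using sm[OF f]
  proof eventually_elim
    case (elim x)
    from Jensen_powr_suminf(1)[OF p _ w _ elim] show ?case
      by (intro summable_norm_cancel[of "\<lambda>k. w k * T k f x"]) (simp add: norm_mult)
  qed
  have Ub: "AE x in leb_n n. cmod (U f x) powr p \<le> W powr (p - 1) * h f x" if f: "f \<in> Lp_space n p" for f
    using sm[OF f]
  proof eventually_elim
    case (elim x)
    note J = Jensen_powr_suminf[OF p _ w _ elim, simplified]
    have "cmod (U f x) \<le> (\<Sum>k. cmod (w k) * cmod (T k f x))"
      unfolding U_def using summable_norm[of "\<lambda>k. w k * T k f x"] J(1) by (simp add: norm_mult)
    then have "cmod (U f x) powr p \<le> (\<Sum>k. cmod (w k) * cmod (T k f x)) powr p"
      using p by (intro powr_mono2) auto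
    also have "\<dots> \<le> W powr (p - 1) * h f x" using J(2) by (simp add: W_def h_def)
    finally show ?case .
  qed
  have hI: "integrable (leb_n n) (h f)" "(\<integral>x. h f x \<partial>leb_n n) \<le> W * (A powr p * Lp_norm n p f powr p)"
    if f: "f \<in> Lp_space n p" for f
  proof -
    have a: "\<And>k. integrable (leb_n n) (\<lambda>x. cmod (w k) * cmod (T k f x) powr p)"
      using TI(1)[OF f] by simp
    have b: "AE x in leb_n n. summable (\<lambda>k. norm (cmod (w k) * cmod (T k f x) powr p))"
      using sm[OF f] by simp
    have c: "summable (\<lambda>k. \<integral>x. norm (cmod (w k) * cmod (T k f x) powr p) \<partial>leb_n n)"
      using sI[OF f] by simp
    show "integrable (leb_n n) (h f)"
      unfolding h_def by (rule integrable_suminf[OF a b c])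
    have "(\<integral>x. h f x \<partial>leb_n n) = (\<Sum>k. \<integral>x. cmod (w k) * cmod (T k f x) powr p \<partial>leb_n n)"
      unfolding h_def by (rule integral_suminf[OF a b c])
    also have "\<dots> \<le> (\<Sum>k. cmod (w k) * (A powr p * Lp_norm n p f powr p))"
      using TI[OF f] by (intro suminf_le sI[OF f] summable_mult2 w) (simp add: mult_left_mono)
    also have "\<dots> = W * (A powr p * Lp_norm n p f powr p)"
      unfolding W_def by (rule suminf_mult2[OF w, symmetric])
    finally show "(\<integral>x. h f x \<partial>leb_n n) \<le> W * (A powr p * Lp_norm n p f powr p)" .
  qed
  have Tm: "T k f \<in> borel_measurable (leb_n n)" if f: "f \<in> Lp_space n p" for k f
    using TL[OF f] by (simp add: Lp_space_def)
  have Um: "U f \<in> borel_measurable (leb_n n)" if f: "f \<in> Lp_space n p" for f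
    unfolding U_def using Tm[OF f] by (intro borel_measurable_suminf borel_measurable_times) auto
  have UI: "integrable (leb_n n) (\<lambda>x. cmod (U f x) powr p)" if f: "f \<in> Lp_space n p" for f
  proof (rule Bochner_Integration.integrable_bound[OF integrable_mult_right[OF hI(1)[OF f], of "W powr (p - 1)"]])
    show "(\<lambda>x. cmod (U f x) powr p) \<in> borel_measurable (leb_n n)" using Um[OF f] by measurable
    show "AE x in leb_n n. norm (cmod (U f x) powr p) \<le> norm (W powr (p - 1) * h f x)"
      using Ub[OF f] by eventually_elim auto
  qed
  have UL: "U f \<in> Lp_space n p" if f: "f \<in> Lp_space n p" for f
    using UI[OF f] Um[OF f] by (simp add: Lp_space_def)
  have UN: "Lp_norm n p (U f) \<le> W * A * Lp_norm n p f" if f: "f \<in> Lp_space n p" for f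
  proof -
    have "(\<integral>x. cmod (U f x) powr p \<partial>leb_n n) \<le> (\<integral>x. W powr (p - 1) * h f x \<partial>leb_n n)"
      using Ub[OF f] UI[OF f] hI(1)[OF f] by (intro integral_mono_AE) auto
    also have "\<dots> = W powr (p - 1) * (\<integral>x. h f x \<partial>leb_n n)"
      by simp
    also have "\<dots> \<le> W powr (p - 1) * (W * (A powr p * Lp_norm n p f powr p))"
      by (intro mult_left_mono hI(2)[OF f]) simp
    also have "\<dots> = (W * A * Lp_norm n p f) powr p"
    proof -
      have "W powr (p - 1) * W = W powr p"
        using W0 by (cases "W = 0") (auto simp: powr_diff)
      then show ?thesis by (simp add: powr_mult mult.assoc[symmetric])
    qed
    finally have "Lp_norm n p (U f) powr p \<le> (W * A * Lp_norm n p f) powr p"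
      using p by (simp add: Lp_norm_powr)
    moreover have "0 \<le> W * A * Lp_norm n p f"
      using W0 A Lp_norm_nonneg by simp
    ultimately show ?thesis
      using p powr_less_mono2[of p "W * A * Lp_norm n p f" "Lp_norm n p (U f)"] by force
  qed
  have "Lp_extension n p m U"
    unfolding Lp_extension_def bounded_Lp_operator_def
  proof (intro conjI ballI allI)
    show "\<And>f. f \<in> Lp_space n p \<Longrightarrow> U f \<in> Lp_space n p" by (rule UL)
    show "AE x in leb_n n. U (\<lambda>y. f y + g y) x = U f x + U g x"
      if f: "f \<in> Lp_space n p" and g: "g \<in> Lp_space n p" for f g
    proof -
      have "AE x in leb_n n. \<forall>k. T k (\<lambda>y. f y + g y) x = T k f x + T k g x"
        unfolding AE_all_countable using T(1) f g by (auto simp: Lp_extension_def bounded_Lp_operator_def)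
      then show ?thesis using sm1[OF f] sm1[OF g]
        by eventually_elim (simp add: U_def distrib_left suminf_add)
    qed
    show "AE x in leb_n n. U (\<lambda>y. c * f y) x = c * U f x" if f: "f \<in> Lp_space n p" for c f
    proof -
      have "AE x in leb_n n. \<forall>k. T k (\<lambda>y. c * f y) x = c * T k f x"
        unfolding AE_all_countable using T(1) f by (auto simp: Lp_extension_def bounded_Lp_operator_def)
      then show ?thesis using sm1[OF f]
        by eventually_elim (simp add: U_def suminf_mult[symmetric] mult.left_commute)
    qed
    show "\<exists>B. \<forall>f\<in>Lp_space n p. Lp_norm n p (U f) \<le> B * Lp_norm n p f" using UN by blast
    show "AE x in leb_n n. U f x = multiplier_op n m f x" if f: "f \<in> test_functions n" for f
    proof -
      have "AE x in leb_n n. \<forall>k. T k f x = multiplier_op n (e k) f x"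
        unfolding AE_all_countable using T(1) f by (auto simp: Lp_extension_def)
      then show ?thesis
        by eventually_elim (simp add: U_def multiplier_op_suminf[OF e(1,2) w m f])
    qed
  qed
  with UN show ?thesis unfolding multiplier_bound_def W_def by blast
qed

section \<open>The identity as a series in powers of the sine\<close>


text \<open>The derivative \<open>1 / sqrt (1 - x^2)\<close> has a binomial series with nonnegative
  coefficients, and \<open>w\<close> comes from integrating it term by term. Signs and the bound
  \<open>arcsin x \<le> pi / 2\<close> then control the sum of the coefficients.\<close>

lemma arcsin_series:
  "\<exists>w::nat \<Rightarrow> real. (\<forall>k. w k \<ge> 0) \<and> summable w \<and> suminf w \<le> pi / 2 \<and>
     (\<forall>x. \<bar>x\<bar> < 1 \<longrightarrow> (\<lambda>k. w k * x ^ Suc k) sums arcsin x)"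
proof -
  \<comment> \<open>The coefficients of \<open>(1 - y) powr (-1/2)\<close>; the sign
    \<open>(-1) ^ j\<close> cancels that of the generalised binomial coefficient.\<close>
  define b :: "nat \<Rightarrow> real" where "b = (\<lambda>j. ((-1/2) gchoose j) * (-1) ^ j)"
  \<comment> \<open>The index \<open>k\<close> belongs to the power \<open>Suc k\<close>, so the odd
    powers of arcsin sit at even \<open>k\<close>.\<close>
  define w where "w = (\<lambda>k. if even k then b (k div 2) / real (Suc k) else 0)"
  have b0: "b j \<ge> 0" for j
  proof -
    have "b j = ((-1) ^ j * (-1) ^ j) * (pochhammer (1 / 2) j / fact j)"
      by (simp add: b_def gbinomial_pochhammer mult_ac)
    also have "(-1) ^ j * (-1) ^ j = (1::real)"
      by (simp add: power_mult_distrib[symmetric])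
    finally show ?thesis by (simp add: pochhammer_nonneg)
  qed
  have w0: "w k \<ge> 0" for k using b0 by (simp add: w_def)
  have deriv_sums: "(\<lambda>k. w k * real (Suc k) * x ^ k) sums (1 / sqrt (1 - x\<^sup>2))" if x: "\<bar>x\<bar> < 1" for x
  proof -
    have x2: "\<bar>- (x\<^sup>2)\<bar> < 1" using x by (simp add: abs_square_less_1)
    then have pos: "1 - x\<^sup>2 > 0" by simp
    have "(\<lambda>j. ((-1/2) gchoose j) * (- (x\<^sup>2)) ^ j) sums (1 + - (x\<^sup>2)) powr (-1/2)"
      by (rule gen_binomial_real[OF x2])
    also have "(\<lambda>j. ((-1/2) gchoose j) * (- (x\<^sup>2)) ^ j) = (\<lambda>j. b j * x ^ (2 * j))"
      by (simp only: b_def power_minus[of "x\<^sup>2"] power_mult mult.assoc)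
    also have "(1 + - (x\<^sup>2)) powr (-1/2) = 1 / sqrt (1 - x\<^sup>2)"
      using powr_minus[of "1 - x\<^sup>2" "1/2"] powr_half_sqrt[of "1 - x\<^sup>2"] pos
      by (simp add: inverse_eq_divide)
    finally have "(\<lambda>k. if even k then b (k div 2) * x ^ (2 * (k div 2)) else 0) sums (0 + 1 / sqrt (1 - x\<^sup>2))"
      using sums_if[of "\<lambda>_. 0" 0 "\<lambda>j. b j * x ^ (2 * j)"] by simp
    moreover have "(\<lambda>k. if even k then b (k div 2) * x ^ (2 * (k div 2)) else 0) = (\<lambda>k. w k * real (Suc k) * x ^ k)"
      by (auto simp: w_def fun_eq_iff simp del: of_nat_Suc)
    ultimately show ?thesis by simp
  qed
  define F where "F = (\<lambda>x. \<Sum>k. w k * x ^ Suc k)"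
  have dF: "(F has_real_derivative 1 / sqrt (1 - x\<^sup>2)) (at x)" if x: "\<bar>x\<bar> < 1" for x
  proof -
    have "(F has_real_derivative (\<Sum>k. w k * real (Suc k) * x ^ k)) (at x)"
      unfolding F_def
      by (rule DERIV_power_series'[of 1]) (use x deriv_sums in \<open>auto simp: sums_iff abs_less_iff\<close>)
    then show ?thesis using deriv_sums[OF x] by (simp add: sums_iff)
  qed
  have F_sums: "(\<lambda>k. w k * x ^ Suc k) sums F x" if x: "\<bar>x\<bar> < 1" for x
  proof -
    have "summable (\<lambda>k. w k * x ^ Suc k)"
    proof (rule summable_comparison_test')
      have "\<bar>\<bar>x\<bar>\<bar> < 1" using x by simp
      from deriv_sums[OF this] show "summable (\<lambda>k. w k * real (Suc k) * \<bar>x\<bar> ^ k)" by (simp add: sums_iff)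
      show "norm (w k * x ^ Suc k) \<le> w k * real (Suc k) * \<bar>x\<bar> ^ k" for k
      proof -
        have "\<bar>x\<bar> ^ Suc k \<le> \<bar>x\<bar> ^ k" using x by (intro power_decreasing) auto
        also have "\<dots> \<le> real (Suc k) * \<bar>x\<bar> ^ k" by (simp add: mult_le_cancel_right1)
        finally have "w k * \<bar>x\<bar> ^ Suc k \<le> w k * (real (Suc k) * \<bar>x\<bar> ^ k)" using w0 by (rule mult_left_mono)
        then show ?thesis using w0[of k] by (simp add: abs_mult power_abs mult.assoc)
      qed
    qed
    then show ?thesis unfolding F_def by (rule summable_sums)
  qed
  have F_eq: "F x = arcsin x" if x: "\<bar>x\<bar> < 1" for x
  proof -
    have "((\<lambda>x. F x - arcsin x) has_real_derivative 0) (at y within {-1<..<1})" if "y \<in> {-1<..<1}" for y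
    proof -
      have "\<bar>y\<bar> < 1" using that by auto
      from DERIV_diff[OF dF[OF this] DERIV_arcsin] that show ?thesis
        by (auto simp: inverse_eq_divide intro: has_field_derivative_at_within)
    qed
    then obtain c where c: "\<And>y. y \<in> {-1<..<1} \<Longrightarrow> F y - arcsin y = c"
      using has_field_derivative_zero_constant[of "{-1<..<1::real}" "\<lambda>x. F x - arcsin x"] by auto
    have "F 0 = 0" by (simp add: F_def)
    with c[of 0] have "c = 0" by simp
    with c[of x] x show ?thesis by (auto simp: abs_less_iff)
  qed
  \<comment> \<open>For \<open>0 < x < 1\<close> nonnegativity bounds a partial sum by the full
    series, hence by \<open>pi / 2\<close>. A finite sum is continuous, so the bound persists as
    \<open>x\<close> tends to 1.\<close>
  have part: "(\<Sum>k<N. w k) \<le> pi / 2" for N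
  proof (rule tendsto_upperbound)
    show "((\<lambda>x. \<Sum>k<N. w k * x ^ Suc k) \<longlongrightarrow> (\<Sum>k<N. w k)) (at_left 1)"
    proof -
      have "((\<lambda>x. \<Sum>k<N. w k * x ^ Suc k) \<longlongrightarrow> (\<Sum>k<N. w k * 1 ^ Suc k)) (at_left 1)"
        by (intro tendsto_intros)
      then show ?thesis by simp
    qed
    have "(\<Sum>k<N. w k * x ^ Suc k) \<le> pi / 2" if x: "0 < x" "x < 1" for x
    proof -
      have "(\<Sum>k<N. w k * x ^ Suc k) \<le> F x"
      proof -
        have "summable (\<lambda>k. w k * x ^ Suc k)" "(\<Sum>k. w k * x ^ Suc k) = F x"
          using F_sums[of x] x by (auto simp: sums_iff)
        then show ?thesis
          using sum_le_suminf[of "\<lambda>k. w k * x ^ Suc k" "{..<N}"] w0 x by simp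
      qed
      also have "\<dots> \<le> pi / 2" using F_eq[of x] arcsin_ubound[of x] x by simp
      finally show ?thesis .
    qed
    then show "\<forall>\<^sub>F x in at_left 1. (\<Sum>k<N. w k * x ^ Suc k) \<le> pi / 2"
      unfolding eventually_at_left_field by (intro exI[of _ 0]) auto
  qed simp
  have sw: "summable w"
    by (rule summableI_nonneg_bounded[OF w0 part])
  moreover have "suminf w \<le> pi / 2"
    by (rule suminf_le_const[OF sw part])
  moreover have "(\<lambda>k. w k * x ^ Suc k) sums arcsin x" if "\<bar>x\<bar> < 1" for x
    using F_sums[OF that] unfolding F_eq[OF that] .
  ultimately show ?thesis using w0 by blast
qed

text \<open>Since 1 lies below \<open>pi / 2\<close>, \<open>sin s\<close> stays strictly inside the
  interval of convergence and arcsin inverts sin.\<close>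

lemma identity_arcsin_series:
  fixes w :: "nat \<Rightarrow> real"
  assumes "\<And>x. \<bar>x\<bar> < 1 \<Longrightarrow> (\<lambda>k. w k * x ^ Suc k) sums arcsin x" and s: "\<bar>s\<bar> \<le> 1"
  shows "(\<lambda>k. w k * sin s ^ Suc k) sums s"
proof -
  have sb: "- (pi / 2) < s" "s < pi / 2" using s pi_gt3 by (auto simp: abs_le_iff)
  have "cos s > 0" using sb by (intro cos_gt_zero_pi) auto
  then have "(sin s)\<^sup>2 < 1" using sin_cos_squared_add[of s] by (smt (verit) zero_less_power)
  then have "\<bar>sin s\<bar> < 1" by (simp add: abs_square_less_1)
  from assms(1)[OF this] show ?thesis using sb by (simp add: arcsin_sin)
qed

section \<open>Powers of the sine as exponential sums\<close>

lemma sin_power_exp: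
  fixes s :: real
  shows "complex_of_real (sin s ^ k) =
    (\<Sum>j\<le>k. (of_nat (k choose j) * (-1) ^ (k - j) / (2 * \<i>) ^ k) * exp (\<i> * complex_of_real ((2 * real j - real k) * s)))"
proof -
  have "complex_of_real (sin s ^ k) = ((exp (\<i> * s) + - exp (- (\<i> * s))) / (2 * \<i>)) ^ k"
    by (simp add: sin_of_real[symmetric] sin_exp_eq)
  also have "\<dots> = (\<Sum>j\<le>k. of_nat (k choose j) * exp (\<i> * s) ^ j * (- exp (- (\<i> * s))) ^ (k - j)) / (2 * \<i>) ^ k"
    by (simp only: power_divide binomial_ring)
  also have "\<dots> = (\<Sum>j\<le>k. (of_nat (k choose j) * (-1) ^ (k - j) / (2 * \<i>) ^ k) * exp (\<i> * complex_of_real ((2 * real j - real k) * s)))"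
    unfolding sum_divide_distrib
  proof (rule sum.cong[OF refl])
    fix j assume "j \<in> {..k}"
    then have j: "j \<le> k" by simp
    have "exp (\<i> * s) ^ j * exp (- (\<i> * s)) ^ (k - j) = exp (of_nat j * (\<i> * s) + of_nat (k - j) * (- (\<i> * s)))"
      by (simp only: exp_of_nat_mult exp_add)
    also have "of_nat j * (\<i> * s) + of_nat (k - j) * (- (\<i> * s)) = \<i> * complex_of_real ((2 * real j - real k) * s)"
      using j by (simp add: of_nat_diff algebra_simps)
    finally have "exp (\<i> * s) ^ j * exp (- (\<i> * s)) ^ (k - j) = exp (\<i> * complex_of_real ((2 * real j - real k) * s))" .
    then show "of_nat (k choose j) * exp (\<i> * s) ^ j * (- exp (- (\<i> * s))) ^ (k - j) / (2 * \<i>) ^ k =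
      (of_nat (k choose j) * (-1) ^ (k - j) / (2 * \<i>) ^ k) * exp (\<i> * complex_of_real ((2 * real j - real k) * s))"
      by (simp only: power_minus[of "exp (- (\<i> * s))"] mult_ac times_divide_eq_left times_divide_eq_right)
  qed
  finally show ?thesis .
qed

text \<open>The binomial coefficients add up to \<open>2 ^ k\<close>, exactly the modulus of the
  denominator. Hence taking powers of the sine does not enlarge the multiplier bound.\<close>

lemma sum_norm_sin_power_coeffs:
  "(\<Sum>j\<le>k. cmod (of_nat (k choose j) * (-1) ^ (k - j) / (2 * \<i>) ^ k)) = 1"
proof -
  have "(\<Sum>j\<le>k. cmod (of_nat (k choose j) * (-1) ^ (k - j) / (2 * \<i>) ^ k)) = (\<Sum>j\<le>k. real (k choose j)) / 2 ^ k"
    by (simp add: norm_mult norm_divide norm_power sum_divide_distrib)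
  also have "(\<Sum>j\<le>k. real (k choose j)) = 2 ^ k"
    unfolding of_nat_sum[symmetric] choose_row_sum by simp
  finally show ?thesis by simp
qed

section \<open>The multiplier norm of the phase\<close>


lemma Lp_operator_norm_le:
  assumes "B \<ge> 0" "\<And>f. f \<in> Lp_space n p \<Longrightarrow> Lp_norm n p (T f) \<le> B * Lp_norm n p f"
  shows "Lp_operator_norm n p T \<le> B"
  unfolding Lp_operator_norm_def using assms by (intro cInf_lower bdd_belowI[of _ 0]) auto

lemma bounded_Lp_operator_bounds_nonempty:
  assumes "bounded_Lp_operator n p T"
  shows "{B. 0 \<le> B \<and> (\<forall>f\<in>Lp_space n p. Lp_norm n p (T f) \<le> B * Lp_norm n p f)} \<noteq> {}"
proof -
  obtain B where B: "\<forall>f\<in>Lp_space n p. Lp_norm n p (T f) \<le> B * Lp_norm n p f"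
    using assms by (auto simp: bounded_Lp_operator_def)
  \<comment> \<open>The \<open>B\<close> provided by \<open>bounded_Lp_operator\<close> may be
    negative, whereas the infimum ranges over nonnegative bounds.\<close>
  have "Lp_norm n p (T f) \<le> \<bar>B\<bar> * Lp_norm n p f" if "f \<in> Lp_space n p" for f
    using B that mult_right_mono[OF abs_ge_self[of B] Lp_norm_nonneg[of n p f]] by fastforce
  then have "\<bar>B\<bar> \<in> {B. 0 \<le> B \<and> (\<forall>f\<in>Lp_space n p. Lp_norm n p (T f) \<le> B * Lp_norm n p f)}"
    by simp
  then show ?thesis by blast
qed

lemma Lp_operator_norm_nonneg:
  assumes "bounded_Lp_operator n p T"
  shows "Lp_operator_norm n p T \<ge> 0"
  unfolding Lp_operator_norm_def
  by (rule cInf_greatest[OF bounded_Lp_operator_bounds_nonempty[OF assms]]) auto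

lemma multiplier_norm_le:
  assumes "multiplier_bound n p m B" "B \<ge> 0"
  shows "multiplier_norm n p m \<le> B"
proof -
  obtain T where T: "Lp_extension n p m T"
      "\<And>f. f \<in> Lp_space n p \<Longrightarrow> Lp_norm n p (T f) \<le> B * Lp_norm n p f"
    using assms(1) by (auto simp: multiplier_bound_def)
  have "bdd_below {Lp_operator_norm n p T | T. Lp_extension n p m T}"
    by (intro bdd_belowI[of _ 0]) (auto simp: Lp_extension_def Lp_operator_norm_nonneg)
  then have "multiplier_norm n p m \<le> Lp_operator_norm n p T"
    unfolding multiplier_norm_def using T(1) by (intro cInf_lower) auto
  also have "\<dots> \<le> B" by (rule Lp_operator_norm_le[OF assms(2) T(2)])
  finally show ?thesis .
qed

lemma multiplier_bound_of_norm_less: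
  assumes "m \<in> multipliers n p" "multiplier_norm n p m < B"
  shows "multiplier_bound n p m B"
proof -
  have ne: "{Lp_operator_norm n p T | T. Lp_extension n p m T} \<noteq> {}"
    using assms(1) by (auto simp: multipliers_def)
  obtain T where T: "Lp_extension n p m T" "Lp_operator_norm n p T < B"
    using cInf_lessD[OF ne, of B] assms(2) by (auto simp: multiplier_norm_def)
  have b: "bounded_Lp_operator n p T" using T(1) by (simp add: Lp_extension_def)
  obtain B' where B': "B' < B" "\<forall>f\<in>Lp_space n p. Lp_norm n p (T f) \<le> B' * Lp_norm n p f"
    using cInf_lessD[OF bounded_Lp_operator_bounds_nonempty[OF b], of B] T(2)
    by (auto simp: Lp_operator_norm_def)
  have "Lp_norm n p (T f) \<le> B * Lp_norm n p f" if "f \<in> Lp_space n p" for f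
    using B' that mult_right_mono[of B' B "Lp_norm n p f"] Lp_norm_nonneg[of n p f] by fastforce
  then show ?thesis using T(1) by (auto simp: multiplier_bound_def)
qed

lemma multiplier_bound_mono:
  assumes "multiplier_bound n p m B" "B \<le> B'"
  shows "multiplier_bound n p m B'"
proof -
  have "B * Lp_norm n p f \<le> B' * Lp_norm n p f" for f
    using assms(2) by (intro mult_right_mono Lp_norm_nonneg)
  then show ?thesis using assms(1) unfolding multiplier_bound_def by (meson order_trans)
qed

text \<open>The estimate holds for every extension and every bound of it, so it passes through both
  infima, which are over nonempty sets.\<close>

lemma multiplier_norm_ge:
  assumes m: "m \<in> multipliers n p" and p: "p \<ge> 1"
    and ess: "\<And>\<delta>. \<delta> > 0 \<Longrightarrow> emeasure (leb_n n) {\<xi> \<in> Rn n. cmod (m \<xi> - c) < \<delta>} > 0"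
  shows "cmod c \<le> multiplier_norm n p m"
  unfolding multiplier_norm_def
proof (rule cInf_greatest)
  show "{Lp_operator_norm n p T | T. Lp_extension n p m T} \<noteq> {}"
    using m by (auto simp: multipliers_def)
  fix z assume "z \<in> {Lp_operator_norm n p T | T. Lp_extension n p m T}"
  then obtain T where T: "z = Lp_operator_norm n p T" "Lp_extension n p m T" by auto
  obtain M where M: "m \<in> borel_measurable (leb_n n)" "\<And>\<xi>. \<xi> \<in> Rn n \<Longrightarrow> cmod (m \<xi>) \<le> M"
    using m by (auto simp: multipliers_def)
  have "bounded_Lp_operator n p T" using T(2) by (simp add: Lp_extension_def)
  from bounded_Lp_operator_bounds_nonempty[OF this]
  show "cmod c \<le> z" unfolding T(1) Lp_operator_norm_def
    by (rule cInf_greatest) (use essential_range_le_multiplier_bound[OF p M ess T(2)] in auto)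
qed

lemma multiplier_bound_sin_power:
  assumes p: "p \<ge> 1" and \<phi>[measurable]: "\<phi> \<in> borel_measurable (leb_n n)" and A: "A \<ge> 0"
    and b: "\<And>t. multiplier_bound n p (\<lambda>x. exp (\<i> * complex_of_real (t * \<phi> x))) A"
  shows "multiplier_bound n p (\<lambda>x. complex_of_real (sin (\<phi> x) ^ k)) A"
proof -
  \<comment> \<open>The finite expansion is padded with zeros so that the lemma on series
    applies.\<close>
  define w where "w = (\<lambda>j. if j \<le> k then of_nat (k choose j) * (-1) ^ (k - j) / (2 * \<i>) ^ k else 0)"
  have fin: "finite {..k}" "\<And>j. j \<notin> {..k} \<Longrightarrow> w j = 0" by (auto simp: w_def)
  have "multiplier_bound n p (\<lambda>x. complex_of_real (sin (\<phi> x) ^ k)) ((\<Sum>j. cmod (w j)) * A)"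
  proof (rule multiplier_bound_suminf[OF p _ _ _ A])
    show "multiplier_bound n p (\<lambda>x. exp (\<i> * complex_of_real ((2 * real j - real k) * \<phi> x))) A" for j
      by (rule b)
    show "summable (\<lambda>j. cmod (w j))" using fin by (intro summable_finite[of "{..k}"]) auto
    show "AE x in leb_n n. (\<lambda>j. w j * exp (\<i> * complex_of_real ((2 * real j - real k) * \<phi> x))) sums complex_of_real (sin (\<phi> x) ^ k)"
    proof (rule AE_I2)
      fix x
      have "(\<lambda>j. w j * exp (\<i> * complex_of_real ((2 * real j - real k) * \<phi> x))) sums
         (\<Sum>j\<le>k. w j * exp (\<i> * complex_of_real ((2 * real j - real k) * \<phi> x)))"
        using fin by (intro sums_finite) auto
      also have "(\<Sum>j\<le>k. w j * exp (\<i> * complex_of_real ((2 * real j - real k) * \<phi> x))) = complex_of_real (sin (\<phi> x) ^ k)"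
        unfolding sin_power_exp by (intro sum.cong) (auto simp: w_def)
      finally show "(\<lambda>j. w j * exp (\<i> * complex_of_real ((2 * real j - real k) * \<phi> x))) sums complex_of_real (sin (\<phi> x) ^ k)" .
    qed
    show "(\<lambda>x. exp (\<i> * complex_of_real ((2 * real j - real k) * \<phi> x))) \<in> borel_measurable (leb_n n)" for j
      by measurable
    show "(\<lambda>x. complex_of_real (sin (\<phi> x) ^ k)) \<in> borel_measurable (leb_n n)" by measurable
  qed (simp only: norm_exp_i_times order_refl)
  also have "(\<Sum>j. cmod (w j)) = (\<Sum>j\<le>k. cmod (w j))"
    using fin by (intro suminf_finite) auto
  also have "\<dots> = 1"
    unfolding sum_norm_sin_power_coeffs[of k, symmetric] by (intro sum.cong) (auto simp: w_def)
  finally show ?thesis by simp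
qed

lemma multiplier_bound_of_exponentials:
  assumes p: "p \<ge> 1" and \<phi>[measurable]: "\<phi> \<in> borel_measurable (leb_n n)" and A: "A \<ge> 0" and S: "S > 0"
    and b: "\<And>t. multiplier_bound n p (\<lambda>x. exp (\<i> * complex_of_real (t * \<phi> x))) A"
    and S_le: "AE x in leb_n n. \<bar>\<phi> x\<bar> \<le> S"
  shows "multiplier_bound n p (\<lambda>x. complex_of_real (\<phi> x)) (pi / 2 * S * A)"
proof -
  obtain w :: "nat \<Rightarrow> real" where w: "\<And>k. w k \<ge> 0" "summable w" "suminf w \<le> pi / 2"
    "\<And>x. \<bar>x\<bar> < 1 \<Longrightarrow> (\<lambda>k. w k * x ^ Suc k) sums arcsin x"
    using arcsin_series by blast
  have nw: "(\<lambda>k. cmod (complex_of_real (S * w k))) = (\<lambda>k. S * w k)"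
    using w(1) S unfolding norm_of_real by simp
  have "multiplier_bound n p (\<lambda>x. complex_of_real (\<phi> x)) ((\<Sum>k. cmod (complex_of_real (S * w k))) * A)"
  proof (rule multiplier_bound_suminf[OF p _ _ _ A])
    show "multiplier_bound n p (\<lambda>x. complex_of_real (sin (\<phi> x / S) ^ Suc k)) A" for k
    proof (rule multiplier_bound_sin_power[OF p _ A])
      \<comment> \<open>Normalising by \<open>S\<close> only changes the frequency, and all real
        frequencies are controlled.\<close>
      show "multiplier_bound n p (\<lambda>x. exp (\<i> * complex_of_real (t * (\<phi> x / S)))) A" for t
        using b[of "t / S"] by simp
    qed measurable
    show "summable (\<lambda>k. cmod (complex_of_real (S * w k)))"
      unfolding nw using w(2) by (rule summable_mult)
    show "AE x in leb_n n. (\<lambda>k. complex_of_real (S * w k) * complex_of_real (sin (\<phi> x / S) ^ Suc k)) sums complex_of_real (\<phi> x)"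
      using S_le
    proof eventually_elim
      case (elim x)
      then have "\<bar>\<phi> x / S\<bar> \<le> 1" using S by simp
      from sums_mult[OF identity_arcsin_series[OF w(4) this], of S]
      have "(\<lambda>k. S * w k * sin (\<phi> x / S) ^ Suc k) sums \<phi> x"
        using S by (simp add: mult.assoc)
      then have "(\<lambda>k. complex_of_real (S * w k * sin (\<phi> x / S) ^ Suc k)) sums complex_of_real (\<phi> x)"
        by (rule sums_of_real)
      then show ?case by (simp only: of_real_mult)
    qed
    show "cmod (complex_of_real (sin (\<phi> x / S) ^ Suc k)) \<le> 1" for k x
      unfolding norm_of_real power_abs by (rule power_le_one) auto
  qed measurable
  then show ?thesis
  proof (rule multiplier_bound_mono)
    have "(\<Sum>k. S * w k) = S * suminf w" using w(2) by (rule suminf_mult)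
    also have "\<dots> \<le> S * (pi / 2)" using w(3) S by simp
    finally show "(\<Sum>k. cmod (complex_of_real (S * w k))) * A \<le> pi / 2 * S * A"
      unfolding nw using A by (intro mult_right_mono) (auto simp: mult.commute)
  qed
qed

text \<open>Since \<open>real_of_ereal\<close> sends infinite values to 0, the essential supremum is
  first placed between 0 and \<open>B\<close>; only then do its properties carry over to
  \<open>Linf_norm\<close>.\<close>

lemma Linf_norm_properties:
  fixes \<phi> :: "(nat \<Rightarrow> real) \<Rightarrow> real"
  assumes \<phi>[measurable]: "\<phi> \<in> borel_measurable (leb_n n)" and B: "\<And>x. x \<in> Rn n \<Longrightarrow> \<bar>\<phi> x\<bar> \<le> B"
    and nz: "\<not> (AE x in leb_n n. \<phi> x = 0)"
  shows "Linf_norm n \<phi> > 0" "AE x in leb_n n. \<bar>\<phi> x\<bar> \<le> Linf_norm n \<phi>"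
    "\<And>z. z < Linf_norm n \<phi> \<Longrightarrow> emeasure (leb_n n) {x \<in> Rn n. z < \<bar>\<phi> x\<bar>} > 0"
proof -
  let ?e = "esssup (leb_n n) (\<lambda>x. ereal \<bar>\<phi> x\<bar>)"
  have [measurable]: "(\<lambda>x. ereal \<bar>\<phi> x\<bar>) \<in> borel_measurable (leb_n n)" by measurable
  have ae: "AE x in leb_n n. ereal \<bar>\<phi> x\<bar> \<le> ?e" by (rule esssup_AE)
  have "?e \<le> ereal B"
    using B by (intro esssup_I) (auto simp: space_leb_n intro!: AE_I2)
  moreover have e0: "?e > 0"
  proof (rule ccontr)
    assume "\<not> ?e > 0"
    then have "?e \<le> 0" by simp
    have "AE x in leb_n n. \<phi> x = 0"
      using ae
    proof eventually_elim
      case (elim x)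
      then have "ereal \<bar>\<phi> x\<bar> \<le> 0" using \<open>?e \<le> 0\<close> by (rule order_trans)
      then show ?case by simp
    qed
    with nz show False by simp
  qed
  ultimately obtain S where S: "?e = ereal S"
    by (cases ?e) auto
  then have L: "Linf_norm n \<phi> = S" by (simp add: Linf_norm_def)
  show "Linf_norm n \<phi> > 0" using e0 S L by simp
  show "AE x in leb_n n. \<bar>\<phi> x\<bar> \<le> Linf_norm n \<phi>" using ae unfolding S L by simp
  show "emeasure (leb_n n) {x \<in> Rn n. z < \<bar>\<phi> x\<bar>} > 0" if "z < Linf_norm n \<phi>" for z
  proof -
    have "ereal z < ?e" using that S L by simp
    from esssup_pos_measure[OF _ this] show ?thesis by (simp add: space_leb_n)
  qed
qed

text \<open>If both \<open>S\<close> and \<open>- S\<close> had neighbourhoods that \<phi> almost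
  never enters, then \<open>\<bar>\<phi>\<bar> \<le> S - d\<close> would hold almost everywhere for
  some \<open>d > 0\<close>, although \<phi> exceeds every level below \<open>S\<close> in modulus
  on a set of positive measure.\<close>

lemma Linf_norm_in_essential_range:
  fixes \<phi> :: "(nat \<Rightarrow> real) \<Rightarrow> real"
  assumes \<phi>[measurable]: "\<phi> \<in> borel_measurable (leb_n n)" and S0: "S > 0" "AE x in leb_n n. \<bar>\<phi> x\<bar> \<le> S"
    "\<And>z. z < S \<Longrightarrow> emeasure (leb_n n) {x \<in> Rn n. z < \<bar>\<phi> x\<bar>} > 0"
  obtains c where "\<bar>c\<bar> = S" "\<And>\<delta>. \<delta> > 0 \<Longrightarrow> emeasure (leb_n n) {x \<in> Rn n. \<bar>\<phi> x - c\<bar> < \<delta>} > 0"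
proof -
  let ?E = "\<lambda>c \<delta>. {x \<in> Rn n. \<bar>\<phi> x - c\<bar> < \<delta>}"
  have m: "?E c \<delta> \<in> sets (leb_n n)" for c \<delta>
  proof -
    have "{x \<in> space (leb_n n). \<bar>\<phi> x - c\<bar> < \<delta>} \<in> sets (leb_n n)" by measurable
    then show ?thesis by (simp add: space_leb_n)
  qed
  have mz: "{x \<in> Rn n. z < \<bar>\<phi> x\<bar>} \<in> sets (leb_n n)" for z
  proof -
    have "{x \<in> space (leb_n n). z < \<bar>\<phi> x\<bar>} \<in> sets (leb_n n)" by measurable
    then show ?thesis by (simp add: space_leb_n)
  qed
  have "\<exists>c\<in>{S, -S}. \<forall>\<delta>>0. emeasure (leb_n n) (?E c \<delta>) > 0"
  proof (rule ccontr)
    assume "\<not> ?thesis"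
    then obtain d1 d2 where d: "d1 > 0" "d2 > 0" "emeasure (leb_n n) (?E S d1) = 0" "emeasure (leb_n n) (?E (-S) d2) = 0"
      by (auto simp: not_gr_zero)
    define d where "d = min d1 d2"
    have "AE x in leb_n n. x \<notin> ?E S d1" "AE x in leb_n n. x \<notin> ?E (-S) d2"
      by (rule AE_not_in[OF null_setsI[OF d(3) m]], rule AE_not_in[OF null_setsI[OF d(4) m]])
    then have "AE x in leb_n n. x \<notin> {x \<in> Rn n. S - d < \<bar>\<phi> x\<bar>}"
      using S0(2)
    proof eventually_elim
      case (elim x)
      show ?case
      proof
        assume x: "x \<in> {x \<in> Rn n. S - d < \<bar>\<phi> x\<bar>}"
        then have "\<bar>\<phi> x - S\<bar> < d \<or> \<bar>\<phi> x - (-S)\<bar> < d"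
          using elim(3) by auto
        with elim x show False by (auto simp: d_def)
      qed
    qed
    then have "{x \<in> Rn n. S - d < \<bar>\<phi> x\<bar>} \<in> null_sets (leb_n n)"
      using AE_iff_null_sets[OF mz] by blast
    then have "emeasure (leb_n n) {x \<in> Rn n. S - d < \<bar>\<phi> x\<bar>} = 0" by (rule null_setsD1)
    moreover have "S - d < S" using d by (simp add: d_def)
    ultimately show False using S0(3) by fastforce
  qed
  then obtain c where "c \<in> {S, -S}" "\<forall>\<delta>>0. emeasure (leb_n n) (?E c \<delta>) > 0" by blast
  moreover from this(1) have "\<bar>c\<bar> = S" using S0(1) by auto
  ultimately show ?thesis using that by blast
qed

lemma exponential_multiplier_estimate:
  fixes \<phi> :: "(nat \<Rightarrow> real) \<Rightarrow> real"
  assumes p: "1 \<le> p" and \<phi>[measurable]: "\<phi> \<in> borel_measurable (leb_n n)"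
    and bd: "\<And>x. x \<in> Rn n \<Longrightarrow> \<bar>\<phi> x\<bar> \<le> B" and nz: "\<not> (AE x in leb_n n. \<phi> x = 0)"
    and A: "\<And>t::real. (\<lambda>x. exp (\<i> * complex_of_real (t * \<phi> x))) \<in> multipliers n p"
      "\<And>t::real. multiplier_norm n p (\<lambda>x. exp (\<i> * complex_of_real (t * \<phi> x))) \<le> A"
  shows "(\<lambda>x. complex_of_real (\<phi> x)) \<in> multipliers n p"
    and "1 \<le> multiplier_norm n p (\<lambda>x. complex_of_real (\<phi> x)) / Linf_norm n \<phi>"
    and "multiplier_norm n p (\<lambda>x. complex_of_real (\<phi> x)) / Linf_norm n \<phi> \<le> pi / 2 * A\<^sup>2"
proof -
  let ?m = "\<lambda>x. complex_of_real (\<phi> x)"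
  define S where "S = Linf_norm n \<phi>"
  note S = Linf_norm_properties[OF \<phi> bd nz, folded S_def]
  have "1 \<le> multiplier_norm n p (\<lambda>x. exp (\<i> * complex_of_real (0 * \<phi> x)))"
  proof -
    have "emeasure (leb_n n) {\<xi> \<in> Rn n. cmod (exp (\<i> * complex_of_real (0 * \<phi> \<xi>)) - 1) < \<delta>} > 0" if "\<delta> > 0" for \<delta>
    proof -
      have "0 < emeasure (lborel_n n) (cube n 1)" by (simp add: emeasure_cube)
      also have "\<dots> \<le> emeasure (lborel_n n) (Rn n)"
        using sets.top[of "lborel_n n"] unfolding space_lborel_n by (rule emeasure_mono[OF cube_subset_Rn])
      also have "\<dots> = emeasure (leb_n n) (Rn n)"
        using sets.top[of "lborel_n n"] unfolding space_lborel_n leb_n_def by simp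
      also have "Rn n = {\<xi> \<in> Rn n. cmod (exp (\<i> * complex_of_real (0 * \<phi> \<xi>)) - 1) < \<delta>}"
        using that by simp
      finally show ?thesis .
    qed
    from multiplier_norm_ge[OF A(1)[of 0] p this] show ?thesis by simp
  qed
  also have "\<dots> \<le> A" by (rule A(2))
  finally have A1: "1 \<le> A" .
  \<comment> \<open>The slack \<open>A < A'\<close> is the price for extracting operators from an
    infimum; \<open>dense_ge\<close> removes it below.\<close>
  have ub: "multiplier_bound n p ?m (pi / 2 * S * A')" if A': "A < A'" for A'
  proof (rule multiplier_bound_of_exponentials[OF p \<phi> _ S(1) _ S(2)])
    show "multiplier_bound n p (\<lambda>x. exp (\<i> * complex_of_real (t * \<phi> x))) A'" for t
      by (rule multiplier_bound_of_norm_less[OF A(1) le_less_trans[OF A(2) A']])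
  qed (use A1 A' in simp)
  show mem: "?m \<in> multipliers n p"
    using ub[of "A + 1"] bd by (auto simp: multipliers_def multiplier_bound_def)
  obtain c where c: "\<bar>c\<bar> = S" "\<And>\<delta>. \<delta> > 0 \<Longrightarrow> emeasure (leb_n n) {x \<in> Rn n. \<bar>\<phi> x - c\<bar> < \<delta>} > 0"
    using Linf_norm_in_essential_range[OF \<phi> S] by blast
  have "cmod (complex_of_real c) \<le> multiplier_norm n p ?m"
    using c(2) unfolding of_real_diff[symmetric] norm_of_real[symmetric]
    by (intro multiplier_norm_ge[OF mem p]) (simp only: of_real_diff[symmetric] norm_of_real)
  then show "1 \<le> multiplier_norm n p ?m / Linf_norm n \<phi>"
    unfolding S_def[symmetric] using S(1) c(1) by simp
  have K: "pi / 2 * S > 0" using S(1) by simp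
  have "multiplier_norm n p ?m / (pi / 2 * S) \<le> A"
  proof (rule dense_ge)
    fix A' assume A': "A < A'"
    have "multiplier_norm n p ?m \<le> pi / 2 * S * A'"
      using ub[OF A'] A' A1 K by (intro multiplier_norm_le) auto
    then show "multiplier_norm n p ?m / (pi / 2 * S) \<le> A'"
      using K by (subst pos_divide_le_eq) (simp_all add: mult.commute)
  qed
  then have "multiplier_norm n p ?m \<le> A * (pi / 2 * S)"
    using K by (simp only: pos_divide_le_eq)
  also have "\<dots> \<le> A\<^sup>2 * (pi / 2 * S)"
    using A1 K by (intro mult_right_mono) (auto simp: power2_eq_square)
  finally show "multiplier_norm n p ?m / Linf_norm n \<phi> \<le> pi / 2 * A\<^sup>2"
    unfolding S_def[symmetric] using S(1) by (simp add: pos_divide_le_eq mult_ac)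
qed

theorem corollary3p7:
  shows "\<exists>C::real. C > 0 \<and>
    (\<forall>(n::nat) (p::real) (\<phi> :: (nat \<Rightarrow> real) \<Rightarrow> real) (A::real).
      1 \<le> n \<longrightarrow> 1 < p \<longrightarrow> p \<noteq> 2 \<longrightarrow>
      \<phi> \<in> borel_measurable (leb_n n) \<longrightarrow>
      (\<exists>B. \<forall>x\<in>Rn n. \<bar>\<phi> x\<bar> \<le> B) \<longrightarrow>
      \<not> (AE x in leb_n n. \<phi> x = 0) \<longrightarrow>
      A > 0 \<longrightarrow>
      (\<forall>t::real. (\<lambda>x. exp (\<i> * complex_of_real (t * \<phi> x))) \<in> multipliers n p \<and>
                 multiplier_norm n p (\<lambda>x. exp (\<i> * complex_of_real (t * \<phi> x))) \<le> A) \<longrightarrow>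
      (\<lambda>x. complex_of_real (\<phi> x)) \<in> multipliers n p \<and>
      1 \<le> multiplier_norm n p (\<lambda>x. complex_of_real (\<phi> x)) / Linf_norm n \<phi> \<and>
      multiplier_norm n p (\<lambda>x. complex_of_real (\<phi> x)) / Linf_norm n \<phi> \<le> C * A\<^sup>2)"
proof (rule exI[of _ "pi / 2"], rule conjI)
  show "0 < pi / 2" by simp
next
  show "\<forall>(n::nat) (p::real) (\<phi> :: (nat \<Rightarrow> real) \<Rightarrow> real) (A::real).
      1 \<le> n \<longrightarrow> 1 < p \<longrightarrow> p \<noteq> 2 \<longrightarrow>
      \<phi> \<in> borel_measurable (leb_n n) \<longrightarrow>
      (\<exists>B. \<forall>x\<in>Rn n. \<bar>\<phi> x\<bar> \<le> B) \<longrightarrow>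
      \<not> (AE x in leb_n n. \<phi> x = 0) \<longrightarrow>
      A > 0 \<longrightarrow>
      (\<forall>t::real. (\<lambda>x. exp (\<i> * complex_of_real (t * \<phi> x))) \<in> multipliers n p \<and>
                 multiplier_norm n p (\<lambda>x. exp (\<i> * complex_of_real (t * \<phi> x))) \<le> A) \<longrightarrow>
      (\<lambda>x. complex_of_real (\<phi> x)) \<in> multipliers n p \<and>
      1 \<le> multiplier_norm n p (\<lambda>x. complex_of_real (\<phi> x)) / Linf_norm n \<phi> \<and>
      multiplier_norm n p (\<lambda>x. complex_of_real (\<phi> x)) / Linf_norm n \<phi> \<le> pi / 2 * A\<^sup>2"
  proof (intro allI impI)
    fix n :: nat and p A :: real and \<phi> :: "(nat \<Rightarrow> real) \<Rightarrow> real"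
    assume p: "1 < p" and \<phi>: "\<phi> \<in> borel_measurable (leb_n n)" "\<exists>B. \<forall>x\<in>Rn n. \<bar>\<phi> x\<bar> \<le> B"
        "\<not> (AE x in leb_n n. \<phi> x = 0)"
      and A: "\<forall>t::real. (\<lambda>x. exp (\<i> * complex_of_real (t * \<phi> x))) \<in> multipliers n p \<and>
                 multiplier_norm n p (\<lambda>x. exp (\<i> * complex_of_real (t * \<phi> x))) \<le> A"
    obtain B where "\<And>x. x \<in> Rn n \<Longrightarrow> \<bar>\<phi> x\<bar> \<le> B" using \<phi>(2) by blast
    note est = exponential_multiplier_estimate[OF less_imp_le[OF p] \<phi>(1) this \<phi>(3) conjunct1[OF spec[OF A]] conjunct2[OF spec[OF A]]]
    show "(\<lambda>x. complex_of_real (\<phi> x)) \<in> multipliers n p \<and>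
      1 \<le> multiplier_norm n p (\<lambda>x. complex_of_real (\<phi> x)) / Linf_norm n \<phi> \<and>
      multiplier_norm n p (\<lambda>x. complex_of_real (\<phi> x)) / Linf_norm n \<phi> \<le> pi / 2 * A\<^sup>2"
      by (intro conjI est)
  qed
qed

end
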